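(* Let $N\ge 2$, $p\in(2,2^* )$, let $\varepsilon_n\in(0,\frac12)$ with $\varepsilon_n\to 0$ and, for each $n$, let $u_n$ be a positive solution to $$-\Delta u+u=Q_{\varepsilon_n}(x)|u|^{p-2}u,\qquad u\in H^1(\mathbb{R}^N).$$ Then there exist $y_n\in\mathbb{Z}^N$ such that, after replacing $u_n$ by its translate $u_n(\,\cdot\,+y_n)$ (still denoted $u_n$), the following holds: for any open bounded subset $U$ of $\mathbb{R}^N$ such that $U\supset[-\frac12,\frac12]^N$ and $\partial U\cap\mathbb{Z}^N=\emptyset$, and any $0<\delta<\min\{\frac12,\ \mathrm{dist}(U\cap\mathbb{Z}^N,\partial U)\}$, we have $$\lim_{n\to\infty}\frac{\sum_{y\in U\cap\mathbb{Z}^N}\int_{B_\delta(y)}(|\nabla u_n|^2+u_n^2)}{\int_U(|\nabla u_n|^2+u_n^2)}=1\qquad\text{and}\qquad\lim_{n\to\infty}\frac{\sum_{y\in U\cap\mathbb{Z}^N}\int_{B_\delta(y)}|u_n|^p}{\int_U|u_n|^p}=1.$$ Moreover, $\|u_n\|_{H^1(U)}\to\infty$ as $n\to\infty$.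
   Context: Here $2^*:=\frac{2N}{N-2}$ if $N\ge 3$ and $2^*:=\infty$ if $N=2$. $B_r(x)$ denotes the ball of radius $r$ centered at $x$ in $\mathbb{R}^N$. For $\varepsilon\in(0,\frac12)$, $\Theta_\varepsilon:=\bigcup_{y\in\mathbb{Z}^N}B_\varepsilon(y)$, and $Q_\varepsilon:\mathbb{R}^N\to\mathbb{R}$ is defined by $Q_\varepsilon(x)=1$ if $x\in\Theta_\varepsilon$ and $Q_\varepsilon(x)=-1$ otherwise; $Q_\varepsilon$ is $\mathbb{Z}^N$-periodic, so translates of solutions by elements of $\mathbb{Z}^N$ are again solutions. A solution is a weak solution: $u\in H^1(\mathbb{R}^N)$ with $\int_{\mathbb{R}^N}(\nabla u\cdot\nabla v+uv)=\int_{\mathbb{R}^N}Q_\varepsilon|u|^{p-2}uv$ for all $v\in H^1(\mathbb{R}^N)$. It is positive if $u>0$ in $\mathbb{R}^N$ (with $u$ identified with its continuous representative). For an open set $U$, $\|u\|_{H^1(U)}^2:=\int_U(|\nabla u|^2+u^2)$. *)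

theory Defs
  imports "HOL-Analysis.Analysis"
begin

definition critical_exponent :: "nat \<Rightarrow> ereal" where
  "critical_exponent N = (if N \<ge> 3 then ereal (2 * real N / (real N - 2)) else \<infinity>)"

definition int_lattice :: "(real ^ 'n) set" where
  "int_lattice = {y. \<forall>i. y $ i \<in> \<int>}"

definition Theta :: "real \<Rightarrow> (real ^ 'n) set" where
  "Theta \<epsilon> = (\<Union>y\<in>int_lattice. ball y \<epsilon>)"

definition Q :: "real \<Rightarrow> real ^ 'n \<Rightarrow> real" where
  "Q \<epsilon> x = (if x \<in> Theta \<epsilon> then 1 else - 1)"

definition partial_deriv :: "'n \<Rightarrow> (real ^ 'n \<Rightarrow> real) \<Rightarrow> real ^ 'n \<Rightarrow> real" where
  "partial_deriv i f x = frechet_derivative f (at x) (axis i 1)"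

primrec C_k :: "nat \<Rightarrow> (real ^ 'n \<Rightarrow> real) \<Rightarrow> bool" where
  "C_k 0 f \<longleftrightarrow> continuous_on UNIV f"
| "C_k (Suc k) f \<longleftrightarrow> f differentiable_on UNIV \<and> (\<forall>i. C_k k (partial_deriv i f))"

definition test_function :: "(real ^ 'n \<Rightarrow> real) \<Rightarrow> bool" where
  "test_function \<phi> \<longleftrightarrow> (\<forall>k. C_k k \<phi>) \<and> compact (closure {x. \<phi> x \<noteq> 0})"

definition L2 :: "(real ^ 'n \<Rightarrow> 'b::euclidean_space) set" where
  "L2 = {f. f \<in> borel_measurable lebesgue \<and> integrable lebesgue (\<lambda>x. (norm (f x))\<^sup>2)}"

text \<open>Functions stand for their classes modulo equality almost everywhere. The square
  integrability of \<open>u\<close> and \<open>g\<close> makes both integrals below genuine ones.\<close>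

definition has_weak_gradient ::
    "(real ^ 'n \<Rightarrow> real) \<Rightarrow> (real ^ 'n \<Rightarrow> real ^ 'n) \<Rightarrow> bool" where
  "has_weak_gradient u g \<longleftrightarrow> u \<in> L2 \<and> g \<in> L2 \<and>
     (\<forall>\<phi> i. test_function \<phi> \<longrightarrow>
        (LINT x|lebesgue. u x * partial_deriv i \<phi> x) = - (LINT x|lebesgue. g x $ i * \<phi> x))"

definition H1 :: "(real ^ 'n \<Rightarrow> real) set" where
  "H1 = {u. \<exists>g. has_weak_gradient u g}"

text \<open>The weak gradient is determined only up to a null set; it is used only under integrals.\<close>

definition weak_grad :: "(real ^ 'n \<Rightarrow> real) \<Rightarrow> real ^ 'n \<Rightarrow> real ^ 'n" where
  "weak_grad u = (SOME g. has_weak_gradient u g)"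

definition H1_energy :: "(real ^ 'n) set \<Rightarrow> (real ^ 'n \<Rightarrow> real) \<Rightarrow> real" where
  "H1_energy S u = (LINT x:S|lebesgue. (norm (weak_grad u x))\<^sup>2 + (u x)\<^sup>2)"

definition H1_norm :: "(real ^ 'n) set \<Rightarrow> (real ^ 'n \<Rightarrow> real) \<Rightarrow> real" where
  "H1_norm S u = sqrt (H1_energy S u)"

text \<open>For \<open>2 < p\<close> below the critical exponent, the integrand on the right-hand side is integrable
  for all \<open>u, v \<in> H1\<close> by the Sobolev embedding, so integrability is not demanded separately.\<close>

definition weak_solution :: "real \<Rightarrow> real \<Rightarrow> (real ^ 'n \<Rightarrow> real) \<Rightarrow> bool" where
  "weak_solution p \<epsilon> u \<longleftrightarrow> u \<in> H1 \<and>
     (\<forall>v\<in>H1. (LINT x|lebesgue. weak_grad u x \<bullet> weak_grad v x + u x * v x) =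
              (LINT x|lebesgue. Q \<epsilon> x * \<bar>u x\<bar> powr (p - 2) * u x * v x))"

text \<open>Continuity records that \<open>u\<close> is the continuous representative of its class.\<close>

definition positive_solution :: "real \<Rightarrow> real \<Rightarrow> (real ^ 'n \<Rightarrow> real) \<Rightarrow> bool" where
  "positive_solution p \<epsilon> u \<longleftrightarrow>
     weak_solution p \<epsilon> u \<and> continuous_on UNIV u \<and> (\<forall>x. u x > 0)"

end

theory Submission
  imports Defs
begin

text \<open>
  Away from the lattice the nonlinearity is absorbing, so testing the equation with \<open>\<eta> ^ k * u\<close> bounds
  the energy and the \<open>L\<^sup>p\<close> norm on compact sets that avoid \<open>int_lattice\<close>, independently of \<open>u\<close>.
  It thus suffices that the energy in \<open>U\<close> tends to infinity; the \<open>L\<^sup>p\<close> norm then follows by testing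
  with \<open>\<eta>\<^sup>2 * u\<close>. Testing with \<open>u\<close> itself gives total energy at most the integral of \<open>u ^ p\<close> over
  the small balls, so by pigeonhole some unit cell has energy \<open>E\<close> at most that integral over its own
  small ball; translate this cell to the origin. By the subcritical Sobolev inequality the latter integral is at most
  \<open>o(1) * E ^ (p / 2)\<close>, and \<open>p > 2\<close> forces \<open>E\<close> to infinity.

  The Sobolev inequality is obtained from averages at scale \<open>1 / r\<close>: the derivative in \<open>r\<close> of an average
  is a divergence and so is controlled by the weak gradient. This bounds the averages pointwise and their
  distance to the function in \<open>L\<^sup>2\<close>; comparing level sets at dyadic heights gives the rest.
\<close>

subsection \<open>Smooth functions and test functions\<close>

text \<open>The bound on \<open>p\<close> enters through one count of exponents. Let N be
  \<open>CARD('n)\<close> and let \<open>v\<close> have energy at most 1. The derivative in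
  \<open>r\<close> of its averages is of order r^(N/2 - 2), so averages at scale 1/R are of order
  R^\<beta> for any positive \<beta> \<ge> N/2 - 1, and their L2 distance to \<open>v\<close> is of
  order 1/R. At height L take R with R^\<beta> comparable to L: the average is then at most half of
  |v| wherever |v| > L, so the layer L < |v| \<le> 2 L contributes at most a multiple of L^(p-2)
  R^(-2), that is of L^(p - 2 - 2/\<beta>). The dyadic sum converges if \<beta> (p-2) < 2, and for
  \<beta> = N/2 - 1 this is p < 2N/(N-2). For N = 2 that value is 0 and the derivative integrates to
  a logarithm, so a larger \<beta> is taken.

  The tail above L is therefore small uniformly in \<open>v\<close>, while below L the integral over
  a small ball is at most L^p times its volume. This is the source of the o(1), and no compact
  embedding is involved.\<close>

lemma partial_deriv_eq:
  assumes "(f has_derivative D) (at x)"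
  shows "partial_deriv i f x = D (axis i 1)"
  unfolding partial_deriv_def using assms by (metis frechet_derivative_at)

lemma C_k_imp_continuous: "C_k k f \<Longrightarrow> continuous_on UNIV f"
  by (cases k) (simp_all add: differentiable_imp_continuous_on)

lemma C_k_Suc_imp: "C_k (Suc k) f \<Longrightarrow> C_k k f"
proof (induction k arbitrary: f)
  case 0
  then show ?case by (simp only: C_k.simps(1) C_k_imp_continuous)
next
  case (Suc k)
  then show ?case by (metis C_k.simps(2))
qed

lemma C_k_const: "C_k k (\<lambda>_. c)"
proof (induction k arbitrary: c)
  case (Suc k)
  have "partial_deriv i (\<lambda>_::real^'a. c) = (\<lambda>_. 0)" for i :: 'a
    by (rule ext) (rule partial_deriv_eq, rule has_derivative_const)
  then show ?case using Suc by simp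
qed simp

lemma C_k_Suc_has_derivative:
  assumes "C_k (Suc k) f"
  shows "(f has_derivative frechet_derivative f (at x)) (at x)"
  using assms by (simp add: differentiable_on_def frechet_derivative_works)

lemma C_k_add: "C_k k f \<Longrightarrow> C_k k g \<Longrightarrow> C_k k (\<lambda>x. f x + g x)"
proof (induction k arbitrary: f g)
  case (Suc k)
  note D = C_k_Suc_has_derivative[OF Suc.prems(1)] C_k_Suc_has_derivative[OF Suc.prems(2)]
  have "partial_deriv i (\<lambda>x. f x + g x) = (\<lambda>x. partial_deriv i f x + partial_deriv i g x)" for i
    by (rule ext, subst partial_deriv_eq, rule has_derivative_add, rule D, rule D)
       (simp add: partial_deriv_def)
  then show ?case using Suc by simp
qed (auto intro: continuous_intros)

lemma C_k_mult: "C_k k f \<Longrightarrow> C_k k g \<Longrightarrow> C_k k (\<lambda>x. f x * g x)"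
proof (induction k arbitrary: f g)
  case (Suc k)
  note D = C_k_Suc_has_derivative[OF Suc.prems(1)] C_k_Suc_has_derivative[OF Suc.prems(2)]
  have "partial_deriv i (\<lambda>x. f x * g x) = (\<lambda>x. f x * partial_deriv i g x + partial_deriv i f x * g x)" for i
    by (rule ext, subst partial_deriv_eq, rule has_derivative_mult, rule D, rule D)
       (simp add: partial_deriv_def)
  moreover have "C_k k f" "C_k k g" using Suc.prems C_k_Suc_imp by auto
  ultimately show ?case using Suc by (auto simp: differentiable_on_mult intro!: C_k_add)
qed (auto intro: continuous_intros)

lemma C_k_power: "C_k k f \<Longrightarrow> C_k k (\<lambda>x. f x ^ m)"
  by (induction m) (auto intro: C_k_const C_k_mult)

lemma C_k_cmult: "C_k k f \<Longrightarrow> C_k k (\<lambda>x. c * f x)"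
  using C_k_mult[OF C_k_const] .

lemma C_k_sum: "(\<And>i. i \<in> I \<Longrightarrow> C_k k (f i)) \<Longrightarrow> C_k k (\<lambda>x. \<Sum>i\<in>I. f i x)"
  by (induction I rule: infinite_finite_induct) (auto intro: C_k_const C_k_add)

lemma C_k_prod: "(\<And>i. i \<in> I \<Longrightarrow> C_k k (f i)) \<Longrightarrow> C_k k (\<lambda>x. \<Prod>i\<in>I. f i x)"
  by (induction I rule: infinite_finite_induct) (auto intro: C_k_const C_k_mult)

lemma partial_deriv_affine:
  assumes "f differentiable at (c *\<^sub>R x + a)"
  shows "(\<lambda>x. f (c *\<^sub>R x + a)) differentiable at x"
    and "partial_deriv i (\<lambda>x. f (c *\<^sub>R x + a)) x = c * partial_deriv i f (c *\<^sub>R x + a)"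
proof -
  note f = assms[unfolded frechet_derivative_works]
  have "((\<lambda>x. c *\<^sub>R x + a) has_derivative (\<lambda>h. c *\<^sub>R h)) (at x)" by (auto intro!: derivative_eq_intros)
  note D = has_derivative_compose[OF this f]
  show "(\<lambda>x. f (c *\<^sub>R x + a)) differentiable at x" using D by (auto simp: differentiable_def)
  show "partial_deriv i (\<lambda>x. f (c *\<^sub>R x + a)) x = c * partial_deriv i f (c *\<^sub>R x + a)"
    using partial_deriv_eq[OF D, of i] has_derivative_linear[OF f] by (simp add: linear_cmul partial_deriv_def)
qed

lemma C_k_affine: "C_k k f \<Longrightarrow> C_k k (\<lambda>x. f (c *\<^sub>R x + a))"
proof (induction k arbitrary: f)
  case 0
  then show ?case
    by (auto intro!: continuous_intros elim!: continuous_on_compose2)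
next
  case (Suc k)
  have d: "f differentiable at x" for x using Suc.prems by (simp add: differentiable_on_def)
  have "partial_deriv i (\<lambda>x. f (c *\<^sub>R x + a)) = (\<lambda>x. c * partial_deriv i f (c *\<^sub>R x + a))" for i
    by (intro ext partial_deriv_affine(2) d)
  then show ?case
    using Suc by (simp add: differentiable_on_def partial_deriv_affine(1)[OF d] C_k_cmult)
qed

text \<open>Differentiation moves along the chain \<open>D 0\<close>, \<open>D 1\<close>, ..., so
  the claim becomes closed under \<open>partial_deriv\<close> once it is made for all members of the
  chain simultaneously.\<close>

lemma C_k_coord:
  assumes "\<And>j t. (D j has_real_derivative D (Suc j) t) (at t)"
  shows "C_k k (\<lambda>x. D j (x $ i))"
proof (induction k arbitrary: j)
  case 0
  have "continuous_on UNIV (D j)"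
    using assms by (meson DERIV_isCont continuous_at_imp_continuous_on)
  then show ?case
    by (auto intro!: continuous_intros elim!: continuous_on_compose2)
next
  case (Suc k)
  have D: "((\<lambda>x. D j (x $ i)) has_derivative (\<lambda>h. D (Suc j) (x $ i) * h $ i)) (at x)" for x :: "real^'a"
    by (rule has_derivative_compose[OF bounded_linear.has_derivative[OF bounded_linear_vec_nth, OF has_derivative_ident]
          assms[unfolded has_field_derivative_def]])
  have "partial_deriv l (\<lambda>x. D j (x $ i)) = (\<lambda>x. (if l = i then 1 else 0) * D (Suc j) (x $ i))" for l
    by (rule ext) (simp add: partial_deriv_eq[OF D] axis_def)
  moreover have "(\<lambda>x. D j (x $ i)) differentiable_on UNIV"
    using D by (auto simp: differentiable_on_def differentiable_def)
  ultimately show ?case using Suc by (auto intro: C_k_cmult C_k_const)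
qed

lemma C_k_nth: "C_k k (\<lambda>x. x $ i)"
proof -
  define D :: "nat \<Rightarrow> real \<Rightarrow> real" where "D = (\<lambda>j t. if j = 0 then t else if j = 1 then 1 else 0)"
  have "(D j has_real_derivative D (Suc j) t) (at t)" for j t
    by (cases "j = 0"; cases "j = 1") (auto simp: D_def)
  from C_k_coord[of D, OF this, where j = 0] show ?thesis by (simp add: D_def)
qed

text \<open>The derivatives of \<open>exp (- 1 / t)\<close> on \<open>t > 0\<close> are polynomials in \<open>1 / t\<close> times this function.\<close>

fun flat_poly :: "nat \<Rightarrow> real poly" where
  "flat_poly 0 = 1"
| "flat_poly (Suc j) = [:0, 0, 1:] * (flat_poly j - pderiv (flat_poly j))"

definition flat_deriv :: "nat \<Rightarrow> real \<Rightarrow> real" where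
  "flat_deriv j t = (if t > 0 then poly (flat_poly j) (1 / t) * exp (- (1 / t)) else 0)"

abbreviation flat :: "real \<Rightarrow> real" where
  "flat \<equiv> flat_deriv 0"

lemma tendsto_poly_div_exp_0: "((\<lambda>x. poly q x * exp (- x)) \<longlongrightarrow> (0::real)) at_top"
proof -
  have "((\<lambda>x. \<Sum>i\<le>degree q. coeff q i * (x ^ i / exp x)) \<longlongrightarrow> (\<Sum>i\<le>degree q. coeff q i * 0)) at_top"
    by (intro tendsto_intros tendsto_power_div_exp_0)
  then show ?thesis
    by (simp add: poly_altdef sum_distrib_right exp_minus divide_inverse mult.assoc)
qed

lemma flat_deriv_derivative: "(flat_deriv j has_real_derivative flat_deriv (Suc j) t) (at t)"
proof -
  consider "t > 0" | "t < 0" | "t = 0" by linarith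
  then show ?thesis
  proof cases
    case 1
    have "((\<lambda>t. poly (flat_poly j) (1 / t) * exp (- (1 / t))) has_real_derivative flat_deriv (Suc j) t) (at t)"
      using 1 by (auto intro!: derivative_eq_intros simp: flat_deriv_def field_simps power2_eq_square)
    then show ?thesis
      by (rule has_field_derivative_transform_within_open[of _ _ _ "{0<..}"])
         (use 1 in \<open>auto simp: flat_deriv_def\<close>)
  next
    case 2
    have "((\<lambda>t. 0) has_real_derivative flat_deriv (Suc j) t) (at t)"
      using 2 by (simp add: flat_deriv_def)
    then show ?thesis
      by (rule has_field_derivative_transform_within_open[of _ _ _ "{..<0}"])
         (use 2 in \<open>auto simp: flat_deriv_def\<close>)
  next
    case 3
    have r: "((\<lambda>h. flat_deriv j h / h) \<longlongrightarrow> 0) (at_right 0)"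
    proof -
      \<comment> \<open>With s = 1/h the difference quotient is s q(s) exp(-s), where q is
        \<open>flat_poly j\<close>; the factor \<open>[:0, 1:]\<close> is the division by h.\<close>
      have "((\<lambda>h. poly ([:0, 1:] * flat_poly j) (inverse h) * exp (- inverse h)) \<longlongrightarrow> 0) (at_right 0)"
        by (rule filterlim_compose[OF tendsto_poly_div_exp_0 filterlim_inverse_at_top_right])
      then show ?thesis
        by (rule Lim_transform_eventually)
           (auto simp: flat_deriv_def eventually_at_right_less field_simps intro: eventually_at_rightI[of 0 1])
    qed
    have l: "((\<lambda>h. flat_deriv j h / h) \<longlongrightarrow> 0) (at_left 0)"
      by (rule Lim_transform_eventually[OF tendsto_const])
         (auto simp: flat_deriv_def intro: eventually_at_leftI[of "-1"])
    from l r have "((\<lambda>h. flat_deriv j h / h) \<longlongrightarrow> 0) (at 0)"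
      by (simp add: filterlim_at_split)
    then show ?thesis
      using 3 by (simp add: DERIV_def flat_deriv_def)
  qed
qed

lemma flat_nonneg: "0 \<le> flat t" and flat_le_1: "flat t \<le> 1"
  and flat_pos_iff: "0 < flat t \<longleftrightarrow> 0 < t" and flat_eq_0: "t \<le> 0 \<Longrightarrow> flat t = 0"
  by (auto simp: flat_deriv_def)

definition smooth :: "(real ^ 'n \<Rightarrow> real) \<Rightarrow> bool" where
  "smooth f \<longleftrightarrow> (\<forall>k. C_k k f)"

lemma smooth_const: "smooth (\<lambda>_. c)"
  and smooth_nth: "smooth (\<lambda>x. x $ i)"
  and smooth_mult: "smooth f \<Longrightarrow> smooth g \<Longrightarrow> smooth (\<lambda>x. f x * g x)"
  and smooth_power: "smooth f \<Longrightarrow> smooth (\<lambda>x. f x ^ m)"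
  and smooth_affine: "smooth f \<Longrightarrow> smooth (\<lambda>x. f (c *\<^sub>R x + a))"
  by (auto simp: smooth_def intro: C_k_const C_k_nth C_k_mult C_k_power C_k_affine)

lemma smooth_sum: "(\<And>i. i \<in> I \<Longrightarrow> smooth (F i)) \<Longrightarrow> smooth (\<lambda>x. \<Sum>i\<in>I. F i x)"
  and smooth_prod: "(\<And>i. i \<in> I \<Longrightarrow> smooth (F i)) \<Longrightarrow> smooth (\<lambda>x. \<Prod>i\<in>I. F i x)"
  by (auto simp: smooth_def intro: C_k_sum C_k_prod)

lemma smooth_continuous: "smooth f \<Longrightarrow> continuous_on UNIV f"
  by (auto simp: smooth_def intro: C_k_imp_continuous)

lemma smooth_partial_deriv: "smooth f \<Longrightarrow> smooth (partial_deriv i f)"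
  unfolding smooth_def by (metis C_k.simps(2))

lemma smooth_has_derivative:
  assumes "smooth f"
  shows "(f has_derivative frechet_derivative f (at x)) (at x)"
  using assms C_k_Suc_has_derivative unfolding smooth_def by blast

lemma smooth_differentiable: "smooth f \<Longrightarrow> f differentiable at x"
  using smooth_has_derivative[of f x] by (auto simp: differentiable_def)

lemma smooth_flat: "smooth (\<lambda>x. flat (c * (x $ i) + a))"
proof -
  have "smooth (\<lambda>x. flat (x $ i))"
    unfolding smooth_def by (intro allI C_k_coord flat_deriv_derivative)
  from smooth_affine[OF this, of c "\<chi> i. a"] show ?thesis by simp
qed

lemma partial_deriv_mult:
  assumes "smooth f" "smooth g"
  shows "partial_deriv i (\<lambda>x. f x * g x) x = f x * partial_deriv i g x + partial_deriv i f x * g x"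
  by (subst partial_deriv_eq, rule has_derivative_mult, (rule smooth_has_derivative assms)+)
     (simp add: partial_deriv_def)

lemma test_function_smooth: "test_function f \<Longrightarrow> smooth f"
  by (simp add: test_function_def smooth_def)

lemma compact_closure_subset:
  fixes K :: "'a::heine_borel set"
  assumes "compact K" "S \<subseteq> K"
  shows "compact (closure S)"
  using bounded_subset[OF compact_imp_bounded[OF assms(1)] assms(2)] by (simp add: compact_closure)

lemma test_functionI:
  assumes "smooth f" "compact K" "\<And>x. f x \<noteq> 0 \<Longrightarrow> x \<in> K"
  shows "test_function f"
  using assms(1) compact_closure_subset[OF assms(2), of "{x. f x \<noteq> 0}"] assms(3)
  unfolding test_function_def smooth_def by blast

lemma test_function_support:
  assumes "test_function f"
  shows "compact (closure {x. f x \<noteq> 0})" "f x \<noteq> 0 \<Longrightarrow> x \<in> closure {x. f x \<noteq> 0}"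
  using assms closure_subset[of "{x. f x \<noteq> 0}"] by (auto simp: test_function_def simp del: compact_closure)

lemma test_function_affine:
  assumes "test_function \<phi>" "c \<noteq> 0"
  shows "test_function (\<lambda>x. \<phi> (c *\<^sub>R x + a))"
proof (rule test_functionI)
  show "smooth (\<lambda>x. \<phi> (c *\<^sub>R x + a))"
    by (rule smooth_affine[OF test_function_smooth[OF assms(1)]])
  show "compact ((\<lambda>x. (1 / c) *\<^sub>R (x - a)) ` closure {x. \<phi> x \<noteq> 0})"
    by (intro compact_continuous_image continuous_intros test_function_support(1)[OF assms(1)])
  show "x \<in> (\<lambda>x. (1 / c) *\<^sub>R (x - a)) ` closure {x. \<phi> x \<noteq> 0}" if "\<phi> (c *\<^sub>R x + a) \<noteq> 0" for x
    using test_function_support(2)[OF assms(1) that] assms(2) by (auto intro: rev_image_eqI)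
qed

lemma test_function_mult: "smooth f \<Longrightarrow> test_function g \<Longrightarrow> test_function (\<lambda>x. f x * g x)"
  by (rule test_functionI[OF _ test_function_support(1)[of g]])
     (simp_all add: smooth_mult test_function_smooth test_function_support(2) del: compact_closure)

lemma partial_deriv_eq_0:
  assumes "x \<notin> closure {x. f x \<noteq> 0}"
  shows "partial_deriv i f x = 0"
proof -
  have "((\<lambda>x. 0) has_derivative (\<lambda>h. 0)) (at x)" by simp
  then have "(f has_derivative (\<lambda>h. 0)) (at x)"
    by (rule has_derivative_transform_within_open[of _ _ _ _ "- closure {x. f x \<noteq> 0}"])
       (use assms closure_subset[of "{x. f x \<noteq> 0}"] in auto)
  then show ?thesis by (simp add: partial_deriv_eq)
qed

lemma test_function_partial_deriv:
  assumes "test_function f"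
  shows "test_function (partial_deriv i f)"
proof (rule test_functionI[OF _ test_function_support(1)[OF assms]])
  show "smooth (partial_deriv i f)"
    using assms by (intro smooth_partial_deriv test_function_smooth)
qed (use partial_deriv_eq_0 in blast)

lemma test_function_bounded:
  assumes "test_function f"
  obtains B where "\<And>x. \<bar>f x\<bar> \<le> B" "B > 0"
proof -
  let ?S = "closure {x. f x \<noteq> 0}"
  have "compact (f ` ?S)"
    using assms by (intro compact_continuous_image continuous_on_subset[OF smooth_continuous])
      (simp_all add: test_function_smooth test_function_support del: compact_closure)
  then obtain B where B: "B > 0" "\<forall>y\<in>f ` ?S. norm y \<le> B"
    using bounded_pos compact_imp_bounded by blast
  have "\<bar>f x\<bar> \<le> B" for x
  proof (cases "f x = 0")
    case False
    then have "x \<in> ?S" by (rule test_function_support(2)[OF assms])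
    then show ?thesis using B by auto
  qed (use B in auto)
  with B(1) that show ?thesis by blast
qed

section \<open>Bumps on boxes and cutoffs near compact sets\<close>

text \<open>The parameter \<open>m\<close> is a steepness: as it grows the bumps tend to the
  indicator of the open box, which later lets test functions detect integrals over boxes. For
  cutoffs \<open>m = 1\<close> is enough.\<close>

definition box_bump :: "real \<Rightarrow> real ^ 'n \<Rightarrow> real ^ 'n \<Rightarrow> real ^ 'n \<Rightarrow> real" where
  "box_bump m a b x = (\<Prod>i\<in>UNIV. flat (m * (x $ i - a $ i)) * flat (m * (b $ i - x $ i)))"

lemma box_bump_nonneg: "0 \<le> box_bump m a b x"
  unfolding box_bump_def by (intro prod_nonneg) (auto simp: flat_nonneg)

lemma box_bump_le_1: "box_bump m a b x \<le> 1"
  unfolding box_bump_def by (intro prod_le_1) (auto simp: flat_nonneg flat_le_1 intro: mult_le_one)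

lemma box_bump_pos: "0 < m \<Longrightarrow> x \<in> box a b \<Longrightarrow> 0 < box_bump m a b x"
  unfolding box_bump_def by (intro prod_pos) (auto simp: flat_pos_iff mem_box_cart)

lemma box_bump_eq_0: "0 < m \<Longrightarrow> x \<notin> box a b \<Longrightarrow> box_bump m a b x = 0"
  unfolding box_bump_def
  by (auto simp: mem_box_cart not_less prod_zero_iff intro!: flat_eq_0 mult_nonneg_nonpos)

lemma test_function_box_bump:
  assumes "0 < m"
  shows "test_function (box_bump m a b)"
proof (rule test_functionI[of _ "cbox a b"])
  have "smooth (\<lambda>x. \<Prod>i\<in>UNIV. flat (m * (x $ i) + (- m * a $ i)) * flat ((- m) * (x $ i) + m * b $ i))"
    by (intro smooth_prod smooth_mult smooth_flat)
  then show "smooth (box_bump m a b)"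
    unfolding box_bump_def by (simp add: algebra_simps)
qed (use box_bump_eq_0[OF assms] box_subset_cbox[of a b] in \<open>auto simp: compact_cbox\<close>)

lemma box_bump_tendsto: "(\<lambda>m. box_bump (real (Suc m)) a b x) \<longlonglongrightarrow> indicator (box a b) x"
proof (cases "x \<in> box a b")
  case True
  have f: "(\<lambda>m. flat (real (Suc m) * t)) \<longlonglongrightarrow> 1" if "t > 0" for t
  proof -
    have "(\<lambda>m. exp (- ((1 / t) * inverse (real (Suc m))))) \<longlonglongrightarrow> exp (- ((1 / t) * 0))"
      by (intro tendsto_intros LIMSEQ_inverse_real_of_nat)
    moreover have "flat (real (Suc m) * t) = exp (- ((1 / t) * inverse (real (Suc m))))" for m
      using that by (simp add: flat_deriv_def field_simps add_pos_nonneg)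
    ultimately show ?thesis by simp
  qed
  have "(\<lambda>m. box_bump (real (Suc m)) a b x) \<longlonglongrightarrow> (\<Prod>i\<in>(UNIV::'a set). 1 * 1)"
    unfolding box_bump_def using True by (intro tendsto_intros f) (auto simp: mem_box_cart)
  then show ?thesis using True by simp
next
  case False
  then have "box_bump (real (Suc m)) a b x = 0" for m by (intro box_bump_eq_0) auto
  then show ?thesis using False by simp
qed

text \<open>A finite sum of box bumps is positive on the compact \<open>K\<close>, hence bounded
  below there, and is divided by that bound. The result may exceed 1, which is harmless: the
  estimates use a lower bound on \<open>K\<close> and some upper bound everywhere.\<close>

lemma test_function_bump:
  fixes K V :: "(real ^ 'n) set"
  assumes "compact K" "open V" "K \<subseteq> V"
  obtains \<eta> where "test_function \<eta>" "\<And>x. 0 \<le> \<eta> x" "\<And>x. x \<in> K \<Longrightarrow> 1 \<le> \<eta> x"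
    "closure {x. \<eta> x \<noteq> 0} \<subseteq> V"
proof -
  have "\<exists>a b. x \<in> box a b \<and> cbox a b \<subseteq> V" if "x \<in> K" for x
    using open_contains_cbox[of V] assms that by (metis subsetD)
  then obtain a b where ab: "\<And>x. x \<in> K \<Longrightarrow> x \<in> box (a x) (b x) \<and> cbox (a x) (b x) \<subseteq> V"
    by metis
  have "K \<subseteq> (\<Union>x\<in>K. box (a x) (b x))" using ab by blast
  then obtain F where F: "F \<subseteq> K" "finite F" "K \<subseteq> (\<Union>x\<in>F. box (a x) (b x))"
    using compactE_image[OF assms(1), of K "\<lambda>x. box (a x) (b x)"] by auto
  define f where "f = (\<lambda>x. \<Sum>y\<in>F. box_bump 1 (a y) (b y) x)"
  have f0: "0 \<le> f x" for x unfolding f_def by (intro sum_nonneg box_bump_nonneg)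
  have fp: "0 < f x" if x: "x \<in> K" for x
  proof -
    obtain y where "y \<in> F" "x \<in> box (a y) (b y)" using F x by blast
    then show ?thesis unfolding f_def using F
      by (intro sum_pos2[of _ y] box_bump_nonneg box_bump_pos) auto
  qed
  define C where "C = (\<Union>y\<in>F. cbox (a y) (b y))"
  have C: "compact C" "C \<subseteq> V" "closed C"
    unfolding C_def using F ab by (auto intro!: compact_UN compact_cbox compact_imp_closed)
  have fC: "x \<in> C" if x: "f x \<noteq> 0" for x
  proof -
    obtain y where "y \<in> F" "box_bump 1 (a y) (b y) x \<noteq> 0"
      using x sum.neutral[of F "\<lambda>y. box_bump 1 (a y) (b y) x"] unfolding f_def by blast
    then have "x \<in> box (a y) (b y)" using box_bump_eq_0[of 1 x] by force
    then show ?thesis unfolding C_def using \<open>y \<in> F\<close> box_subset_cbox by blast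
  qed
  have sm: "smooth f"
    unfolding f_def by (intro smooth_sum test_function_smooth test_function_box_bump) auto
  obtain c where c: "c > 0" "\<And>x. x \<in> K \<Longrightarrow> c \<le> f x"
  proof (cases "K = {}")
    case False
    then obtain z where "z \<in> K" "\<forall>x\<in>K. f z \<le> f x"
      using continuous_attains_inf[of K f] assms sm smooth_continuous continuous_on_subset by blast
    then show ?thesis using that fp by blast
  qed (rule that[of 1], auto)
  show ?thesis
  proof (rule that[of "\<lambda>x. (1 / c) * f x"])
    show "test_function (\<lambda>x. (1 / c) * f x)"
      by (intro test_function_mult smooth_const test_functionI[OF sm C(1)] fC)
    have "closure {x. 1 / c * f x \<noteq> 0} \<subseteq> C"
      using fC by (intro closure_minimal C) auto
    then show "closure {x. 1 / c * f x \<noteq> 0} \<subseteq> V" using C by blast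
    show "0 \<le> 1 / c * f x" for x using f0[of x] c(1) by simp
    show "1 \<le> 1 / c * f x" if "x \<in> K" for x using c(2)[OF that] c(1) by (simp add: field_simps)
  qed
qed

subsection \<open>Weak gradients\<close>

text \<open>Open boxes are stable under intersection and generate the Borel sets, so the vanishing
  spreads to all Borel sets by the pi-lambda induction. Since only Borel sets are reached,
  \<open>f\<close> is first replaced by a Borel function \<open>g\<close> that agrees with it almost
  everywhere.\<close>

lemma integrable_zero_on_boxes_AE:
  fixes f :: "'a::euclidean_space \<Rightarrow> real"
  assumes f: "integrable lebesgue f" and box: "\<And>a b. (LINT x:box a b|lebesgue. f x) = 0"
    and supp: "\<And>x. x \<notin> box c d \<Longrightarrow> f x = 0"
  shows "AE x in lebesgue. f x = 0"
proof -
  obtain g where g: "g \<in> borel_measurable lborel" "AE x in lborel. f x = g x"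
    using completion_ex_borel_measurable_real[OF borel_measurable_integrable[OF f]] by blast
  have fg: "AE x in lebesgue. f x = g x" using g(2) by (rule AE_completion)
  have ig: "integrable lborel g"
    using integrable_cong_AE_imp[OF f measurable_completion[OF g(1)] fg] integrable_completion[OF g(1)] by blast
  have eq: "(LINT x:A|lborel. g x) = (LINT x:A|lebesgue. f x)" if A: "A \<in> sets lborel" for A
  proof -
    have m: "(\<lambda>x. indicator A x *\<^sub>R g x) \<in> borel_measurable lborel"
      using A g(1) by (intro borel_measurable_scaleR borel_measurable_indicator)
    have "(LINT x:A|lborel. g x) = (LINT x:A|lebesgue. g x)"
      unfolding set_lebesgue_integral_def by (rule integral_completion[OF m, symmetric])
    also have "\<dots> = (LINT x:A|lebesgue. f x)"
      unfolding set_lebesgue_integral_def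
    proof (rule integral_cong_AE[OF measurable_completion[OF m]])
      show "(\<lambda>x. indicator A x *\<^sub>R f x) \<in> borel_measurable lebesgue"
        using A f by (intro borel_measurable_scaleR borel_measurable_indicator) auto
    qed (use fg in \<open>eventually_elim, simp\<close>)
    finally show ?thesis .
  qed
  have si: "set_integrable lborel A g" if "A \<in> sets lborel" for A
    using integrable_mult_indicator[OF that ig] by (simp add: set_integrable_def)
  \<comment> \<open>The complement step of the induction needs the integral over the whole space;
    \<open>supp\<close> turns it into an integral over a box.\<close>
  have UNIV0: "(LINT x:UNIV|lborel. g x) = 0"
  proof -
    have "(\<lambda>x. indicator UNIV x *\<^sub>R f x) = (\<lambda>x. indicator (box c d) x *\<^sub>R f x)"
      by (rule ext) (use supp in \<open>auto simp: indicator_def\<close>)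
    then have "(LINT x:UNIV|lebesgue. f x) = (LINT x:box c d|lebesgue. f x)"
      unfolding set_lebesgue_integral_def by (simp only:)
    moreover have "(LINT x:UNIV|lborel. g x) = (LINT x:UNIV|lebesgue. f x)" by (rule eq) simp
    ultimately show ?thesis by (simp only: box)
  qed
  have "(LINT x:A|lborel. g x) = 0" if "A \<in> sets lborel" for A
  proof -
    have "Int_stable (range (\<lambda>(a, b). box a b :: 'a set))"
      by (auto simp: Int_stable_def box_Int_box)
    moreover have "range (\<lambda>(a, b). box a b :: 'a set) \<subseteq> Pow UNIV" by auto
    moreover have "A \<in> sigma_sets UNIV (range (\<lambda>(a, b). box a b))"
      using that unfolding sets_lborel borel_eq_box by simp
    ultimately show ?thesis
    proof (induction rule: sigma_sets_induct_disjoint)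
      case (basic A)
      then show ?case using box eq by auto
    next
      case empty
      then show ?case by (simp add: set_lebesgue_integral_def)
    next
      case (compl A)
      then have [measurable]: "A \<in> sets borel" by (simp add: borel_eq_box)
      have "(LINT x:(UNIV - A) \<union> A|lborel. g x) = (LINT x:UNIV - A|lborel. g x) + (LINT x:A|lborel. g x)"
        by (intro set_integral_Un si) auto
      then show ?case using UNIV0 compl by simp
    next
      case (union F)
      then have [measurable]: "\<And>i. F i \<in> sets borel" by (simp add: borel_eq_box subset_eq)
      have "(LINT x:(\<Union>i. F i)|lborel. g x) = (\<Sum>i. (LINT x:(F i)|lborel. g x))"
        using union(1) by (intro lebesgue_integral_countable_add si) (auto simp: disjoint_family_on_def)
      then show ?case using union by simp
    qed
  qed
  then have "AE x in lborel. g x = 0"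
    using density_unique_real[OF ig, of "\<lambda>_. 0"] by (simp add: set_lebesgue_integral_def)
  from AE_completion[OF this] fg show ?thesis by eventually_elim simp
qed

lemma measurable_lebesgue_continuous:
  fixes f :: "'a::euclidean_space \<Rightarrow> 'b::euclidean_space"
  assumes "continuous_on UNIV f"
  shows "f \<in> borel_measurable lebesgue"
  using borel_measurable_continuous_onI[OF assms] by (intro measurable_completion) simp

lemma L2_measurable: "f \<in> L2 \<Longrightarrow> f \<in> borel_measurable lebesgue"
  and L2_integrable: "f \<in> L2 \<Longrightarrow> integrable lebesgue (\<lambda>x. (norm (f x))\<^sup>2)"
  and L2_I: "f \<in> borel_measurable lebesgue \<Longrightarrow> integrable lebesgue (\<lambda>x. (norm (f x))\<^sup>2) \<Longrightarrow> f \<in> L2"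
  by (auto simp: L2_def)

lemma L2_bound:
  assumes "f \<in> borel_measurable lebesgue" "integrable lebesgue h" "\<And>x. (norm (f x))\<^sup>2 \<le> h x"
  shows "f \<in> L2"
  by (rule L2_I[OF assms(1)], rule Bochner_Integration.integrable_bound[OF assms(2)])
     (use assms in \<open>auto intro!: AE_I2 order_trans[OF assms(3)]\<close>)

lemma L2_add:
  assumes "f \<in> L2" "g \<in> L2"
  shows "(\<lambda>x. f x + g x) \<in> L2"
proof (rule L2_bound[where h = "\<lambda>x. 2 * (norm (f x))\<^sup>2 + 2 * (norm (g x))\<^sup>2"])
  show "(norm (f x + g x))\<^sup>2 \<le> 2 * (norm (f x))\<^sup>2 + 2 * (norm (g x))\<^sup>2" for x
  proof -
    have "(norm (f x + g x))\<^sup>2 \<le> (norm (f x) + norm (g x))\<^sup>2"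
      by (intro power_mono norm_triangle_ineq) auto
    then show ?thesis using sum_squares_bound[of "norm (f x)" "norm (g x)"]
      by (simp add: power2_sum)
  qed
qed (use assms[THEN L2_measurable] assms[THEN L2_integrable] in \<open>auto intro: borel_measurable_add\<close>)

lemma L2_bounded_scaleR:
  assumes "f \<in> L2" "\<And>x. \<bar>c x\<bar> \<le> B" "c \<in> borel_measurable lebesgue"
  shows "(\<lambda>x. c x *\<^sub>R f x) \<in> L2"
proof (rule L2_bound[where h = "\<lambda>x. B\<^sup>2 * (norm (f x))\<^sup>2"])
  show "(norm (c x *\<^sub>R f x))\<^sup>2 \<le> B\<^sup>2 * (norm (f x))\<^sup>2" for x
  proof -
    have "\<bar>c x\<bar>\<^sup>2 \<le> B\<^sup>2" using assms(2)[of x] by (intro power_mono) auto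
    then show ?thesis by (simp add: power_mult_distrib mult_right_mono)
  qed
qed (use assms(3) L2_measurable[OF assms(1)] L2_integrable[OF assms(1)] in \<open>auto intro: borel_measurable_scaleR\<close>)

lemma L2_component: "f \<in> L2 \<Longrightarrow> (\<lambda>x. f x $ i) \<in> L2"
proof (rule L2_bound[where h = "\<lambda>x. (norm (f x))\<^sup>2"])
  assume f: "f \<in> L2"
  show "(\<lambda>x. f x $ i) \<in> borel_measurable lebesgue"
    using measurable_compose[OF L2_measurable[OF f], of "\<lambda>y. y $ i" borel]
    by (simp add: borel_measurable_continuous_onI continuous_on_component)
qed (simp_all add: L2_integrable power2_le_iff_abs_le Finite_Cartesian_Product.norm_nth_le)

lemma L2_inner_integrable:
  assumes "f \<in> L2" "g \<in> L2"
  shows "integrable lebesgue (\<lambda>x. f x \<bullet> g x)"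
proof (rule Bochner_Integration.integrable_bound)
  show "integrable lebesgue (\<lambda>x. (norm (f x))\<^sup>2 + (norm (g x))\<^sup>2)"
    using assms by (intro Bochner_Integration.integrable_add L2_integrable)
  show "(\<lambda>x. f x \<bullet> g x) \<in> borel_measurable lebesgue"
    using assms by (intro borel_measurable_inner L2_measurable)
  show "AE x in lebesgue. norm (f x \<bullet> g x) \<le> norm ((norm (f x))\<^sup>2 + (norm (g x))\<^sup>2)"
  proof (rule AE_I2)
    fix x
    have "\<bar>f x \<bullet> g x\<bar> \<le> norm (f x) * norm (g x)" by (rule Cauchy_Schwarz_ineq2)
    also have "\<dots> \<le> (norm (f x))\<^sup>2 + (norm (g x))\<^sup>2"
      using sum_squares_bound[of "norm (f x)" "norm (g x)"]
        mult_nonneg_nonneg[OF norm_ge_zero[of "f x"] norm_ge_zero[of "g x"]] by linarith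
    finally show "norm (f x \<bullet> g x) \<le> norm ((norm (f x))\<^sup>2 + (norm (g x))\<^sup>2)" by simp
  qed
qed

lemma L2_mult_integrable:
  fixes f g :: "real ^ 'n \<Rightarrow> real"
  shows "f \<in> L2 \<Longrightarrow> g \<in> L2 \<Longrightarrow> integrable lebesgue (\<lambda>x. f x * g x)"
  using L2_inner_integrable[of f g] by simp

lemma set_integrable_compact_continuous:
  fixes f :: "'a::euclidean_space \<Rightarrow> real"
  assumes "compact S" "continuous_on UNIV f"
  shows "set_integrable lebesgue S f"
proof -
  have "set_integrable lborel S f"
    unfolding set_integrable_def
    by (rule borel_integrable_compact[OF assms(1) continuous_on_subset[OF assms(2)]]) auto
  then show ?thesis
    unfolding set_integrable_def
    using borel_measurable_continuous_onI[OF assms(2)] borel_closed[OF compact_imp_closed[OF assms(1)]]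
    by (subst integrable_completion) (auto intro!: borel_measurable_scaleR borel_measurable_indicator)
qed

lemma integrable_compact_continuous:
  fixes f :: "'a::euclidean_space \<Rightarrow> real"
  assumes "compact S" "continuous_on UNIV f" "\<And>x. x \<notin> S \<Longrightarrow> f x = 0"
  shows "integrable lebesgue f"
proof -
  have "(\<lambda>x. indicator S x *\<^sub>R f x) = f"
    by (rule ext) (use assms(3) in \<open>auto simp: indicator_def\<close>)
  then show ?thesis using set_integrable_compact_continuous[OF assms(1,2)] by (simp only: set_integrable_def)
qed

lemma test_function_measurable: "test_function \<phi> \<Longrightarrow> \<phi> \<in> borel_measurable lebesgue"
  by (intro measurable_lebesgue_continuous smooth_continuous test_function_smooth)

lemma test_function_L2:
  assumes "test_function \<phi>"
  shows "\<phi> \<in> L2"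
proof (rule L2_I[OF test_function_measurable[OF assms]])
  show "integrable lebesgue (\<lambda>x. (norm (\<phi> x))\<^sup>2)"
  proof (rule integrable_compact_continuous[OF test_function_support(1)[OF assms]])
    show "continuous_on UNIV (\<lambda>x. (norm (\<phi> x))\<^sup>2)"
      by (intro continuous_intros smooth_continuous test_function_smooth assms)
  qed (use test_function_support(2)[OF assms] in auto)
qed

text \<open>Box bumps converge to indicators of boxes under a common integrable majorant, so all
  integrals over boxes vanish. An L2 function need not be integrable on the whole space, so the box
  criterion is applied to its restriction to a box, and countably many boxes exhaust the
  space.\<close>

lemma L2_zero_test_functions_AE:
  fixes f :: "real ^ 'n \<Rightarrow> real"
  assumes f: "f \<in> L2" and zero: "\<And>\<phi>. test_function \<phi> \<Longrightarrow> (LINT x|lebesgue. f x * \<phi> x) = 0"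
  shows "AE x in lebesgue. f x = 0"
proof -
  have int: "integrable lebesgue (\<lambda>x. indicator (box a b) x * f x)" for a b
  proof -
    have "(\<lambda>x. (norm (indicator (box a b) x :: real))\<^sup>2) = indicator (box a b)"
      by (auto simp: indicator_def)
    then have "(\<lambda>x. indicator (box a b) x :: real) \<in> L2"
      by (intro L2_I) (simp_all add: borel_measurable_indicator integrable_real_indicator emeasure_lborel_box_eq)
    from L2_mult_integrable[OF this f] show ?thesis .
  qed
  have box0: "(LINT x|lebesgue. indicator (box a b) x * f x) = 0" for a b
  proof -
    have "(\<lambda>m. LINT x|lebesgue. f x * box_bump (real (Suc m)) a b x) \<longlonglongrightarrow> (LINT x|lebesgue. f x * indicator (box a b) x)"
    proof (rule integral_dominated_convergence[where w = "\<lambda>x. \<bar>indicator (box a b) x * f x\<bar>"])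
      show "AE x in lebesgue. norm (f x * box_bump (real (Suc m)) a b x) \<le> \<bar>indicator (box a b) x * f x\<bar>" for m
      proof (rule AE_I2)
        fix x
        show "norm (f x * box_bump (real (Suc m)) a b x) \<le> \<bar>indicator (box a b) x * f x\<bar>"
          using box_bump_eq_0[of "real (Suc m)" x a b] box_bump_le_1[of "real (Suc m)" a b x]
            box_bump_nonneg[of "real (Suc m)" a b x]
          by (cases "x \<in> box a b") (auto simp: abs_mult mult_left_le)
      qed
      show "AE x in lebesgue. (\<lambda>m. f x * box_bump (real (Suc m)) a b x) \<longlonglongrightarrow> f x * indicator (box a b) x"
        by (intro AE_I2 tendsto_intros box_bump_tendsto)
      show "(\<lambda>x. f x * box_bump (real (Suc m)) a b x) \<in> borel_measurable lebesgue" for m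
        by (intro borel_measurable_times L2_measurable[OF f] test_function_measurable test_function_box_bump) simp
      show "(\<lambda>x. f x * indicator (box a b) x) \<in> borel_measurable lebesgue"
        by (intro borel_measurable_times L2_measurable[OF f] borel_measurable_indicator) simp
      show "integrable lebesgue (\<lambda>x. \<bar>indicator (box a b) x * f x\<bar>)"
        by (intro integrable_abs int)
    qed
    then show ?thesis
      by (simp add: zero test_function_box_bump LIMSEQ_const_iff mult.commute)
  qed
  have "AE x in lebesgue. indicator (box c d) x * f x = 0" for c d
  proof (rule integrable_zero_on_boxes_AE[OF int, where c = c and d = d])
    fix a b
    obtain s t where st: "box a b \<inter> box c d = box s t" using box_Int_box by blast
    have "(\<lambda>x. indicator (box a b) x *\<^sub>R (indicator (box c d) x * f x)) = (\<lambda>x. indicator (box s t) x * f x)"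
      unfolding st[symmetric] by (rule ext) (simp add: indicator_inter_arith)
    then show "(LINT x:box a b|lebesgue. indicator (box c d) x * f x) = 0"
      unfolding set_lebesgue_integral_def using box0[of s t] by (simp only:)
  qed simp
  then have "AE x in lebesgue. \<forall>n::nat. indicator (box (- (real n *\<^sub>R One)) (real n *\<^sub>R One)) x * f x = 0"
    unfolding AE_all_countable by blast
  then show ?thesis
  proof eventually_elim
    case (elim x)
    have "x \<in> (\<Union>n::nat. box (- (real n *\<^sub>R One)) (real n *\<^sub>R One))" by (simp add: UN_box_eq_UNIV)
    then obtain n :: nat where "x \<in> box (- (real n *\<^sub>R One)) (real n *\<^sub>R One)" by blast
    with elim[rule_format, of n] show ?case by simp
  qed
qed

section \<open>Uniqueness of weak gradients and the product rule\<close>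

lemma has_weak_gradient_L2:
  assumes "has_weak_gradient u g"
  shows "u \<in> L2" "g \<in> L2"
  using assms by (auto simp: has_weak_gradient_def)

lemma has_weak_gradient_unique:
  assumes g: "has_weak_gradient u g" and h: "has_weak_gradient u h"
  shows "AE x in lebesgue. g x = h x"
proof -
  note L2 = has_weak_gradient_L2[OF g] has_weak_gradient_L2[OF h]
  have "AE x in lebesgue. g x $ i + (-1) *\<^sub>R h x $ i = 0" for i
  proof (rule L2_zero_test_functions_AE)
    show "(\<lambda>x. g x $ i + (-1) *\<^sub>R h x $ i) \<in> L2"
      by (intro L2_add L2_component[OF L2(2)] L2_bounded_scaleR[OF L2_component[OF L2(4)], of _ 1]) auto
    fix \<phi> :: "real^'a \<Rightarrow> real" assume \<phi>: "test_function \<phi>"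
    have "(LINT x|lebesgue. (g x $ i + (-1) *\<^sub>R h x $ i) * \<phi> x)
        = (LINT x|lebesgue. g x $ i * \<phi> x) - (LINT x|lebesgue. h x $ i * \<phi> x)"
      using L2_mult_integrable[OF L2_component[OF L2(2)] test_function_L2[OF \<phi>]]
        L2_mult_integrable[OF L2_component[OF L2(4)] test_function_L2[OF \<phi>]]
      by (subst Bochner_Integration.integral_diff[symmetric]) (auto simp: algebra_simps)
    also have "\<dots> = 0"
      using g h \<phi> unfolding has_weak_gradient_def by (metis (no_types, lifting) add.inverse_inverse diff_self)
    finally show "(LINT x|lebesgue. (g x $ i + (-1) *\<^sub>R h x $ i) * \<phi> x) = 0" .
  qed
  then have "AE x in lebesgue. \<forall>i\<in>UNIV. g x $ i + (-1) *\<^sub>R h x $ i = 0"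
    by (intro AE_finite_allI finite)
  then show ?thesis by eventually_elim (simp add: vec_eq_iff)
qed

lemma has_weak_gradient_H1: "has_weak_gradient u g \<Longrightarrow> u \<in> H1"
  by (auto simp: H1_def)

lemma has_weak_gradient_weak_grad:
  assumes "u \<in> H1"
  shows "has_weak_gradient u (weak_grad u)"
proof -
  have "\<exists>g. has_weak_gradient u g" using assms by (simp add: H1_def)
  then show ?thesis unfolding weak_grad_def by (rule someI_ex)
qed

text \<open>This controls the choice made in \<open>weak_grad\<close>: any explicitly computed weak
  gradient may replace it under an integral.\<close>

lemma weak_grad_AE:
  assumes "has_weak_gradient u g"
  shows "AE x in lebesgue. weak_grad u x = g x"
  by (rule has_weak_gradient_unique[OF has_weak_gradient_weak_grad[OF has_weak_gradient_H1[OF assms]] assms])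

definition grad :: "(real ^ 'n \<Rightarrow> real) \<Rightarrow> real ^ 'n \<Rightarrow> real ^ 'n" where
  "grad f x = (\<chi> i. partial_deriv i f x)"

lemma grad_measurable:
  assumes "smooth f"
  shows "grad f \<in> borel_measurable lebesgue"
  unfolding grad_def
  by (intro measurable_lebesgue_continuous continuous_on_vec_lambda smooth_continuous smooth_partial_deriv assms)

lemma grad_bounded:
  assumes "test_function f"
  obtains B where "\<And>x. norm (grad f x) \<le> B" "B > 0"
proof -
  have "\<exists>B>0. \<forall>x. \<bar>partial_deriv i f x\<bar> \<le> B" for i
    using test_function_bounded[OF test_function_partial_deriv[OF assms]] by metis
  then obtain B where B: "\<And>i. B i > 0" "\<And>i x. \<bar>partial_deriv i f x\<bar> \<le> B i" by metis
  have "norm (grad f x) \<le> (\<Sum>i\<in>UNIV. B i)" for x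
  proof -
    have "norm (grad f x) \<le> (\<Sum>i\<in>UNIV. \<bar>grad f x $ i\<bar>)" by (rule norm_le_l1_cart)
    also have "\<dots> \<le> (\<Sum>i\<in>UNIV. B i)" using B(2) by (intro sum_mono) (simp add: grad_def)
    finally show ?thesis .
  qed
  moreover have "(\<Sum>i\<in>UNIV. B i) > 0" using B(1) by (intro sum_pos) auto
  ultimately show ?thesis using that by blast
qed

lemma grad_eq_0: "x \<notin> closure {x. f x \<noteq> 0} \<Longrightarrow> grad f x = 0"
  by (simp add: grad_def vec_eq_iff partial_deriv_eq_0)

lemma L2_scaleR_grad:
  fixes u :: "real ^ 'n \<Rightarrow> real"
  assumes u: "u \<in> L2" and \<eta>: "test_function \<eta>"
  shows "(\<lambda>x. u x *\<^sub>R grad \<eta> x) \<in> L2"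
proof -
  obtain B' where B': "\<And>x. norm (grad \<eta> x) \<le> B'" "B' > 0" using grad_bounded[OF \<eta>] by blast
  show ?thesis
  proof (rule L2_bound[where h = "\<lambda>x. B'\<^sup>2 * (norm (u x))\<^sup>2"])
    show "(norm (u x *\<^sub>R grad \<eta> x))\<^sup>2 \<le> B'\<^sup>2 * (norm (u x))\<^sup>2" for x
      using mult_right_mono[OF power_mono[OF B'(1), of x 2], of "(u x)\<^sup>2"]
      by (simp add: power_mult_distrib mult.commute)
  qed (use L2_measurable[OF u] L2_integrable[OF u] grad_measurable[OF test_function_smooth[OF \<eta>]]
      in \<open>auto intro: borel_measurable_scaleR\<close>)
qed

text \<open>\<open>\<eta> * \<phi>\<close> is again a test function; testing \<open>u\<close> with
  it reduces the weak product rule to the classical one.\<close>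

lemma has_weak_gradient_mult:
  fixes u :: "real ^ 'n \<Rightarrow> real"
  assumes u: "has_weak_gradient u g" and \<eta>: "test_function \<eta>"
  shows "has_weak_gradient (\<lambda>x. \<eta> x * u x) (\<lambda>x. \<eta> x *\<^sub>R g x + u x *\<^sub>R grad \<eta> x)"
  unfolding has_weak_gradient_def
proof (intro conjI allI impI)
  note L2 = has_weak_gradient_L2[OF u]
  obtain B where B: "\<And>x. \<bar>\<eta> x\<bar> \<le> B" using test_function_bounded[OF \<eta>] by blast
  have m: "\<eta> \<in> borel_measurable lebesgue" using \<eta> by (rule test_function_measurable)
  show "(\<lambda>x. \<eta> x * u x) \<in> L2" using L2_bounded_scaleR[OF L2(1) B m] by simp
  show "(\<lambda>x. \<eta> x *\<^sub>R g x + u x *\<^sub>R grad \<eta> x) \<in> L2"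
    by (intro L2_add L2_bounded_scaleR[OF L2(2) B m] L2_scaleR_grad L2 \<eta>)
  fix \<phi> :: "real ^ 'n \<Rightarrow> real" and i
  assume \<phi>: "test_function \<phi>"
  have \<eta>\<phi>: "test_function (\<lambda>x. \<eta> x * \<phi> x)"
    by (intro test_function_mult test_function_smooth \<eta> \<phi>)
  have pd: "partial_deriv i (\<lambda>x. \<eta> x * \<phi> x) x = \<eta> x * partial_deriv i \<phi> x + partial_deriv i \<eta> x * \<phi> x" for x
    by (intro partial_deriv_mult test_function_smooth \<eta> \<phi>)
  have t3: "test_function (\<lambda>x. partial_deriv i \<eta> x * \<phi> x)"
    by (intro test_function_mult smooth_partial_deriv test_function_smooth \<eta> \<phi>)
  have "(LINT x|lebesgue. \<eta> x * u x * partial_deriv i \<phi> x)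
     = (LINT x|lebesgue. u x * partial_deriv i (\<lambda>x. \<eta> x * \<phi> x) x - u x * (partial_deriv i \<eta> x * \<phi> x))"
    by (simp add: pd algebra_simps)
  also have "\<dots> = (LINT x|lebesgue. u x * partial_deriv i (\<lambda>x. \<eta> x * \<phi> x) x)
      - (LINT x|lebesgue. u x * (partial_deriv i \<eta> x * \<phi> x))"
    by (intro Bochner_Integration.integral_diff L2_mult_integrable L2 test_function_L2 test_function_partial_deriv \<eta>\<phi> t3)
  also have "(LINT x|lebesgue. u x * partial_deriv i (\<lambda>x. \<eta> x * \<phi> x) x) = - (LINT x|lebesgue. g x $ i * (\<eta> x * \<phi> x))"
    using u \<eta>\<phi> unfolding has_weak_gradient_def by blast
  also have "- (LINT x|lebesgue. g x $ i * (\<eta> x * \<phi> x)) - (LINT x|lebesgue. u x * (partial_deriv i \<eta> x * \<phi> x))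
      = - (LINT x|lebesgue. g x $ i * (\<eta> x * \<phi> x) + u x * (partial_deriv i \<eta> x * \<phi> x))"
    by (subst Bochner_Integration.integral_add)
       (simp_all add: L2_mult_integrable L2 L2_component test_function_L2 \<eta>\<phi> t3)
  also have "\<dots> = - (LINT x|lebesgue. (\<eta> x *\<^sub>R g x + u x *\<^sub>R grad \<eta> x) $ i * \<phi> x)"
    by (simp add: grad_def algebra_simps)
  finally show "(LINT x|lebesgue. \<eta> x * u x * partial_deriv i \<phi> x)
      = - (LINT x|lebesgue. (\<eta> x *\<^sub>R g x + u x *\<^sub>R grad \<eta> x) $ i * \<phi> x)" .
qed

subsection \<open>Translations\<close>

lemma
  fixes c :: "'a::euclidean_space"
  shows lebesgue_measurable_translate: "(\<lambda>x. x + c) \<in> lebesgue \<rightarrow>\<^sub>M lebesgue"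
    and lebesgue_distr_translate: "distr lebesgue lebesgue (\<lambda>x. x + c) = lebesgue"
proof -
  have T: "(\<lambda>x. c + (\<Sum>j\<in>Basis. (1 * (x \<bullet> j)) *\<^sub>R j)) = (\<lambda>x. x + c)"
    by (simp add: euclidean_representation add.commute)
  show "(\<lambda>x. x + c) \<in> lebesgue \<rightarrow>\<^sub>M lebesgue"
    using lebesgue_affine_measurable[of "\<lambda>_. 1" c] unfolding T by simp
  show "distr lebesgue lebesgue (\<lambda>x. x + c) = lebesgue"
    using lebesgue_affine_euclidean[of "\<lambda>_. 1" c] unfolding T by (simp add: density_1)
qed

lemma borel_measurable_translate:
  fixes f :: "'a::euclidean_space \<Rightarrow> 'b::topological_space"
  shows "(\<lambda>x. f (x + c)) \<in> borel_measurable lebesgue \<longleftrightarrow> f \<in> borel_measurable lebesgue"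
proof
  show "f \<in> borel_measurable lebesgue \<Longrightarrow> (\<lambda>x. f (x + c)) \<in> borel_measurable lebesgue"
    using measurable_compose[OF lebesgue_measurable_translate] by blast
  show "f \<in> borel_measurable lebesgue" if "(\<lambda>x. f (x + c)) \<in> borel_measurable lebesgue"
    using measurable_compose[OF lebesgue_measurable_translate[of "- c"] that] by simp
qed

lemma integrable_translate:
  fixes f :: "'a::euclidean_space \<Rightarrow> real"
  shows "integrable lebesgue (\<lambda>x. f (x + c)) \<longleftrightarrow> integrable lebesgue f"
proof (cases "f \<in> borel_measurable lebesgue")
  case True
  then show ?thesis
    using integrable_distr_eq[OF lebesgue_measurable_translate[of c] True] by (simp add: lebesgue_distr_translate)
next
  case False
  then show ?thesis using borel_measurable_translate[of f c] borel_measurable_integrable by blast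
qed

text \<open>No integrability is assumed: for a non-measurable \<open>f\<close> both integrals take
  the default value 0. It can therefore be applied to the nonlinear term of a weak solution before
  its integrability is known.\<close>

lemma integral_translate:
  fixes f :: "'a::euclidean_space \<Rightarrow> real"
  shows "(LINT x|lebesgue. f (x + c)) = (LINT x|lebesgue. f x)"
proof (cases "f \<in> borel_measurable lebesgue")
  case True
  then show ?thesis
    using integral_distr[OF lebesgue_measurable_translate[of c] True] by (simp add: lebesgue_distr_translate)
next
  case False
  then have "\<not> integrable lebesgue f" by auto
  then show ?thesis using integrable_translate[of f c] by (simp add: not_integrable_integral_eq)
qed

lemma L2_translate:
  assumes "f \<in> L2"
  shows "(\<lambda>x. f (x + c)) \<in> L2"
  using L2_measurable[OF assms] L2_integrable[OF assms]
    integrable_translate[of "\<lambda>x. (norm (f x))\<^sup>2" c] borel_measurable_translate[of f c]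
  by (intro L2_I) auto

lemma partial_deriv_translate:
  assumes "smooth f"
  shows "partial_deriv i (\<lambda>x. f (x + c)) x = partial_deriv i f (x + c)"
  using partial_deriv_affine(2)[OF smooth_differentiable[OF assms], of i 1 c x] by simp

lemma test_function_translate: "test_function \<phi> \<Longrightarrow> test_function (\<lambda>x. \<phi> (x + c))"
  using test_function_affine[of \<phi> 1 c] by simp

lemma has_weak_gradient_translate:
  assumes "has_weak_gradient u g"
  shows "has_weak_gradient (\<lambda>x. u (x + c)) (\<lambda>x. g (x + c))"
  unfolding has_weak_gradient_def
proof (intro conjI allI impI)
  note L2 = has_weak_gradient_L2[OF assms]
  show "(\<lambda>x. u (x + c)) \<in> L2" "(\<lambda>x. g (x + c)) \<in> L2" using L2 by (auto intro: L2_translate)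
  fix \<phi> :: "real ^ 'a \<Rightarrow> real" and i
  assume \<phi>: "test_function \<phi>"
  let ?\<psi> = "\<lambda>x. \<phi> (x + (- c))"
  have \<psi>: "test_function ?\<psi>" using \<phi> by (rule test_function_translate)
  have "(LINT x|lebesgue. u (x + c) * partial_deriv i \<phi> x)
      = (LINT x|lebesgue. (\<lambda>x. u x * partial_deriv i ?\<psi> x) (x + c))"
    by (simp only: partial_deriv_translate[OF test_function_smooth[OF \<phi>]]) simp
  also have "\<dots> = (LINT x|lebesgue. u x * partial_deriv i ?\<psi> x)" by (rule integral_translate)
  also have "\<dots> = - (LINT x|lebesgue. g x $ i * ?\<psi> x)"
    using assms \<psi> unfolding has_weak_gradient_def by blast
  also have "(LINT x|lebesgue. g x $ i * ?\<psi> x) = (LINT x|lebesgue. (\<lambda>x. g x $ i * ?\<psi> x) (x + c))"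
    by (rule integral_translate[symmetric])
  finally show "(LINT x|lebesgue. u (x + c) * partial_deriv i \<phi> x) = - (LINT x|lebesgue. g (x + c) $ i * \<phi> x)"
    by simp
qed

section \<open>Invariance of the equation under lattice translations\<close>

lemma int_lattice_add: "x \<in> int_lattice \<Longrightarrow> y \<in> int_lattice \<Longrightarrow> x + y \<in> int_lattice"
  and int_lattice_diff: "x \<in> int_lattice \<Longrightarrow> y \<in> int_lattice \<Longrightarrow> x - y \<in> int_lattice"
  and int_lattice_zero: "0 \<in> int_lattice"
  by (auto simp: int_lattice_def)

lemma Theta_translate:
  assumes "c \<in> int_lattice"
  shows "x + c \<in> Theta \<epsilon> \<longleftrightarrow> x \<in> Theta \<epsilon>"
proof
  assume "x + c \<in> Theta \<epsilon>"
  then obtain y where "y \<in> int_lattice" "dist y (x + c) < \<epsilon>" by (auto simp: Theta_def)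
  then show "x \<in> Theta \<epsilon>" unfolding Theta_def using int_lattice_diff[OF _ assms, of y]
    by (auto intro!: bexI[of _ "y - c"] simp: dist_norm algebra_simps)
next
  assume "x \<in> Theta \<epsilon>"
  then obtain y where "y \<in> int_lattice" "dist y x < \<epsilon>" by (auto simp: Theta_def)
  then show "x + c \<in> Theta \<epsilon>" unfolding Theta_def using int_lattice_add[OF _ assms, of y]
    by (auto intro!: bexI[of _ "y + c"] simp: dist_norm algebra_simps)
qed

lemma Q_translate: "c \<in> int_lattice \<Longrightarrow> Q \<epsilon> (x + c) = Q \<epsilon> x"
  by (simp add: Q_def Theta_translate)

text \<open>Testing the translate with \<open>v\<close> is testing \<open>u\<close> with
  \<open>v\<close> shifted back. The weak gradient chosen for a translate equals the translated one
  only almost everywhere, hence the two almost-everywhere congruences.\<close>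

lemma weak_solution_translate:
  fixes u :: "real ^ 'n \<Rightarrow> real"
  assumes u: "weak_solution p \<epsilon> u" and c: "c \<in> int_lattice"
  shows "weak_solution p \<epsilon> (\<lambda>x. u (x + c))"
  unfolding weak_solution_def
proof (intro conjI ballI)
  have gu: "has_weak_gradient u (weak_grad u)"
    using u by (intro has_weak_gradient_weak_grad) (simp add: weak_solution_def)
  let ?w = "\<lambda>x. u (x + c)"
  have gw: "has_weak_gradient ?w (\<lambda>x. weak_grad u (x + c))"
    by (rule has_weak_gradient_translate[OF gu])
  then show "?w \<in> H1" by (rule has_weak_gradient_H1)
  fix v :: "real ^ 'n \<Rightarrow> real" assume v: "v \<in> H1"
  let ?z = "\<lambda>x. v (x + (- c))"
  have gv: "has_weak_gradient v (weak_grad v)" by (rule has_weak_gradient_weak_grad[OF v])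
  have gz: "has_weak_gradient ?z (\<lambda>x. weak_grad v (x + (- c)))"
    by (rule has_weak_gradient_translate[OF gv])
  have z: "?z \<in> H1" by (rule has_weak_gradient_H1[OF gz])
  note m = L2_measurable[OF has_weak_gradient_L2(1)] L2_measurable[OF has_weak_gradient_L2(2)]
  have "(LINT x|lebesgue. weak_grad ?w x \<bullet> weak_grad v x + ?w x * v x)
      = (LINT x|lebesgue. weak_grad u (x + c) \<bullet> weak_grad v x + ?w x * v x)"
    using weak_grad_AE[OF gw] m[OF gv] m[OF gw] m[OF has_weak_gradient_weak_grad[OF has_weak_gradient_H1[OF gw]]]
    by (intro integral_cong_AE borel_measurable_add borel_measurable_inner borel_measurable_times) auto
  also have "\<dots> = (LINT x|lebesgue. (\<lambda>x. weak_grad u x \<bullet> weak_grad v (x + (- c)) + u x * ?z x) (x + c))"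
    by simp
  also have "\<dots> = (LINT x|lebesgue. weak_grad u x \<bullet> weak_grad v (x + (- c)) + u x * ?z x)"
    by (rule integral_translate)
  also have "\<dots> = (LINT x|lebesgue. weak_grad u x \<bullet> weak_grad ?z x + u x * ?z x)"
    using weak_grad_AE[OF gz] m[OF gu] m[OF gz] m[OF has_weak_gradient_weak_grad[OF z]]
    by (intro integral_cong_AE borel_measurable_add borel_measurable_inner borel_measurable_times) auto
  also have "\<dots> = (LINT x|lebesgue. Q \<epsilon> x * \<bar>u x\<bar> powr (p - 2) * u x * ?z x)"
    using u z unfolding weak_solution_def by blast
  also have "\<dots> = (LINT x|lebesgue. (\<lambda>x. Q \<epsilon> x * \<bar>u x\<bar> powr (p - 2) * u x * ?z x) (x + c))"
    by (rule integral_translate[symmetric])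
  finally show "(LINT x|lebesgue. weak_grad ?w x \<bullet> weak_grad v x + ?w x * v x)
      = (LINT x|lebesgue. Q \<epsilon> x * \<bar>?w x\<bar> powr (p - 2) * ?w x * v x)"
    by (simp add: Q_translate[OF c])
qed

lemma positive_solution_translate:
  assumes "positive_solution p \<epsilon> u" "c \<in> int_lattice"
  shows "positive_solution p \<epsilon> (\<lambda>x. u (x + c))"
  using assms weak_solution_translate unfolding positive_solution_def
  by (auto intro!: continuous_intros elim!: continuous_on_compose2)

lemma H1_energy_translate:
  fixes u :: "real ^ 'n \<Rightarrow> real"
  assumes "u \<in> H1" "S \<in> sets lebesgue"
  shows "H1_energy S (\<lambda>x. u (x + c)) = H1_energy {x. x - c \<in> S} u"
proof -
  have gu: "has_weak_gradient u (weak_grad u)" using assms(1) by (rule has_weak_gradient_weak_grad)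
  let ?w = "\<lambda>x. u (x + c)"
  have gw: "has_weak_gradient ?w (\<lambda>x. weak_grad u (x + c))"
    by (rule has_weak_gradient_translate[OF gu])
  note m = L2_measurable[OF has_weak_gradient_L2(1)] L2_measurable[OF has_weak_gradient_L2(2)]
  note mw = m[OF gw] m(2)[OF has_weak_gradient_weak_grad[OF has_weak_gradient_H1[OF gw]]]
  have "H1_energy S ?w = (LINT x:S|lebesgue. (norm (weak_grad u (x + c)))\<^sup>2 + (u (x + c))\<^sup>2)"
    unfolding H1_energy_def set_lebesgue_integral_def using weak_grad_AE[OF gw] mw assms(2)
    by (intro integral_cong_AE borel_measurable_scaleR borel_measurable_indicator borel_measurable_add
          borel_measurable_power borel_measurable_norm) (auto intro: measurable_compose[OF _ borel_measurable_norm])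
  also have "\<dots> = (LINT x|lebesgue. (\<lambda>x. indicator {x. x - c \<in> S} x *\<^sub>R ((norm (weak_grad u x))\<^sup>2 + (u x)\<^sup>2)) (x + c))"
    by (simp add: set_lebesgue_integral_def indicator_def)
  also have "\<dots> = H1_energy {x. x - c \<in> S} u"
    unfolding H1_energy_def set_lebesgue_integral_def by (rule integral_translate)
  finally show ?thesis .
qed

lemma set_integral_translate:
  fixes f :: "'a::euclidean_space \<Rightarrow> real"
  shows "(LINT x:S|lebesgue. f (x + c)) = (LINT x:{x. x - c \<in> S}|lebesgue. f x)"
  using integral_translate[of "\<lambda>x. indicator {x. x - c \<in> S} x *\<^sub>R f x" c]
  by (simp add: set_lebesgue_integral_def indicator_def)

subsection \<open>Local energy estimate away from the lattice\<close>

lemma closed_int_lattice: "closed (int_lattice :: (real ^ 'n) set)"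
proof -
  have "closed {y :: real ^ 'n. y $ i \<in> \<int>}" for i
    using closed_vimage[OF closed_Ints, of "\<lambda>y. y $ i"] by (simp add: vimage_def continuous_on_component)
  then show ?thesis unfolding int_lattice_def by (intro closed_Collect_all) auto
qed

lemma Theta_sets: "Theta \<epsilon> \<in> sets lebesgue"
  by (intro sets_completionI_sets) (auto intro!: borel_open simp: Theta_def)

lemma Q_measurable: "Q \<epsilon> \<in> borel_measurable lebesgue"
  unfolding Q_def[abs_def] by (intro measurable_If_set) (auto simp: Theta_sets)

lemma grad_power:
  assumes "smooth f"
  shows "grad (\<lambda>x. f x ^ Suc k) x = (real (Suc k) * f x ^ k) *\<^sub>R grad f x"
proof -
  have "((\<lambda>x. f x ^ Suc k) has_derivative (\<lambda>h. frechet_derivative f (at x) h * (real (Suc k) * f x ^ k))) (at x)"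
    by (rule has_derivative_eq_rhs[OF has_derivative_power[OF smooth_has_derivative[OF assms]]]) (auto simp: algebra_simps)
  from partial_deriv_eq[OF this] show ?thesis
    by (simp add: grad_def vec_eq_iff partial_deriv_def)
qed

lemma test_function_power: "test_function f \<Longrightarrow> test_function (\<lambda>x. f x ^ Suc k)"
  using test_function_mult[of "\<lambda>x. f x ^ k" f] by (simp add: smooth_power test_function_smooth mult.commute)

section \<open>Testing the equation with a cut-off solution\<close>

lemma positive_solution_weak_gradient:
  assumes "positive_solution p \<epsilon> u"
  shows "has_weak_gradient u (weak_grad u)"
  using assms has_weak_gradient_weak_grad by (auto simp: positive_solution_def weak_solution_def)

lemma positive_solution_powr_continuous:
  assumes "positive_solution p \<epsilon> u"
  shows "continuous_on UNIV (\<lambda>x. u x powr q)"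
  using assms by (auto simp: positive_solution_def intro!: continuous_intros) (metis less_irrefl)

lemma integrable_test_function_mult:
  fixes \<zeta> f :: "real ^ 'n \<Rightarrow> real"
  assumes \<zeta>: "test_function \<zeta>" and f: "continuous_on UNIV f"
  shows "integrable lebesgue (\<lambda>x. \<zeta> x * f x)"
proof (rule integrable_compact_continuous[OF test_function_support(1)[OF \<zeta>]])
  show "continuous_on UNIV (\<lambda>x. \<zeta> x * f x)"
    by (intro continuous_intros f smooth_continuous test_function_smooth \<zeta>)
qed (use test_function_support(2)[OF \<zeta>] in auto)

lemma positive_solution_nonlinearity:
  assumes "positive_solution p \<epsilon> u"
  shows "\<bar>u x\<bar> powr (p - 2) * u x * u x = u x powr p"
proof -
  have "u x powr p = u x powr (p - 2) * u x powr 2" by (simp flip: powr_add)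
  moreover have "u x > 0" using assms by (simp add: positive_solution_def)
  ultimately show ?thesis by (simp add: powr_numeral power2_eq_square)
qed

text \<open>The test function is \<open>\<zeta> * u\<close>, with its gradient expanded by the
  product rule. As \<open>\<zeta>\<close> has compact support and \<open>u\<close> is continuous,
  the right-hand side is integrable without any knowledge of \<open>u powr p\<close> on the whole
  space.\<close>

lemma positive_solution_tested:
  assumes u: "positive_solution p \<epsilon> u" and \<zeta>: "test_function \<zeta>"
  shows "integrable lebesgue (\<lambda>x. \<zeta> x * (norm (weak_grad u x))\<^sup>2 + u x * (weak_grad u x \<bullet> grad \<zeta> x) + \<zeta> x * (u x)\<^sup>2)"
    and "integrable lebesgue (\<lambda>x. Q \<epsilon> x * (\<zeta> x * u x powr p))"
    and "(LINT x|lebesgue. \<zeta> x * (norm (weak_grad u x))\<^sup>2 + u x * (weak_grad u x \<bullet> grad \<zeta> x) + \<zeta> x * (u x)\<^sup>2)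
      = (LINT x|lebesgue. Q \<epsilon> x * (\<zeta> x * u x powr p))"
proof -
  let ?g = "weak_grad u"
  have g: "has_weak_gradient u ?g" using u by (rule positive_solution_weak_gradient)
  note L2 = has_weak_gradient_L2[OF g]
  have v: "has_weak_gradient (\<lambda>x. \<zeta> x * u x) (\<lambda>x. \<zeta> x *\<^sub>R ?g x + u x *\<^sub>R grad \<zeta> x)"
    by (rule has_weak_gradient_mult[OF g \<zeta>])
  note vL2 = has_weak_gradient_L2[OF v]
  have eq: "\<zeta> x * (norm (?g x))\<^sup>2 + u x * (?g x \<bullet> grad \<zeta> x) + \<zeta> x * (u x)\<^sup>2
    = ?g x \<bullet> (\<zeta> x *\<^sub>R ?g x + u x *\<^sub>R grad \<zeta> x) + u x * (\<zeta> x * u x)" for x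
    by (simp add: inner_add_right power2_norm_eq_inner) (simp add: power2_eq_square)
  show "integrable lebesgue (\<lambda>x. \<zeta> x * (norm (?g x))\<^sup>2 + u x * (?g x \<bullet> grad \<zeta> x) + \<zeta> x * (u x)\<^sup>2)"
    unfolding eq by (intro Bochner_Integration.integrable_add L2_inner_integrable L2_mult_integrable L2 vL2)
  show "integrable lebesgue (\<lambda>x. Q \<epsilon> x * (\<zeta> x * u x powr p))"
    by (rule Bochner_Integration.integrable_bound[OF integrable_test_function_mult[OF \<zeta> positive_solution_powr_continuous[OF u, of p]]])
       (auto simp: Q_def[abs_def] abs_mult intro!: borel_measurable_times Q_measurable[unfolded Q_def[abs_def]]
        borel_measurable_integrable[OF integrable_test_function_mult[OF \<zeta> positive_solution_powr_continuous[OF u]]])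
  have "(LINT x|lebesgue. ?g x \<bullet> (\<zeta> x *\<^sub>R ?g x + u x *\<^sub>R grad \<zeta> x) + u x * (\<zeta> x * u x))
     = (LINT x|lebesgue. ?g x \<bullet> weak_grad (\<lambda>x. \<zeta> x * u x) x + u x * (\<zeta> x * u x))"
  proof (rule integral_cong_AE)
    note m = L2[THEN L2_measurable] vL2[THEN L2_measurable]
      has_weak_gradient_L2[OF has_weak_gradient_weak_grad[OF has_weak_gradient_H1[OF v]], THEN L2_measurable]
    show "(\<lambda>x. ?g x \<bullet> (\<zeta> x *\<^sub>R ?g x + u x *\<^sub>R grad \<zeta> x) + u x * (\<zeta> x * u x)) \<in> borel_measurable lebesgue"
      "(\<lambda>x. ?g x \<bullet> weak_grad (\<lambda>x. \<zeta> x * u x) x + u x * (\<zeta> x * u x)) \<in> borel_measurable lebesgue"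
      using borel_measurable_add[OF borel_measurable_inner[OF m(2) m(4)] borel_measurable_times[OF m(1) m(3)]]
        borel_measurable_add[OF borel_measurable_inner[OF m(2) m(6)] borel_measurable_times[OF m(1) m(3)]]
      by auto
  qed (use weak_grad_AE[OF v] in \<open>eventually_elim, simp\<close>)
  also have "\<dots> = (LINT x|lebesgue. Q \<epsilon> x * \<bar>u x\<bar> powr (p - 2) * u x * (\<zeta> x * u x))"
    using u has_weak_gradient_H1[OF v] unfolding positive_solution_def weak_solution_def by blast
  also have "(\<lambda>x. Q \<epsilon> x * \<bar>u x\<bar> powr (p - 2) * u x * (\<zeta> x * u x)) = (\<lambda>x. Q \<epsilon> x * (\<zeta> x * u x powr p))"
    unfolding positive_solution_nonlinearity[OF u, symmetric] by (simp add: mult_ac)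
  finally show "(LINT x|lebesgue. \<zeta> x * (norm (?g x))\<^sup>2 + u x * (?g x \<bullet> grad \<zeta> x) + \<zeta> x * (u x)\<^sup>2)
      = (LINT x|lebesgue. Q \<epsilon> x * (\<zeta> x * u x powr p))"
    unfolding eq .
qed

text \<open>The term that is left over from the cutoff is absorbed by the nonlinearity,
  which is why the bound does not depend on \<open>s\<close>; this is the energy form of the
  Keller-Osserman estimate.\<close>

lemma keller_osserman_pointwise:
  fixes p A B s t :: real
  assumes "2 < p" "4 / (p - 2) \<le> real m" "0 \<le> A" "0 \<le> t" "t \<le> B" "0 < s"
  shows "A * t ^ m * s\<^sup>2 \<le> t ^ (m + 2) * s powr p + A powr (1 + 2 / (p - 2)) * B powr (real m - 4 / (p - 2))"
\<comment> \<open>In the first case the nonlinear term dominates outright. Otherwise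
  \<open>s\<^sup>2\<close> is at most \<open>(A / t\<^sup>2) powr (2 / (p - 2))\<close>, which
  leaves \<open>t\<close> to the power \<open>m - 4 / (p - 2)\<close>; the lower bound on
  \<open>m\<close> makes this exponent nonnegative, so \<open>t\<close> can be replaced by
  \<open>B\<close>.\<close>
proof (cases "A \<le> t\<^sup>2 * s powr (p - 2)")
  case True
  have sp: "s powr p = s powr (p - 2) * s\<^sup>2"
    using assms by (simp flip: powr_add powr_numeral)
  have "A * (t ^ m * s\<^sup>2) \<le> t\<^sup>2 * s powr (p - 2) * (t ^ m * s\<^sup>2)"
    using True assms by (intro mult_right_mono) auto
  also have "\<dots> = t ^ (m + 2) * s powr p" by (simp add: sp power_add power2_eq_square)
  also have "\<dots> \<le> \<dots> + A powr (1 + 2 / (p - 2)) * B powr (real m - 4 / (p - 2))" by simp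
  finally show ?thesis by (simp add: mult.assoc)
next
  case False
  have m: "m > 0" using assms by (intro Nat.gr0I) (auto simp: field_simps)
  show ?thesis
  proof (cases "t = 0")
    case True
    then show ?thesis using m by (simp add: zero_power)
  next
    case t: False
    with assms have t: "t > 0" by simp
    have A: "A > 0" using False assms by (smt (verit) mult_nonneg_nonneg powr_ge_zero zero_le_power2)
    have "s powr (p - 2) \<le> A / t\<^sup>2" using False t by (simp add: field_simps)
    then have "(s powr (p - 2)) powr (2 / (p - 2)) \<le> (A / t\<^sup>2) powr (2 / (p - 2))"
      using assms by (intro powr_mono2) auto
    moreover have "(s powr (p - 2)) powr (2 / (p - 2)) = s\<^sup>2"
    proof -
      have "(p - 2) * (2 / (p - 2)) = 2" using assms(1) nonzero_mult_div_cancel_left[of "p - 2" 2] by auto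
      then show ?thesis using assms(6) by (simp only: powr_powr) (simp add: powr_numeral)
    qed
    moreover have "(A / t\<^sup>2) powr (2 / (p - 2)) = A powr (2 / (p - 2)) * t powr (- (4 / (p - 2)))"
    proof -
      have "(t\<^sup>2) powr (2 / (p - 2)) = (t powr 2) powr (2 / (p - 2))" using t by (simp add: powr_numeral)
      also have "\<dots> = t powr (4 / (p - 2))" by (simp add: powr_powr)
      finally have "(t\<^sup>2) powr (2 / (p - 2)) = t powr (4 / (p - 2))" .
      moreover have "(A / t\<^sup>2) powr (2 / (p - 2)) = A powr (2 / (p - 2)) / (t\<^sup>2) powr (2 / (p - 2))"
        by (rule powr_divide)
      ultimately show ?thesis by (simp add: powr_minus divide_inverse)
    qed
    ultimately have "s\<^sup>2 \<le> A powr (2 / (p - 2)) * t powr (- (4 / (p - 2)))" by simp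
    then have "A * t ^ m * s\<^sup>2 \<le> A * t ^ m * (A powr (2 / (p - 2)) * t powr (- (4 / (p - 2))))"
      using assms by (intro mult_left_mono) auto
    also have "\<dots> = A powr (1 + 2 / (p - 2)) * t powr (real m - 4 / (p - 2))"
      using A t by (simp add: powr_add powr_diff powr_minus divide_inverse powr_realpow)
    also have "\<dots> \<le> A powr (1 + 2 / (p - 2)) * B powr (real m - 4 / (p - 2))"
      using assms by (intro mult_left_mono powr_mono2) auto
    also have "\<dots> \<le> t ^ (m + 2) * s powr p + \<dots>" using assms by simp
    finally show ?thesis .
  qed
qed

text \<open>The power m + 1 of the cutoff is the geometric mean of the powers m + 2 and m: the first
  half is absorbed by the gradient term of the energy, the second carries only
  \<open>u\<close>.\<close>

lemma young_product:
  fixes a b c t :: real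
  assumes "0 \<le> t" "\<bar>c\<bar> \<le> a * b"
  shows "\<bar>t ^ Suc m * c\<bar> \<le> t ^ (m + 2) * a\<^sup>2 / 2 + t ^ m * b\<^sup>2 / 2"
proof -
  have "\<bar>t ^ Suc m * c\<bar> = t ^ Suc m * \<bar>c\<bar>" using assms(1) by (simp add: abs_mult)
  also have "\<dots> \<le> t ^ Suc m * (a * b)" using assms by (intro mult_left_mono) auto
  also have "\<dots> = t ^ m * ((t * a) * b)" by simp
  also have "\<dots> \<le> t ^ m * ((t * a)\<^sup>2 / 2 + b\<^sup>2 / 2)"
    using assms(1) sum_squares_bound[of "t * a" b] by (intro mult_left_mono) auto
  also have "\<dots> = t ^ (m + 2) * a\<^sup>2 / 2 + t ^ m * b\<^sup>2 / 2"
    by (simp add: algebra_simps power_add power2_eq_square)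
  finally show ?thesis .
qed

lemma H1_energy_integrable:
  assumes "has_weak_gradient u (weak_grad u)"
  shows "integrable lebesgue (\<lambda>x. (norm (weak_grad u x))\<^sup>2 + (u x)\<^sup>2)"
  using has_weak_gradient_L2[OF assms, THEN L2_integrable] by simp

text \<open>Only the cut-off product is assumed integrable, so that the lemma applies to
  \<open>u powr p\<close> as well as to the energy density.\<close>

lemma set_integrable_mono_test:
  fixes f \<zeta> :: "real ^ 'n \<Rightarrow> real"
  assumes "S \<in> sets lebesgue" "f \<in> borel_measurable lebesgue" "\<And>x. 0 \<le> f x" "\<And>x. 0 \<le> \<zeta> x" "\<And>x. x \<in> S \<Longrightarrow> 1 \<le> \<zeta> x"
    and int: "integrable lebesgue (\<lambda>x. \<zeta> x * f x)"
  shows "set_integrable lebesgue S f" "(LINT x:S|lebesgue. f x) \<le> (LINT x|lebesgue. \<zeta> x * f x)"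
proof -
  have le: "indicator S x *\<^sub>R f x \<le> \<zeta> x * f x" for x
    using assms(3,4)[of x] assms(5)[of x] mult_right_mono[of 1 "\<zeta> x" "f x"] by (auto simp: indicator_def)
  show i: "set_integrable lebesgue S f"
    unfolding set_integrable_def
  proof (rule Bochner_Integration.integrable_bound[OF int])
    show "(\<lambda>x. indicator S x *\<^sub>R f x) \<in> borel_measurable lebesgue"
      using assms by (intro borel_measurable_scaleR borel_measurable_indicator) auto
    show "AE x in lebesgue. norm (indicator S x *\<^sub>R f x) \<le> norm (\<zeta> x * f x)"
      using le assms(3,4) by (intro AE_I2) (auto simp: abs_mult)
  qed
  show "(LINT x:S|lebesgue. f x) \<le> (LINT x|lebesgue. \<zeta> x * f x)"
    using i int le unfolding set_integrable_def set_lebesgue_integral_def by (intro integral_mono) auto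
qed

lemma integrable_test_function_energy:
  assumes \<zeta>: "test_function \<zeta>" and u: "has_weak_gradient u (weak_grad u)"
  shows "integrable lebesgue (\<lambda>x. \<zeta> x * ((norm (weak_grad u x))\<^sup>2 + (u x)\<^sup>2))"
proof -
  obtain B where B: "\<And>x. \<bar>\<zeta> x\<bar> \<le> B" using test_function_bounded[OF \<zeta>] by blast
  let ?E = "\<lambda>x. (norm (weak_grad u x))\<^sup>2 + (u x)\<^sup>2"
  have "integrable lebesgue (\<lambda>x. B * ?E x)" by (intro integrable_mult_right H1_energy_integrable u)
  moreover have "(\<lambda>x. \<zeta> x * ?E x) \<in> borel_measurable lebesgue"
    by (intro borel_measurable_times test_function_measurable[OF \<zeta>] borel_measurable_integrable H1_energy_integrable u)
  moreover have "norm (\<zeta> x * ?E x) \<le> norm (B * ?E x)" for x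
    using B[of x] by (simp only: real_norm_def abs_mult) (intro mult_right_mono, auto)
  ultimately show ?thesis by (blast intro: Bochner_Integration.integrable_bound)
qed

text \<open>Young's inequality bounds the cross term by half of the gradient term plus a term in
  \<open>u\<close> alone; absorbing that half gives the factor 2. \<open>Q\<close> is left
  untouched, so the bound serves both where \<open>Q\<close> is -1 on the whole support and where it
  changes sign.\<close>

lemma caccioppoli:
  assumes u: "positive_solution p \<epsilon> u" and \<eta>: "test_function \<eta>" "\<And>x. 0 \<le> \<eta> x" "\<And>x. norm (grad \<eta> x) \<le> b"
    and S: "S = closure {x. \<eta> x \<noteq> 0}"
  shows "(LINT x|lebesgue. \<eta> x ^ (m + 2) * ((norm (weak_grad u x))\<^sup>2 + (u x)\<^sup>2))
    \<le> 2 * (LINT x|lebesgue. Q \<epsilon> x * (\<eta> x ^ (m + 2) * u x powr p))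
      + (LINT x:S|lebesgue. ((real m + 2) * b)\<^sup>2 * \<eta> x ^ m * (u x)\<^sup>2)"
proof -
  let ?g = "weak_grad u" and ?\<zeta> = "\<lambda>x. \<eta> x ^ (m + 2)" and ?A = "((real m + 2) * b)\<^sup>2"
  have \<zeta>: "test_function ?\<zeta>" using test_function_power[OF \<eta>(1), of "Suc m"] by simp
  have gz: "grad ?\<zeta> x = ((real m + 2) * \<eta> x ^ Suc m) *\<^sub>R grad \<eta> x" for x
    using grad_power[OF test_function_smooth[OF \<eta>(1)], of "Suc m" x] by (simp add: algebra_simps)
  have g: "has_weak_gradient u ?g" using u by (rule positive_solution_weak_gradient)
  have pos: "u x > 0" for x using u by (simp add: positive_solution_def)
  let ?E = "\<lambda>x. (norm (?g x))\<^sup>2 + (u x)\<^sup>2"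
  let ?X = "\<lambda>x. ?\<zeta> x * (norm (?g x))\<^sup>2 + u x * (?g x \<bullet> grad ?\<zeta> x) + ?\<zeta> x * (u x)\<^sup>2"
  let ?R = "\<lambda>x. indicator S x *\<^sub>R (?A * \<eta> x ^ m * (u x)\<^sup>2)"
  note T = positive_solution_tested[OF u \<zeta>]
  have "compact S" unfolding S by (rule test_function_support(1)[OF \<eta>(1)])
  then have iR: "integrable lebesgue ?R"
    using u smooth_continuous[OF test_function_smooth[OF \<eta>(1)]]
    unfolding set_integrable_def[symmetric]
    by (intro set_integrable_compact_continuous continuous_intros) (auto simp: positive_solution_def)
  have iE: "integrable lebesgue (\<lambda>x. ?\<zeta> x * ?E x)" by (rule integrable_test_function_energy[OF \<zeta> g])
  have pw: "?\<zeta> x * ?E x \<le> 2 * ?X x + ?R x" for x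
  proof (cases "x \<in> S")
    case False
    then have "\<eta> x = 0" using test_function_support(2)[OF \<eta>(1)] unfolding S by blast
    then show ?thesis using gz[of x] False by simp
  next
    case True
    have "\<bar>(real m + 2) * u x * (?g x \<bullet> grad \<eta> x)\<bar> \<le> norm (?g x) * ((real m + 2) * b * u x)"
    proof -
      have "\<bar>(real m + 2) * u x * (?g x \<bullet> grad \<eta> x)\<bar> = (real m + 2) * u x * \<bar>?g x \<bullet> grad \<eta> x\<bar>"
        using pos[of x] by (simp add: abs_mult)
      also have "\<dots> \<le> (real m + 2) * u x * (norm (?g x) * b)"
        using pos[of x] \<eta>(3)[of x]
        by (intro mult_left_mono order_trans[OF Cauchy_Schwarz_ineq2]) auto
      finally show ?thesis by (simp add: algebra_simps)
    qed
    note young = young_product[OF \<eta>(2) this, of x m]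
    have e1: "u x * (?g x \<bullet> grad ?\<zeta> x) = \<eta> x ^ Suc m * ((real m + 2) * u x * (?g x \<bullet> grad \<eta> x))"
      unfolding gz by simp
    have e2: "\<eta> x ^ m * ((real m + 2) * b * u x)\<^sup>2 / 2 = ?A * \<eta> x ^ m * (u x)\<^sup>2 / 2"
      by (simp add: power_mult_distrib)
    have 1: "\<bar>u x * (?g x \<bullet> grad ?\<zeta> x)\<bar> \<le> ?\<zeta> x * (norm (?g x))\<^sup>2 / 2 + ?A * \<eta> x ^ m * (u x)\<^sup>2 / 2"
      using young unfolding e1 e2 .
    have 2: "0 \<le> ?\<zeta> x * (u x)\<^sup>2" using \<eta>(2) by simp
    have 3: "?\<zeta> x * ?E x = ?\<zeta> x * (norm (?g x))\<^sup>2 + ?\<zeta> x * (u x)\<^sup>2" by (simp add: algebra_simps)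
    have 4: "?R x = ?A * \<eta> x ^ m * (u x)\<^sup>2" using True by simp
    \<comment> \<open>Plain arithmetic: \<open>t\<close> is at least \<open>- a / 2 - q / 2\<close>,
      so the right-hand side is at least \<open>a + 2 * c\<close>.\<close>
    have "e \<le> 2 * (a + t + c) + r" if "\<bar>t\<bar> \<le> a / 2 + q / 2" "0 \<le> c" "e = a + c" "r = q" for a c e q r t :: real
      using that by (simp add: abs_le_iff field_simps)
    from this[OF 1 2 3 4] show ?thesis .
  qed
  have "(LINT x|lebesgue. ?\<zeta> x * ?E x) \<le> (LINT x|lebesgue. 2 * ?X x + ?R x)"
    by (intro integral_mono Bochner_Integration.integrable_add integrable_mult_right iE T(1) iR pw)
  also have "\<dots> = (LINT x|lebesgue. 2 * ?X x) + (LINT x|lebesgue. ?R x)"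
    by (intro Bochner_Integration.integral_add integrable_mult_right T(1) iR)
  finally show ?thesis unfolding set_lebesgue_integral_def integral_mult_right_zero T(3) .
qed

text \<open>Once \<epsilon> is below the distance from the support of the cutoff to the lattice,
  \<open>Q\<close> is -1 on that support, and \<open>caccioppoli\<close> has minus twice the
  weighted integral of \<open>u powr p\<close> on its right. One copy absorbs the cutoff term by
  \<open>keller_osserman_pointwise\<close>; the other moves to the left and bounds the
  \<open>p\<close>-th power integral along with the energy.\<close>

lemma local_energy_bound:
  fixes K :: "(real ^ 'n) set"
  assumes p: "2 < p" and K: "compact K" "K \<inter> int_lattice = {}"
  obtains \<epsilon>0 C where "0 < \<epsilon>0"
    "\<And>\<epsilon> u. \<epsilon> < \<epsilon>0 \<Longrightarrow> positive_solution p \<epsilon> u \<Longrightarrow>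
       set_integrable lebesgue K (\<lambda>x. u x powr p) \<and> H1_energy K u \<le> C \<and> (LINT x:K|lebesgue. u x powr p) \<le> C"
proof -
  have "open (- int_lattice :: (real ^ 'n) set)" by (rule open_Compl[OF closed_int_lattice])
  then obtain \<eta> :: "real ^ 'n \<Rightarrow> real" where \<eta>: "test_function \<eta>" "\<And>x. 0 \<le> \<eta> x" "\<And>x. x \<in> K \<Longrightarrow> 1 \<le> \<eta> x"
    "closure {x. \<eta> x \<noteq> 0} \<subseteq> - int_lattice"
    using test_function_bump[OF K(1)] K(2) by (metis disjoint_eq_subset_Compl)
  define S where "S = closure {x. \<eta> x \<noteq> 0}"
  have S: "compact S" "S \<inter> int_lattice = {}" "\<And>x. \<eta> x \<noteq> 0 \<Longrightarrow> x \<in> S"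
    using test_function_support[OF \<eta>(1)] \<eta>(4) by (auto simp: S_def)
  obtain \<epsilon>0 where \<epsilon>0: "\<epsilon>0 > 0" "\<And>x y. x \<in> S \<Longrightarrow> y \<in> int_lattice \<Longrightarrow> \<epsilon>0 \<le> dist x y"
    using separate_compact_closed[OF S(1) closed_int_lattice S(2)] by blast
  obtain B where B: "\<And>x. \<bar>\<eta> x\<bar> \<le> B" using test_function_bounded[OF \<eta>(1)] by blast
  obtain b where b: "\<And>x. norm (grad \<eta> x) \<le> b" using grad_bounded[OF \<eta>(1)] by blast
  \<comment> \<open>The power of the cutoff is taken just large enough for
    \<open>keller_osserman_pointwise\<close>.\<close>
  define m where "m = nat \<lceil>4 / (p - 2)\<rceil>"
  have m: "4 / (p - 2) \<le> real m" unfolding m_def by linarith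
  define A where "A = ((real m + 2) * b)\<^sup>2"
  define C0 where "C0 = A powr (1 + 2 / (p - 2)) * B powr (real m - 4 / (p - 2))"
  let ?\<zeta> = "\<lambda>x. \<eta> x ^ (m + 2)"
  have \<zeta>: "test_function ?\<zeta>" using test_function_power[OF \<eta>(1), of "Suc m"] by simp
  define C where "C = (LINT x:S|lebesgue. C0)"
  have iS: "set_integrable lebesgue S (\<lambda>x. C0)"
    by (intro set_integrable_compact_continuous S continuous_intros)
  have "set_integrable lebesgue K (\<lambda>x. u x powr p) \<and> H1_energy K u \<le> C \<and> (LINT x:K|lebesgue. u x powr p) \<le> C"
    if \<epsilon>: "\<epsilon> < \<epsilon>0" and u: "positive_solution p \<epsilon> u" for \<epsilon> u
  proof -
    let ?E = "\<lambda>x. (norm (weak_grad u x))\<^sup>2 + (u x)\<^sup>2"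
    let ?P = "\<lambda>x. u x powr p"
    have g: "has_weak_gradient u (weak_grad u)" using u by (rule positive_solution_weak_gradient)
    have iE: "integrable lebesgue (\<lambda>x. ?\<zeta> x * ?E x)" by (rule integrable_test_function_energy[OF \<zeta> g])
    have iY: "integrable lebesgue (\<lambda>x. ?\<zeta> x * ?P x)"
      by (rule integrable_test_function_mult[OF \<zeta> positive_solution_powr_continuous[OF u]])
    have Q: "Q \<epsilon> x * (?\<zeta> x * ?P x) = - (?\<zeta> x * ?P x)" for x
    proof (cases "\<eta> x = 0")
      case False
      then have "x \<in> S" by (rule S)
      then have "x \<notin> Theta \<epsilon>" using \<epsilon> \<epsilon>0(2)[of x] by (force simp: Theta_def dist_commute)
      then show ?thesis by (simp add: Q_def)
    qed simp
    have "(LINT x:S|lebesgue. A * \<eta> x ^ m * (u x)\<^sup>2) \<le> (LINT x|lebesgue. ?\<zeta> x * ?P x + indicator S x *\<^sub>R C0)"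
      unfolding set_lebesgue_integral_def
    proof (rule integral_mono)
      show "integrable lebesgue (\<lambda>x. indicator S x *\<^sub>R (A * \<eta> x ^ m * (u x)\<^sup>2))"
        using u smooth_continuous[OF test_function_smooth[OF \<eta>(1)]]
        unfolding set_integrable_def[symmetric]
        by (intro set_integrable_compact_continuous S continuous_intros) (auto simp: positive_solution_def)
      show "integrable lebesgue (\<lambda>x. ?\<zeta> x * ?P x + indicator S x *\<^sub>R C0)"
        using iY iS unfolding set_integrable_def by (rule Bochner_Integration.integrable_add)
      fix x
      have "A * \<eta> x ^ m * (u x)\<^sup>2 \<le> ?\<zeta> x * ?P x + C0"
        unfolding C0_def using B[of x] u
        by (intro keller_osserman_pointwise p m \<eta>(2)) (auto simp: A_def positive_solution_def)
      moreover have "0 \<le> ?\<zeta> x * ?P x" using \<eta>(2) by simp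
      ultimately show "indicator S x *\<^sub>R (A * \<eta> x ^ m * (u x)\<^sup>2) \<le> ?\<zeta> x * ?P x + indicator S x *\<^sub>R C0"
        by (cases "x \<in> S") auto
    qed
    also have "\<dots> = (LINT x|lebesgue. ?\<zeta> x * ?P x) + C"
      unfolding C_def set_lebesgue_integral_def using iY iS unfolding set_integrable_def
      by (rule Bochner_Integration.integral_add)
    finally have sum: "(LINT x|lebesgue. ?\<zeta> x * ?E x) + (LINT x|lebesgue. ?\<zeta> x * ?P x) \<le> C"
      using caccioppoli[OF u \<eta>(1,2) b S_def, of m]
      unfolding Q A_def Bochner_Integration.integral_minus by linarith
    have nn: "0 \<le> (LINT x|lebesgue. ?\<zeta> x * ?E x)" "0 \<le> (LINT x|lebesgue. ?\<zeta> x * ?P x)"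
      using \<eta>(2) by (auto intro!: integral_nonneg)
    have Kl: "K \<in> sets lebesgue" using lmeasurable_compact[OF K(1)] by auto
    have z: "0 \<le> ?\<zeta> x" "x \<in> K \<Longrightarrow> 1 \<le> ?\<zeta> x" for x
      using \<eta>(2,3)[of x] by (auto intro!: one_le_power simp del: power_Suc power_add)
    have Em: "?E \<in> borel_measurable lebesgue" using H1_energy_integrable[OF g] by auto
    have "H1_energy K u \<le> (LINT x|lebesgue. ?\<zeta> x * ?E x)"
      unfolding H1_energy_def by (rule set_integrable_mono_test(2)[OF Kl Em _ z iE]) auto
    moreover have Pm: "?P \<in> borel_measurable lebesgue"
      by (rule measurable_lebesgue_continuous[OF positive_solution_powr_continuous[OF u]])
    have "set_integrable lebesgue K ?P" "(LINT x:K|lebesgue. ?P x) \<le> (LINT x|lebesgue. ?\<zeta> x * ?P x)"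
      by (rule set_integrable_mono_test[OF Kl Pm _ z iY], simp, assumption)+
    ultimately show ?thesis using sum nn by simp
  qed
  then show ?thesis using that[OF \<epsilon>0(1)] by blast
qed

subsection \<open>Energy concentration in a cell of the lattice\<close>

text \<open>This is \<open>caccioppoli\<close> with \<open>m = 0\<close>: the nonlinear term is
  estimated by \<open>Q \<le> 1\<close> and the cutoff term by
  \<open>(u x)\<^sup>2 \<le> 1 + u x powr p\<close>. It is used to transfer divergence of the energy
  in \<open>K\<close> to the \<open>p\<close>-th power integral over \<open>U\<close>.\<close>

lemma energy_le_powr_integral:
  fixes K U :: "(real ^ 'n) set"
  assumes p: "2 < p" and K: "compact K" "K \<subseteq> U" and U: "open U" "bounded U"
  obtains C where "0 < C"
    "\<And>\<epsilon> u. positive_solution p \<epsilon> u \<Longrightarrow>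
       set_integrable lebesgue U (\<lambda>x. u x powr p) \<and> H1_energy K u \<le> C * (1 + (LINT x:U|lebesgue. u x powr p))"
proof -
  obtain \<eta> where \<eta>: "test_function \<eta>" "\<And>x. 0 \<le> \<eta> x" "\<And>x. x \<in> K \<Longrightarrow> 1 \<le> \<eta> x"
    "closure {x. \<eta> x \<noteq> 0} \<subseteq> U"
    using test_function_bump[OF K(1) U(1) K(2)] by metis
  define S where "S = closure {x. \<eta> x \<noteq> 0}"
  have S: "compact S" "S \<subseteq> U" "\<And>x. \<eta> x \<noteq> 0 \<Longrightarrow> x \<in> S"
    using test_function_support[OF \<eta>(1)] \<eta>(4) by (auto simp: S_def)
  obtain B where B: "\<And>x. \<bar>\<eta> x\<bar> \<le> B" "B > 0" using test_function_bounded[OF \<eta>(1)] by blast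
  obtain b where b: "\<And>x. norm (grad \<eta> x) \<le> b" using grad_bounded[OF \<eta>(1)] by blast
  let ?\<zeta> = "\<lambda>x. \<eta> x ^ (0 + 2)"
  have \<zeta>: "test_function ?\<zeta>" using test_function_power[OF \<eta>(1), of 1] by (simp add: power2_eq_square)
  have Us: "U \<in> sets lebesgue" using lmeasurable_open[OF U(2,1)] by auto
  have cU: "set_integrable lebesgue U f" if "continuous_on UNIV f" for f :: "real ^ 'n \<Rightarrow> real"
    using set_integrable_compact_continuous[OF _ that, of "closure U"] U(2) Us closure_subset
    by (auto intro: set_integrable_subset simp: compact_closure)
  define V where "V = (LINT x:U|lebesgue. (1 :: real))"
  have V0: "0 \<le> V" unfolding V_def set_lebesgue_integral_def by (rule Bochner_Integration.integral_nonneg) auto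
  define A where "A = ((real 0 + 2) * b)\<^sup>2"
  define D where "D = 2 * B\<^sup>2 + A"
  have D: "D > 0" unfolding D_def A_def using B by (simp add: add_pos_nonneg)
  have "set_integrable lebesgue U (\<lambda>x. u x powr p) \<and> H1_energy K u \<le> D * (V + 1) * (1 + (LINT x:U|lebesgue. u x powr p))"
    if u: "positive_solution p \<epsilon> u" for \<epsilon> u
  proof -
    have g: "has_weak_gradient u (weak_grad u)" using u by (rule positive_solution_weak_gradient)
    have pos: "u x > 0" for x using u by (simp add: positive_solution_def)
    let ?E = "\<lambda>x. (norm (weak_grad u x))\<^sup>2 + (u x)\<^sup>2"
    let ?P = "\<lambda>x. u x powr p"
    have iE: "integrable lebesgue (\<lambda>x. ?\<zeta> x * ?E x)" by (rule integrable_test_function_energy[OF \<zeta> g])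
    have iP: "set_integrable lebesgue U ?P" by (rule cU[OF positive_solution_powr_continuous[OF u]])
    have i1: "set_integrable lebesgue U (\<lambda>x. 1 + ?P x)"
      by (intro set_integral_add cU[OF continuous_on_const] iP)
    have iY: "integrable lebesgue (\<lambda>x. Q \<epsilon> x * (?\<zeta> x * ?P x))" by (rule positive_solution_tested(2)[OF u \<zeta>])
    let ?R = "\<lambda>x. indicator S x *\<^sub>R (A * \<eta> x ^ 0 * (u x)\<^sup>2)"
    have iR: "integrable lebesgue ?R"
      using u smooth_continuous[OF test_function_smooth[OF \<eta>(1)]]
      unfolding set_integrable_def[symmetric]
      by (intro set_integrable_compact_continuous S continuous_intros) (auto simp: positive_solution_def)
    have pw: "2 * (Q \<epsilon> x * (?\<zeta> x * ?P x)) + ?R x \<le> indicator U x *\<^sub>R (D * (1 + ?P x))" for x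
    proof (cases "x \<in> S")
      case False
      then have "\<eta> x = 0" using S(3) by blast
      moreover have "0 \<le> D * (1 + ?P x)" using D by simp
      ultimately show ?thesis using False by (simp add: indicator_def)
    next
      case True
      have "(u x)\<^sup>2 \<le> 1 + ?P x"
      proof (cases "u x \<le> 1")
        case True
        then have "(u x)\<^sup>2 \<le> 1" using pos[of x] by (simp add: power_le_one)
        then show ?thesis by (simp add: add_increasing2)
      next
        case False
        then have "u x powr 2 \<le> ?P x" using p by (intro powr_mono) auto
        then show ?thesis using pos[of x] by (simp add: powr_numeral)
      qed
      then have 1: "A * (u x)\<^sup>2 \<le> A * (1 + ?P x)" by (intro mult_left_mono) (auto simp: A_def)
      have "?\<zeta> x \<le> B\<^sup>2" using power_mono[OF B(1), of x 2] by (simp add: power2_eq_square)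
      then have "?\<zeta> x * ?P x \<le> B\<^sup>2 * (1 + ?P x)" by (intro mult_mono) auto
      then have 2: "Q \<epsilon> x * (?\<zeta> x * ?P x) \<le> B\<^sup>2 * (1 + ?P x)" by (auto simp: Q_def intro: order_trans[of _ 0])
      have "x \<in> U" using True S by blast
      then have "indicator U x *\<^sub>R (D * (1 + ?P x)) = 2 * (B\<^sup>2 * (1 + ?P x)) + A * (1 + ?P x)"
        by (simp add: D_def algebra_simps)
      moreover have "?R x = A * (u x)\<^sup>2" using True by simp
      ultimately show ?thesis using 1 2 by linarith
    qed
    have "(LINT x|lebesgue. ?\<zeta> x * ?E x) \<le> (LINT x|lebesgue. 2 * (Q \<epsilon> x * (?\<zeta> x * ?P x)) + ?R x)"
      using caccioppoli[OF u \<eta>(1,2) b S_def, of 0]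
        Bochner_Integration.integral_add[OF integrable_mult_right[OF iY] iR, of 2]
      unfolding A_def set_lebesgue_integral_def by (simp only: integral_mult_right_zero)
    also have "\<dots> \<le> (LINT x:U|lebesgue. D * (1 + ?P x))"
      unfolding set_lebesgue_integral_def
      using set_integrable_mult_right[OF i1, of D] iY iR pw
      by (intro integral_mono) (auto simp: set_integrable_def)
    also have "\<dots> = D * (V + (LINT x:U|lebesgue. ?P x))"
      using set_integral_add(2)[OF cU[OF continuous_on_const] iP] by (simp add: V_def)
    also have "\<dots> \<le> D * ((V + 1) * (1 + (LINT x:U|lebesgue. ?P x)))"
    proof (intro mult_left_mono)
      have "0 \<le> (LINT x:U|lebesgue. ?P x)" unfolding set_lebesgue_integral_def by (intro Bochner_Integration.integral_nonneg) auto
      then show "V + (LINT x:U|lebesgue. ?P x) \<le> (V + 1) * (1 + (LINT x:U|lebesgue. ?P x))"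
        using V0 by (simp add: algebra_simps)
    qed (use D in auto)
    finally have *: "(LINT x|lebesgue. ?\<zeta> x * ?E x) \<le> D * (V + 1) * (1 + (LINT x:U|lebesgue. ?P x))"
      by (simp add: mult.assoc)
    have Kl: "K \<in> sets lebesgue" using lmeasurable_compact[OF K(1)] by auto
    have Em: "?E \<in> borel_measurable lebesgue" using H1_energy_integrable[OF g] by auto
    have "H1_energy K u \<le> (LINT x|lebesgue. ?\<zeta> x * ?E x)"
      unfolding H1_energy_def
      by (rule set_integrable_mono_test(2)[OF Kl Em _ _ one_le_power[OF \<eta>(3)] iE]) auto
    with * iP show ?thesis by linarith
  qed
  moreover have "D * (V + 1) > 0" using D V0 by simp
  ultimately show ?thesis using that by blast
qed

section \<open>Cells of the lattice and the pigeonhole step\<close>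

text \<open>Half-open cubes are used so that the cells of the lattice points partition the space
  exactly.\<close>

definition cell :: "real ^ 'n \<Rightarrow> (real ^ 'n) set" where
  "cell y = {x. \<forall>i. y $ i - 1 / 2 \<le> x $ i \<and> x $ i < y $ i + 1 / 2}"

lemma cell_sets: "cell y \<in> sets lebesgue"
proof -
  have "cell y = (\<Inter>i\<in>UNIV. {x. y $ i - 1 / 2 \<le> x $ i} \<inter> {x. x $ i < y $ i + 1 / 2})"
    by (auto simp: cell_def)
  also have "\<dots> \<in> sets lebesgue"
    by (intro sets_completionI_sets, unfold sets_lborel, intro sets.finite_INT sets.Int borel_closed borel_open closed_Collect_le open_Collect_less
        continuous_intros) auto
  finally show ?thesis .
qed

lemma int_lattice_eqI:
  assumes "y \<in> int_lattice" "z \<in> int_lattice" "\<And>i. \<bar>y $ i - z $ i\<bar> < 1"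
  shows "y = z"
  unfolding vec_eq_iff
proof
  fix i
  have "y $ i - z $ i \<in> \<int>" using assms(1,2) by (auto simp: int_lattice_def)
  then show "y $ i = z $ i" using assms(3)[of i] Ints_nonzero_abs_less1 by fastforce
qed

lemma cell_disjoint:
  assumes "y \<in> int_lattice" "z \<in> int_lattice" "x \<in> cell y" "x \<in> cell z"
  shows "y = z"
proof (rule int_lattice_eqI[OF assms(1,2)])
  fix i
  have "y $ i - 1 / 2 \<le> x $ i" "x $ i < y $ i + 1 / 2" "z $ i - 1 / 2 \<le> x $ i" "x $ i < z $ i + 1 / 2"
    using assms(3,4) by (auto simp: cell_def)
  then show "\<bar>y $ i - z $ i\<bar> < 1" by linarith
qed

lemma cell_cover: "\<exists>y\<in>int_lattice. x \<in> cell y"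
proof (rule bexI)
  show "(\<chi> i. of_int \<lfloor>x $ i + 1 / 2\<rfloor>) \<in> int_lattice" by (simp add: int_lattice_def)
  have "of_int \<lfloor>x $ i + 1 / 2\<rfloor> - 1 / 2 \<le> x $ i \<and> x $ i < of_int \<lfloor>x $ i + 1 / 2\<rfloor> + 1 / 2" for i
    by linarith
  then show "x \<in> cell (\<chi> i. of_int \<lfloor>x $ i + 1 / 2\<rfloor>)" by (simp add: cell_def)
qed

text \<open>A point is coordinatewise within 1/2 of the centre of its cell and strictly within 1/2
  of the centre \<open>z\<close> of a ball containing it. The two lattice points thus differ by less
  than 1 in every coordinate, so they coincide.\<close>

lemma cell_Theta:
  assumes "y \<in> int_lattice" "\<epsilon> \<le> 1 / 2" "x \<in> cell y" "x \<in> Theta \<epsilon>"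
  shows "x \<in> ball y \<epsilon>"
proof -
  obtain z where z: "z \<in> int_lattice" "dist z x < \<epsilon>" using assms(4) by (auto simp: Theta_def)
  have "y = z"
  proof (rule int_lattice_eqI[OF assms(1) z(1)])
    fix i
    have "\<bar>(z - x) $ i\<bar> < 1 / 2" using component_le_norm_cart[of "z - x" i] z(2) assms(2) by (simp add: dist_norm)
    moreover have "y $ i - 1 / 2 \<le> x $ i" "x $ i < y $ i + 1 / 2" using assms(3) by (auto simp: cell_def)
    ultimately show "\<bar>y $ i - z $ i\<bar> < 1" by (simp only: vector_minus_component abs_less_iff) linarith
  qed
  then show ?thesis using z by simp
qed

lemma countable_int_lattice: "countable (int_lattice :: (real ^ 'n) set)"
proof -
  have "int_lattice \<subseteq> vec_lambda ` (PiE UNIV (\<lambda>_::'n. \<int>) :: ('n \<Rightarrow> real) set)"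
    by (auto simp: int_lattice_def PiE_def intro!: image_eqI[of _ _ "vec_nth _"])
  moreover have "countable (\<int> :: real set)" by (simp add: Ints_def)
  ultimately show ?thesis
    by (meson countable_PiE countable_image countable_subset finite)
qed

lemma integral_pos_of_cells:
  fixes f :: "real ^ 'n \<Rightarrow> real"
  assumes f: "integrable lebesgue f" and pos: "\<And>y. y \<in> int_lattice \<Longrightarrow> 0 < (LINT x:cell y|lebesgue. f x)"
  shows "0 < (LINT x|lebesgue. f x)"
proof -
  let ?L = "int_lattice :: (real ^ 'n) set"
  define A where "A n = (\<Union>y\<in>{y\<in>?L. to_nat_on ?L y = n}. cell y)" for n
  have inj: "inj_on (to_nat_on ?L) ?L" by (rule inj_on_to_nat_on[OF countable_int_lattice])
  have A: "A (to_nat_on ?L y) = cell y" if "y \<in> ?L" for y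
  proof -
    have "{z\<in>?L. to_nat_on ?L z = to_nat_on ?L y} = {y}" using that inj by (auto dest: inj_onD)
    then show ?thesis by (simp add: A_def)
  qed
  have A0: "A n = {}" if "n \<notin> to_nat_on ?L ` ?L" for n using that by (auto simp: A_def)
  have Am: "A n \<in> sets lebesgue" for n
    using A A0[of n] cell_sets by (cases "n \<in> to_nat_on ?L ` ?L") auto
  have dis: "A i \<inter> A j = {}" if "i \<noteq> j" for i j
    using that by (auto simp: A_def dest: cell_disjoint)
  have "x \<in> (\<Union>n. A n)" for x using cell_cover[of x] unfolding A_def by blast
  then have un: "(\<Union>n. A n) = UNIV" by blast
  have si: "set_integrable lebesgue S f" if "S \<in> sets lebesgue" for S
    using integrable_mult_indicator[OF that f] by (simp add: set_integrable_def)
  have an: "0 \<le> (LINT x:A n|lebesgue. f x)" for n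
  proof (cases "n \<in> to_nat_on ?L ` ?L")
    case True
    then obtain y where "y \<in> ?L" "n = to_nat_on ?L y" by blast
    then show ?thesis using A[of y] pos[of y] by simp
  qed (simp add: A0 set_lebesgue_integral_def)
  have eq: "(LINT x|lebesgue. f x) = (\<Sum>n. LINT x:A n|lebesgue. f x)"
    using lebesgue_integral_countable_add[of A lebesgue f, OF Am dis] si[of UNIV] unfolding un
    by (simp add: set_lebesgue_integral_def)
  have sm: "summable (\<lambda>n. LINT x:A n|lebesgue. f x)"
  proof (rule summableI_nonneg_bounded[OF an])
    fix N
    have "(\<Sum>n<N. LINT x:A n|lebesgue. f x) = (LINT x:(\<Union>n<N. A n)|lebesgue. f x)"
      using dis by (intro set_integral_finite_Union[symmetric] si Am) (auto simp: disjoint_family_on_def)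
    also have "\<dots> \<le> (LINT x|lebesgue. \<bar>f x\<bar>)"
      unfolding set_lebesgue_integral_def
      using si[of "\<Union>n<N. A n"] Am f
      by (intro integral_mono) (auto simp: set_integrable_def indicator_def)
    finally show "(\<Sum>n<N. LINT x:A n|lebesgue. f x) \<le> (LINT x|lebesgue. \<bar>f x\<bar>)" .
  qed
  have "0 < (LINT x:A (to_nat_on ?L 0)|lebesgue. f x)"
    using A[OF int_lattice_zero] pos[OF int_lattice_zero] by simp
  from suminf_pos2[OF sm an this] show ?thesis unfolding eq .
qed

lemma integral_pos_open:
  fixes f :: "'a::euclidean_space \<Rightarrow> real"
  assumes f: "integrable lebesgue f" "\<And>x. 0 \<le> f x" and S: "open S" "S \<noteq> {}" "\<And>x. x \<in> S \<Longrightarrow> 0 < f x"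
  shows "0 < (LINT x|lebesgue. f x)"
proof -
  have "(LINT x|lebesgue. f x) \<noteq> 0"
  proof
    assume "(LINT x|lebesgue. f x) = 0"
    then have "AE x in lebesgue. f x = 0" using integral_nonneg_eq_0_iff_AE[OF f(1)] f(2) by blast
    then have ae: "AE x in lebesgue. x \<notin> S" by eventually_elim (use S(3) in force)
    have "S \<in> sets lebesgue" using S(1) by (intro sets_completionI_sets) (auto intro: borel_open)
    then have "negligible S" using ae by (simp only: negligible_iff_null_sets AE_iff_null_sets)
    then show False using open_not_negligible S by blast
  qed
  moreover have "0 \<le> (LINT x|lebesgue. f x)" using f(2) by (intro Bochner_Integration.integral_nonneg)
  ultimately show ?thesis by linarith
qed

lemma integral_H1_energy_pos:
  assumes u: "positive_solution p \<epsilon> u"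
  shows "0 < H1_energy UNIV u"
proof -
  have "0 < (norm (weak_grad u x))\<^sup>2 + (u x)\<^sup>2" for x
    using u by (intro add_nonneg_pos) (auto simp: positive_solution_def less_imp_neq[THEN not_sym])
  then have "0 < (LINT x|lebesgue. (norm (weak_grad u x))\<^sup>2 + (u x)\<^sup>2)"
    by (intro integral_pos_open[of _ UNIV] H1_energy_integrable[OF positive_solution_weak_gradient[OF u]])
       (auto intro: less_imp_le)
  then show ?thesis by (simp add: H1_energy_def set_lebesgue_integral_def)
qed

text \<open>If \<open>Q \<epsilon> x * u x powr p\<close> were not integrable, testing the equation with \<open>u\<close> would give
  energy \<open>0\<close>, since the integral of a non-integrable function is \<open>0\<close>.\<close>

lemma exists_concentration_cell:
  fixes u :: "real ^ 'n \<Rightarrow> real"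
  assumes u: "positive_solution p \<epsilon> u" and \<epsilon>: "\<epsilon> < 1 / 2"
  obtains y where "y \<in> int_lattice" "H1_energy (cell y) u \<le> (LINT x:ball y \<epsilon>|lebesgue. u x powr p)"
proof -
  have "\<exists>y\<in>int_lattice. H1_energy (cell y) u \<le> (LINT x:ball y \<epsilon>|lebesgue. u x powr p)"
  proof (rule ccontr)
    assume "\<not> ?thesis"
    then have *: "(LINT x:ball y \<epsilon>|lebesgue. u x powr p) < H1_energy (cell y) u" if "y \<in> int_lattice" for y
      using that by (meson not_le)
    let ?E = "\<lambda>x. (norm (weak_grad u x))\<^sup>2 + (u x)\<^sup>2"
    let ?P = "\<lambda>x. u x powr p"
    have iE: "integrable lebesgue ?E" by (rule H1_energy_integrable[OF positive_solution_weak_gradient[OF u]])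
    have uH: "u \<in> H1" using u by (simp add: positive_solution_def weak_solution_def)
    have PQ: "Q \<epsilon> x * \<bar>u x\<bar> powr (p - 2) * u x * u x = Q \<epsilon> x * ?P x" for x
      using positive_solution_nonlinearity[OF u, of x] by (simp add: mult.assoc)
    have "(LINT x|lebesgue. weak_grad u x \<bullet> weak_grad u x + u x * u x)
        = (LINT x|lebesgue. Q \<epsilon> x * \<bar>u x\<bar> powr (p - 2) * u x * u x)"
      using u uH unfolding positive_solution_def weak_solution_def by blast
    then have EQ: "(LINT x|lebesgue. ?E x) = (LINT x|lebesgue. Q \<epsilon> x * ?P x)"
      unfolding PQ by (simp add: power2_norm_eq_inner power2_eq_square[of "u _"])
    have "0 < (LINT x|lebesgue. Q \<epsilon> x * ?P x)"
      using integral_H1_energy_pos[OF u] EQ by (simp add: H1_energy_def set_lebesgue_integral_def)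
    then have iQ: "integrable lebesgue (\<lambda>x. Q \<epsilon> x * ?P x)" using not_integrable_integral_eq by fastforce
    have Pm: "?P \<in> borel_measurable lebesgue"
      by (rule measurable_lebesgue_continuous[OF positive_solution_powr_continuous[OF u]])
    have iP: "integrable lebesgue ?P"
      by (rule Bochner_Integration.integrable_bound[OF iQ Pm]) (auto simp: Q_def)
    have iT: "integrable lebesgue (\<lambda>x. indicator (Theta \<epsilon>) x * ?P x)"
      using integrable_mult_indicator[OF Theta_sets iP] by simp
    \<comment> \<open>Dropping the region where \<open>Q\<close> is negative replaces
      \<open>Q\<close> by the indicator of \<open>Theta \<epsilon>\<close>. If every cell violated
      the claim, the same integral would be positive by
      \<open>integral_pos_of_cells\<close>.\<close>
    have "(LINT x|lebesgue. ?E x - indicator (Theta \<epsilon>) x * ?P x) \<le> 0"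
    proof -
      have "(LINT x|lebesgue. Q \<epsilon> x * ?P x) \<le> (LINT x|lebesgue. indicator (Theta \<epsilon>) x * ?P x)"
        by (intro integral_mono iQ iT) (auto simp: Q_def)
      then show ?thesis using EQ iE iT by simp
    qed
    moreover have "0 < (LINT x|lebesgue. ?E x - indicator (Theta \<epsilon>) x * ?P x)"
    proof (rule integral_pos_of_cells)
      show "integrable lebesgue (\<lambda>x. ?E x - indicator (Theta \<epsilon>) x * ?P x)"
        by (intro Bochner_Integration.integrable_diff iE iT)
      fix y :: "real ^ 'n" assume y: "y \<in> int_lattice"
      have bl: "ball y \<epsilon> \<in> sets lebesgue" by (intro sets_completionI_sets) auto
      have "(LINT x:cell y|lebesgue. indicator (Theta \<epsilon>) x * ?P x) \<le> (LINT x:ball y \<epsilon>|lebesgue. ?P x)"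
        unfolding set_lebesgue_integral_def
      proof (rule integral_mono)
        show "integrable lebesgue (\<lambda>x. indicat_real (cell y) x *\<^sub>R (indicator (Theta \<epsilon>) x * ?P x))"
          by (rule integrable_mult_indicator[OF cell_sets iT])
        show "integrable lebesgue (\<lambda>x. indicat_real (ball y \<epsilon>) x *\<^sub>R ?P x)"
          by (rule integrable_mult_indicator[OF bl iP])
        show "indicat_real (cell y) x *\<^sub>R (indicator (Theta \<epsilon>) x * ?P x) \<le> indicat_real (ball y \<epsilon>) x *\<^sub>R ?P x" for x
          using cell_Theta[OF y less_imp_le[OF \<epsilon>], of x] by (auto simp: indicator_def)
      qed
      moreover have "(LINT x:cell y|lebesgue. ?E x - indicator (Theta \<epsilon>) x * ?P x)
          = (LINT x:cell y|lebesgue. ?E x) - (LINT x:cell y|lebesgue. indicator (Theta \<epsilon>) x * ?P x)"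
        using integrable_mult_indicator[OF cell_sets iE] integrable_mult_indicator[OF cell_sets iT]
        by (intro set_integral_diff) (auto simp: set_integrable_def)
      ultimately show "0 < (LINT x:cell y|lebesgue. ?E x - indicator (Theta \<epsilon>) x * ?P x)"
        using *[OF y] by (simp add: H1_energy_def)
    qed
    ultimately show False by simp
  qed
  then show thesis using that by blast
qed

subsection \<open>Mollified averages\<close>

lemma frechet_derivative_expand:
  assumes "smooth f"
  shows "frechet_derivative f (at x) h = (\<Sum>i\<in>UNIV. h $ i * partial_deriv i f x)"
proof -
  have lin: "linear (frechet_derivative f (at x))"
    using smooth_has_derivative[OF assms] has_derivative_linear by blast
  have "frechet_derivative f (at x) h = frechet_derivative f (at x) (\<Sum>i\<in>UNIV. h $ i *\<^sub>R axis i 1)"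
    using basis_expansion[of h] by (simp add: scalar_mult_eq_scaleR)
  also have "\<dots> = (\<Sum>i\<in>UNIV. h $ i * partial_deriv i f x)"
    using lin by (simp add: linear_sum linear_cmul partial_deriv_def)
  finally show ?thesis .
qed

text \<open>The square is a double integral, and f(x) f(y) is at most the sum of the two squares.
  This crude inequality holds for infinite values too; it costs the factor 2, which affects only
  constants.\<close>

lemma nn_integral_Cauchy_Schwarz_weighted:
  fixes k f :: "'a \<Rightarrow> ennreal"
  assumes [measurable]: "k \<in> borel_measurable M" "f \<in> borel_measurable M"
  shows "(\<integral>\<^sup>+x. k x * f x \<partial>M)\<^sup>2 \<le> 2 * (\<integral>\<^sup>+x. k x \<partial>M) * (\<integral>\<^sup>+x. k x * (f x)\<^sup>2 \<partial>M)"
proof -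
  let ?I = "\<integral>\<^sup>+x. k x \<partial>M" and ?J = "\<integral>\<^sup>+x. k x * (f x)\<^sup>2 \<partial>M"
  have ab: "a * b \<le> a\<^sup>2 + b\<^sup>2" for a b :: ennreal
  proof (cases "a \<le> b")
    case True
    then have "a * b \<le> b * b" by (intro mult_right_mono) auto
    then show ?thesis by (simp add: power2_eq_square add_increasing)
  next
    case False
    then have "a * b \<le> a * a" by (intro mult_left_mono) auto
    then show ?thesis by (simp add: power2_eq_square add_increasing2)
  qed
  have "(\<integral>\<^sup>+x. k x * f x \<partial>M)\<^sup>2 = (\<integral>\<^sup>+x. (\<integral>\<^sup>+y. k x * f x * (k y * f y) \<partial>M) \<partial>M)"
    by (simp add: power2_eq_square nn_integral_cmult nn_integral_multc)
  also have "\<dots> \<le> (\<integral>\<^sup>+x. (\<integral>\<^sup>+y. k x * (f x)\<^sup>2 * k y + k x * (k y * (f y)\<^sup>2) \<partial>M) \<partial>M)"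
  proof (intro nn_integral_mono)
    fix x y
    have "k x * k y * (f x * f y) \<le> k x * k y * ((f x)\<^sup>2 + (f y)\<^sup>2)" by (intro mult_left_mono ab) auto
    then show "k x * f x * (k y * f y) \<le> k x * (f x)\<^sup>2 * k y + k x * (k y * (f y)\<^sup>2)"
      by (simp add: algebra_simps)
  qed
  also have "\<dots> = (\<integral>\<^sup>+x. k x * (f x)\<^sup>2 * ?I + k x * ?J \<partial>M)"
    by (intro nn_integral_cong) (simp add: nn_integral_add nn_integral_cmult)
  also have "\<dots> = ?J * ?I + ?I * ?J" by (simp add: nn_integral_add nn_integral_multc)
  also have "\<dots> = 2 * ?I * ?J" by (simp add: algebra_simps mult_2)
  finally show ?thesis .
qed

text \<open>Rewriting as a gauge integral over a fixed box gives access to continuity in a parameter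
  and to the Leibniz rule.\<close>

lemma lebesgue_integral_cbox:
  fixes f :: "real ^ 'n \<Rightarrow> real"
  assumes c: "continuous_on UNIV f" and z: "\<And>x. x \<notin> cbox a b \<Longrightarrow> f x = 0"
  shows "integrable lebesgue f" "(LINT x|lebesgue. f x) = integral (cbox a b) f"
proof -
  show i: "integrable lebesgue f" by (rule integrable_compact_continuous[OF compact_cbox c z])
  have "(f has_integral integral (cbox a b) f) UNIV"
    using c z by (intro has_integral_on_superset[OF integrable_integral] integrable_continuous)
      (auto intro: continuous_on_subset)
  then show "(LINT x|lebesgue. f x) = integral (cbox a b) f"
    by (rule has_integral_unique[OF has_integral_integral_lebesgue[OF i]])
qed

text \<open>\<open>V\<close> is a parameter because a locale constant that depends on \<open>CARD('n)\<close> but not on \<open>\<rho>\<close>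
  would need an extra argument for the type.\<close>

locale mollifier =
  fixes \<rho> :: "real ^ 'n \<Rightarrow> real" and B V :: real
  assumes test: "test_function \<rho>" and nonneg: "\<And>w. 0 \<le> \<rho> w"
    and V: "V = unit_ball_vol (real CARD('n))"
    and bound: "\<And>w. \<rho> w \<le> B"
    and support: "\<And>w. \<rho> w \<noteq> 0 \<Longrightarrow> norm w < 1"
    and integral_eq_1: "(LINT w|lebesgue. \<rho> w) = 1"

lemma mollifier_exists: "\<exists>(\<rho> :: real ^ 'n \<Rightarrow> real) B. mollifier \<rho> B (unit_ball_vol (real CARD('n)))"
proof -
  obtain \<eta> :: "real ^ 'n \<Rightarrow> real" where \<eta>: "test_function \<eta>" "\<And>x. 0 \<le> \<eta> x" "\<And>x. x \<in> {0} \<Longrightarrow> 1 \<le> \<eta> x"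
    "closure {x. \<eta> x \<noteq> 0} \<subseteq> ball 0 1"
    using test_function_bump[of "{0}" "ball 0 1"] by auto
  have i: "integrable lebesgue \<eta>"
    using integrable_test_function_mult[OF \<eta>(1), of "\<lambda>_. 1"] by simp
  define I where "I = (LINT x|lebesgue. \<eta> x)"
  have "0 < I"
    unfolding I_def
  proof (rule integral_pos_open[OF i \<eta>(2), of "{x. \<eta> x \<noteq> 0}"])
    show "open {x. \<eta> x \<noteq> 0}"
      using smooth_continuous[OF test_function_smooth[OF \<eta>(1)]] by (intro open_Collect_neq) auto
    have "0 \<in> {x. \<eta> x \<noteq> 0}" using \<eta>(3)[of 0] by simp
    then show "{x. \<eta> x \<noteq> 0} \<noteq> {}" by blast
  qed (use \<eta>(2) in \<open>auto simp: less_le\<close>)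
  note I = this
  have t: "test_function (\<lambda>x. (1 / I) * \<eta> x)" by (intro test_function_mult smooth_const \<eta>)
  then obtain B where B: "\<And>x. \<bar>1 / I * \<eta> x\<bar> \<le> B" using test_function_bounded by blast
  have "mollifier (\<lambda>x. (1 / I) * \<eta> x) B (unit_ball_vol (real CARD('n)))"
  proof
    show "test_function (\<lambda>x. (1 / I) * \<eta> x)" by (rule t)
    show "1 / I * \<eta> w \<le> B" for w using B[of w] by linarith
    show "norm w < 1" if "1 / I * \<eta> w \<noteq> 0" for w
      using that \<eta>(4) test_function_support(2)[OF \<eta>(1), of w] by auto
  qed (use I \<eta>(2) in \<open>simp_all flip: I_def\<close>)
  then show ?thesis by blast
qed

context mollifier
begin

text \<open>The convolution of \<open>v\<close> with \<open>\<rho>\<close> rescaled to the radius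
  \<open>1 / r\<close>. Taking the inverse scale as the parameter makes the kernel smooth in
  \<open>r\<close> on the whole line, so the derivative formula below has no side condition on
  \<open>r\<close>.\<close>

definition avg :: "(real ^ 'n \<Rightarrow> real) \<Rightarrow> real \<Rightarrow> real ^ 'n \<Rightarrow> real" where
  "avg v r x = (LINT y|lebesgue. r ^ CARD('n) * \<rho> (r *\<^sub>R (x - y)) * v y)"

text \<open>The \<open>r\<close>-derivative of the kernel, written as a divergence: at w = r (x - y)
  the i-th summand is the i-th partial derivative of \<open>w $ i * \<rho> w\<close>. The dimension
  produced by differentiating \<open>r ^ CARD('n)\<close> is spread over the sum.\<close>

definition avg_deriv :: "(real ^ 'n \<Rightarrow> real) \<Rightarrow> real \<Rightarrow> real ^ 'n \<Rightarrow> real" where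
  "avg_deriv v r x = (LINT y|lebesgue. r ^ (CARD('n) - 1) *
     (\<Sum>i\<in>UNIV. \<rho> (r *\<^sub>R (x - y)) + (r *\<^sub>R (x - y)) $ i * partial_deriv i \<rho> (r *\<^sub>R (x - y))) * v y)"

lemma cont_rho: "continuous_on UNIV \<rho>"
  using test by (intro smooth_continuous test_function_smooth)

lemma cont_rho_compose [continuous_intros]:
  "continuous_on S h \<Longrightarrow> continuous_on S (\<lambda>x. \<rho> (h x))"
  by (rule continuous_on_compose2[OF cont_rho]) auto

lemma cont_partial_rho_compose [continuous_intros]:
  "continuous_on S h \<Longrightarrow> continuous_on S (\<lambda>x. partial_deriv i \<rho> (h x))"
  by (rule continuous_on_compose2[of UNIV "partial_deriv i \<rho>"])
     (simp_all add: smooth_continuous smooth_partial_deriv test_function_smooth test)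

lemma
  assumes c: "continuous_on UNIV v" and z: "\<And>x. x \<notin> cbox a b \<Longrightarrow> v x = 0"
  shows avg_has_derivative: "((\<lambda>r. avg v r x) has_real_derivative avg_deriv v r x) (at r)"
    and avg_deriv_continuous: "continuous_on UNIV (\<lambda>r. avg_deriv v r x)"
proof -
  let ?k = "\<lambda>r y. r ^ CARD('n) * \<rho> (r *\<^sub>R (x - y)) * v y"
  let ?k' = "\<lambda>r y. r ^ (CARD('n) - 1) *
     (\<Sum>i\<in>UNIV. \<rho> (r *\<^sub>R (x - y)) + (r *\<^sub>R (x - y)) $ i * partial_deriv i \<rho> (r *\<^sub>R (x - y))) * v y"
  note cv = continuous_on_compose2[OF c]
  have A: "avg v r x = integral (cbox a b) (?k r)" for r
    unfolding avg_def using z by (intro lebesgue_integral_cbox) (auto intro!: continuous_intros cv)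
  have A': "avg_deriv v r x = integral (cbox a b) (?k' r)" for r
    unfolding avg_deriv_def using z by (intro lebesgue_integral_cbox) (auto intro!: continuous_intros cv)
  have cont: "continuous_on (UNIV \<times> cbox a b) (\<lambda>(r, y). ?k' r y)"
    unfolding split_beta by (intro continuous_intros cv) auto
  show "continuous_on UNIV (\<lambda>r. avg_deriv v r x)"
    unfolding A' using cont by (rule integral_continuous_on_param)
  have d: "((\<lambda>r. ?k r y) has_real_derivative ?k' r y) (at r)" for r y
  proof -
    let ?w = "r *\<^sub>R (x - y)"
    have "((\<lambda>r. r *\<^sub>R (x - y)) has_derivative (\<lambda>h. h *\<^sub>R (x - y))) (at r)"
      by (auto intro!: derivative_eq_intros)
    from has_derivative_compose[OF this smooth_has_derivative[OF test_function_smooth[OF test]]]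
    have "((\<lambda>r. \<rho> (r *\<^sub>R (x - y))) has_derivative (\<lambda>h. frechet_derivative \<rho> (at ?w) (h *\<^sub>R (x - y)))) (at r)" .
    then have D: "((\<lambda>r. \<rho> (r *\<^sub>R (x - y))) has_real_derivative (\<Sum>i\<in>UNIV. (x - y) $ i * partial_deriv i \<rho> ?w)) (at r)"
      unfolding has_field_derivative_def frechet_derivative_expand[OF test_function_smooth[OF test]]
      by (rule has_derivative_eq_rhs) (simp add: fun_eq_iff mult.assoc mult.commute[of _ "sum _ _"] flip: sum_distrib_left)
    have "((\<lambda>r. ?k r y) has_real_derivative (real CARD('n) * r ^ (CARD('n) - 1) * \<rho> ?w
        + r ^ CARD('n) * (\<Sum>i\<in>UNIV. (x - y) $ i * partial_deriv i \<rho> ?w)) * v y) (at r)"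
      by (rule DERIV_cong[OF DERIV_cmult_right[OF DERIV_mult[OF DERIV_pow D]]]) (simp only: One_nat_def mult.commute[of "sum _ _"])
    moreover have "real CARD('n) * r ^ (CARD('n) - 1) * \<rho> ?w + r ^ CARD('n) * (\<Sum>i\<in>UNIV. (x - y) $ i * partial_deriv i \<rho> ?w)
      = r ^ (CARD('n) - 1) * (\<Sum>i\<in>UNIV. \<rho> ?w + ?w $ i * partial_deriv i \<rho> ?w)"
    proof -
      have "r ^ CARD('n) = r ^ (CARD('n) - 1) * r" by (metis power_minus_mult zero_less_card_finite)
      then show ?thesis
        by (simp add: sum.distrib sum_distrib_left distrib_left mult.assoc)
    qed
    ultimately show ?thesis by simp
  qed
  show "((\<lambda>r. avg v r x) has_real_derivative avg_deriv v r x) (at r)"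
    unfolding A A'
    by (rule leibniz_rule_field_derivative[of UNIV])
       (use d cont in \<open>auto intro!: integrable_continuous continuous_intros cv\<close>)
qed

text \<open>As a function of \<open>y\<close> the i-th summand is -1/r times a partial derivative of
  the test function \<open>?\<psi> i\<close>, so the weak gradient of \<open>v\<close> takes over.
  The division by \<open>r\<close> lowers the exponent from N - 1 to N - 2, and \<open>N\<close>
  keeps this subtraction of naturals from truncating.\<close>

lemma avg_deriv_weak:
  assumes N: "CARD('n) \<ge> 2" and g: "has_weak_gradient v g" and r: "r > 0"
  shows "avg_deriv v r x = r ^ (CARD('n) - 2) * (LINT y|lebesgue. \<rho> (r *\<^sub>R (x - y)) * ((r *\<^sub>R (x - y)) \<bullet> g y))"
    and "integrable lebesgue (\<lambda>y. \<rho> (r *\<^sub>R (x - y)) * ((r *\<^sub>R (x - y)) \<bullet> g y))"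
proof -
  note L2 = has_weak_gradient_L2[OF g]
  have sm: "smooth \<rho>" by (rule test_function_smooth[OF test])
  let ?\<theta> = "\<lambda>i w. w $ i * \<rho> w"
  let ?\<psi> = "\<lambda>i y. ?\<theta> i ((- r) *\<^sub>R y + r *\<^sub>R x)"
  have w: "(- r) *\<^sub>R y + r *\<^sub>R x = r *\<^sub>R (x - y)" for y by (simp add: algebra_simps)
  have \<theta>: "test_function (?\<theta> i)" for i by (intro test_function_mult smooth_nth test)
  have \<psi>: "test_function (?\<psi> i)" for i using r by (intro test_function_affine[OF \<theta>]) auto
  have pd_nth: "partial_deriv i (\<lambda>w. w $ i) w = 1" for i :: 'n and w
    by (subst partial_deriv_eq[OF bounded_linear.has_derivative[OF bounded_linear_vec_nth has_derivative_ident]]) simp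
  have pd: "partial_deriv i (?\<psi> i) y = - r * (\<rho> (r *\<^sub>R (x - y)) + (r *\<^sub>R (x - y)) $ i * partial_deriv i \<rho> (r *\<^sub>R (x - y)))" for i y
  proof -
    have "partial_deriv i (?\<psi> i) y = - r * partial_deriv i (?\<theta> i) ((- r) *\<^sub>R y + r *\<^sub>R x)"
      by (rule partial_deriv_affine(2)[OF smooth_differentiable[OF test_function_smooth[OF \<theta>]]])
    also have "partial_deriv i (?\<theta> i) ((- r) *\<^sub>R y + r *\<^sub>R x)
      = \<rho> (r *\<^sub>R (x - y)) + (r *\<^sub>R (x - y)) $ i * partial_deriv i \<rho> (r *\<^sub>R (x - y))"
      unfolding w by (subst partial_deriv_mult[OF smooth_nth sm]) (simp add: pd_nth)
    finally show ?thesis .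
  qed
  have p: "r ^ (CARD('n) - 1) = r ^ (CARD('n) - 2) * r"
    using N by (metis Suc_1 Suc_diff_Suc Suc_le_lessD power_Suc2)
  have ig: "integrable lebesgue (\<lambda>y. g y $ i * ?\<psi> i y)" for i
    by (intro L2_mult_integrable L2_component[OF L2(2)] test_function_L2 \<psi>)
  have e: "\<rho> (r *\<^sub>R (x - y)) * ((r *\<^sub>R (x - y)) \<bullet> g y) = (\<Sum>i\<in>UNIV. g y $ i * ?\<psi> i y)" for y
    unfolding w inner_vec_def sum_distrib_left by (intro sum.cong) (simp_all add: algebra_simps)
  show "integrable lebesgue (\<lambda>y. \<rho> (r *\<^sub>R (x - y)) * ((r *\<^sub>R (x - y)) \<bullet> g y))"
    unfolding e using ig by (intro Bochner_Integration.integrable_sum)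
  have "avg_deriv v r x = (LINT y|lebesgue. (\<Sum>i\<in>UNIV. - (r ^ (CARD('n) - 2)) * (v y * partial_deriv i (?\<psi> i) y)))"
    unfolding avg_deriv_def pd p
    by (intro Bochner_Integration.integral_cong refl) (simp add: sum_distrib_left sum_distrib_right algebra_simps)
  also have "\<dots> = (\<Sum>i\<in>UNIV. - (r ^ (CARD('n) - 2)) * (LINT y|lebesgue. v y * partial_deriv i (?\<psi> i) y))"
  proof -
    have "integrable lebesgue (\<lambda>y. v y * partial_deriv i (?\<psi> i) y)" for i
      by (intro L2_mult_integrable[OF L2(1)] test_function_L2 test_function_partial_deriv \<psi>)
    from integrable_mult_right[OF this, of "- (r ^ (CARD('n) - 2))"] show ?thesis
      by (subst Bochner_Integration.integral_sum) (simp_all only: integral_mult_right_zero)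
  qed
  also have "\<dots> = (\<Sum>i\<in>UNIV. r ^ (CARD('n) - 2) * (LINT y|lebesgue. g y $ i * ?\<psi> i y))"
  proof (intro sum.cong refl)
    fix i
    have "(LINT y|lebesgue. v y * partial_deriv i (?\<psi> i) y) = - (LINT y|lebesgue. g y $ i * ?\<psi> i y)"
      using g \<psi>[of i] unfolding has_weak_gradient_def by blast
    then show "- (r ^ (CARD('n) - 2)) * (LINT y|lebesgue. v y * partial_deriv i (?\<psi> i) y)
      = r ^ (CARD('n) - 2) * (LINT y|lebesgue. g y $ i * ?\<psi> i y)" by simp
  qed
  also have "\<dots> = r ^ (CARD('n) - 2) * (LINT y|lebesgue. \<rho> (r *\<^sub>R (x - y)) * ((r *\<^sub>R (x - y)) \<bullet> g y))"
    unfolding e sum_distrib_left[symmetric] using ig by (subst Bochner_Integration.integral_sum) auto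
  finally show "avg_deriv v r x = r ^ (CARD('n) - 2) * (LINT y|lebesgue. \<rho> (r *\<^sub>R (x - y)) * ((r *\<^sub>R (x - y)) \<bullet> g y))" .
qed

lemma integral_scaled:
  assumes "r > 0"
  shows "(LINT y|lebesgue. r ^ CARD('n) * \<rho> (r *\<^sub>R (x - y))) = 1"
proof -
  have m: "\<rho> \<in> borel_measurable borel" using cont_rho by (rule borel_measurable_continuous_onI)
  have m': "(\<lambda>y. \<rho> (r *\<^sub>R (x - y))) \<in> borel_measurable borel"
    by (intro borel_measurable_continuous_onI continuous_intros)
  have "1 = (LINT w|lborel. \<rho> w)" using integral_eq_1 m integral_completion[of \<rho> lborel] by simp
  also have "\<dots> = (LINT w|density (distr lborel borel (\<lambda>y. r *\<^sub>R x + (- r) *\<^sub>R y)) (\<lambda>_. ennreal (\<bar>- r\<bar> ^ CARD('n))). \<rho> w)"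
    using assms lborel_affine[of "- r" "r *\<^sub>R x"] by simp
  also have "\<dots> = (LINT y|lborel. r ^ CARD('n) * \<rho> (r *\<^sub>R x + (- r) *\<^sub>R y))"
    using m assms by (subst integral_density) (auto simp: integral_distr)
  also have "\<dots> = (LINT y|lborel. r ^ CARD('n) * \<rho> (r *\<^sub>R (x - y)))" by (simp add: algebra_simps)
  also have "\<dots> = (LINT y|lebesgue. r ^ CARD('n) * \<rho> (r *\<^sub>R (x - y)))"
    using m' by (intro integral_completion[symmetric]) simp
  finally show ?thesis by simp
qed

text \<open>The usual approximate identity argument. Pointwise convergence suffices, as it only
  provides the end point at infinity when \<open>avg_deriv\<close> is integrated over
  \<open>r\<close> in \<open>avg_L2\<close>.\<close>

lemma avg_tendsto:
  assumes c: "continuous_on UNIV v" and z: "\<And>x. x \<notin> cbox a b \<Longrightarrow> v x = 0"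
  shows "((\<lambda>r. avg v r x) \<longlongrightarrow> v x) at_top"
proof (rule tendstoI)
  fix e :: real assume e: "e > 0"
  have "isCont v x" using c by (simp add: continuous_on_eq_continuous_at)
  then obtain d where d: "d > 0" "\<And>y. dist y x < d \<Longrightarrow> dist (v y) (v x) < e / 2"
    using e unfolding continuous_at_eps_delta by (metis half_gt_zero)
  have "dist (avg v r x) (v x) < e" if r: "r > 1 / d" for r
  proof -
    have r0: "r > 0" using d(1) r by (meson divide_pos_pos less_trans zero_less_one)
    let ?k = "\<lambda>y. r ^ CARD('n) * \<rho> (r *\<^sub>R (x - y))"
    have supp: "dist y x < d" if "?k y \<noteq> 0" for y
    proof -
      have "norm (r *\<^sub>R (x - y)) < 1" using that by (intro support) auto
      then have "dist y x * r < 1" using r0 by (simp add: dist_norm norm_minus_commute mult.commute)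
      then have "dist y x < 1 / r" using r0 by (simp add: field_simps)
      also have "1 / r < d" using r r0 d(1) by (simp add: field_simps)
      finally show ?thesis .
    qed
    obtain a' b' where ab: "ball x d \<subseteq> cbox a' b'" using bounded_subset_cbox_symmetric[OF bounded_ball] by metis
    have kz: "?k y = 0" if "y \<notin> cbox a' b'" for y
    proof (rule ccontr)
      assume "?k y \<noteq> 0"
      then have "y \<in> ball x d" using supp[of y] by (simp add: dist_commute)
      then show False using ab that by blast
    qed
    have ik: "integrable lebesgue ?k"
      by (rule lebesgue_integral_cbox[of _ a' b'], intro continuous_intros, rule kz)
    have ikv: "integrable lebesgue (\<lambda>y. ?k y * v y)"
      by (rule lebesgue_integral_cbox[of _ a b], intro continuous_intros c, simp add: z)
    have "avg v r x - v x = (LINT y|lebesgue. ?k y * v y) - (LINT y|lebesgue. ?k y) * v x"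
      using integral_scaled[OF r0, of x] by (simp add: avg_def)
    also have "\<dots> = (LINT y|lebesgue. ?k y * v y - ?k y * v x)"
      using ik ikv by simp
    finally have "\<bar>avg v r x - v x\<bar> \<le> (LINT y|lebesgue. \<bar>?k y * v y - ?k y * v x\<bar>)"
      using integral_norm_bound[of lebesgue "\<lambda>y. ?k y * v y - ?k y * v x"] by simp
    also have "\<dots> \<le> (LINT y|lebesgue. ?k y * (e / 2))"
    proof (intro integral_mono integrable_abs Bochner_Integration.integrable_diff ikv integrable_mult_left ik)
      fix y
      have k0: "0 \<le> ?k y" using nonneg r0 by simp
      show "\<bar>?k y * v y - ?k y * v x\<bar> \<le> ?k y * (e / 2)"
      proof (cases "?k y = 0")
        case False
        from d(2)[OF supp[OF this]] have "\<bar>v y - v x\<bar> \<le> e / 2" by (simp add: dist_real_def)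
        then have "?k y * \<bar>v y - v x\<bar> \<le> ?k y * (e / 2)" using k0 by (intro mult_left_mono)
        moreover have "\<bar>?k y * v y - ?k y * v x\<bar> = ?k y * \<bar>v y - v x\<bar>"
          using k0 by (metis abs_mult abs_of_nonneg right_diff_distrib)
        ultimately show ?thesis by simp
      next
        case True
        show ?thesis unfolding True by simp
      qed
    qed
    also have "\<dots> = e / 2" using integral_scaled[OF r0, of x] by (simp only: Bochner_Integration.integral_mult_left_zero)
    finally show ?thesis using e by (simp add: dist_real_def)
  qed
  then show "\<forall>\<^sub>F r in at_top. dist (avg v r x) (v x) < e"
    by (rule eventually_mono[OF eventually_gt_at_top])
qed

end

subsection \<open>Estimates for the averages\<close>

lemma le_of_ennreal_power2_le:
  assumes "(ennreal a)\<^sup>2 \<le> ennreal (c\<^sup>2)" "0 \<le> c" "0 \<le> a"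
  shows "a \<le> c"
proof -
  have "ennreal (a\<^sup>2) \<le> ennreal (c\<^sup>2)" using assms by (simp add: ennreal_power)
  then have "a\<^sup>2 \<le> c\<^sup>2" by simp
  then show ?thesis using assms(2) by (rule power2_le_imp_le)
qed

context mollifier
begin

lemma V_nonneg: "0 \<le> V"
  by (simp add: V)

lemma B_nonneg: "0 \<le> B"
  using nonneg[of 0] bound[of 0] by linarith

lemma emeasure_cball_V:
  assumes "r > 0"
  shows "emeasure lborel (cball (x :: real ^ 'n) (1 / r)) = ennreal (V / r ^ CARD('n))"
  using assms emeasure_cball[of "1 / r" x] by (simp add: V power_divide)

lemma kernel_support:
  assumes "r > 0" "\<rho> (r *\<^sub>R (x - y)) \<noteq> 0"
  shows "norm (r *\<^sub>R (x - y)) \<le> 1" "y \<in> cball x (1 / r)"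
proof -
  show n: "norm (r *\<^sub>R (x - y)) \<le> 1" using support[OF assms(2)] by simp
  then have "r * norm (x - y) \<le> 1" using assms(1) by (simp del: scaleR_right_diff_distrib)
  then show "y \<in> cball x (1 / r)" using assms(1) by (simp add: dist_norm field_simps)
qed

text \<open>Inside its support the kernel is bounded by the constant \<open>B\<close>, and
  \<open>B\<close> times the ball has mass \<open>B * V / r ^ N\<close>, with N the dimension. The
  remaining integral is kept on the ball: dropping the indicator gives the pointwise bounds, while
  integrating it over \<open>x\<close> gives the L2 bound.\<close>

lemma kernel_Cauchy_Schwarz:
  assumes r: "r > 0" and F: "integrable lebesgue F" and f: "f \<in> borel_measurable lebesgue" "\<And>y. 0 \<le> f y"
    and le: "\<And>y. \<bar>F y\<bar> \<le> \<rho> (r *\<^sub>R (x - y)) * f y"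
  shows "(ennreal \<bar>LINT y|lebesgue. F y\<bar>)\<^sup>2
    \<le> ennreal (2 * B\<^sup>2 * V / r ^ CARD('n)) * (\<integral>\<^sup>+y. indicator (cball x (1 / r)) y * ennreal ((f y)\<^sup>2) \<partial>lebesgue)"
proof -
  let ?i = "indicator (cball x (1 / r)) :: real ^ 'n \<Rightarrow> ennreal"
  let ?k = "\<lambda>y. ennreal B * ?i y" and ?I = "\<integral>\<^sup>+y. ?i y * ennreal ((f y)\<^sup>2) \<partial>lebesgue"
  have i: "?i \<in> borel_measurable lebesgue" by (intro borel_measurable_indicator) auto
  have cm: "(\<integral>\<^sup>+y. ennreal B * (?i y * h y) \<partial>lebesgue) = ennreal B * (\<integral>\<^sup>+y. ?i y * h y \<partial>lebesgue)"
    if "h \<in> borel_measurable lebesgue" for h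
    using i that by (intro nn_integral_cmult borel_measurable_times_ennreal)
  have "ennreal \<bar>LINT y|lebesgue. F y\<bar> \<le> (\<integral>\<^sup>+y. norm (F y) \<partial>lebesgue)"
    using integral_norm_bound_ennreal[OF F] by simp
  also have "\<dots> \<le> (\<integral>\<^sup>+y. ?k y * ennreal (f y) \<partial>lebesgue)"
  proof (intro nn_integral_mono)
    fix y
    show "ennreal (norm (F y)) \<le> ?k y * ennreal (f y)"
    proof (cases "\<rho> (r *\<^sub>R (x - y)) = 0")
      case True
      then show ?thesis using le[of y] by simp
    next
      case False
      have "norm (F y) \<le> B * f y" using le[of y] mult_right_mono[OF bound f(2)[of y]] by (simp add: order_trans)
      then show ?thesis using kernel_support(2)[OF r False] B_nonneg f(2) by (simp add: ennreal_leI flip: ennreal_mult)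
    qed
  qed
  finally have "(ennreal \<bar>LINT y|lebesgue. F y\<bar>)\<^sup>2 \<le> (\<integral>\<^sup>+y. ?k y * ennreal (f y) \<partial>lebesgue)\<^sup>2"
    by (intro power_mono) auto
  also have "\<dots> \<le> 2 * (\<integral>\<^sup>+y. ?k y \<partial>lebesgue) * (\<integral>\<^sup>+y. ?k y * (ennreal (f y))\<^sup>2 \<partial>lebesgue)"
    using i f by (intro nn_integral_Cauchy_Schwarz_weighted) auto
  also have "(\<integral>\<^sup>+y. ?k y \<partial>lebesgue) = ennreal (B * (V / r ^ CARD('n)))"
    using cm[of "\<lambda>_. 1"] emeasure_cball_V[OF r, of x] ennreal_mult[of B "V / r ^ CARD('n)"] r B_nonneg V_nonneg by simp
  also have "(\<integral>\<^sup>+y. ?k y * (ennreal (f y))\<^sup>2 \<partial>lebesgue) = ennreal B * ?I"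
    using cm[of "\<lambda>y. ennreal ((f y)\<^sup>2)"] f by (simp add: ennreal_power mult.assoc)
  also have "2 * ennreal (B * (V / r ^ CARD('n))) * (ennreal B * ?I) = ennreal (2 * B\<^sup>2 * V / r ^ CARD('n)) * ?I"
  proof -
    have "ennreal (2 * B\<^sup>2 * V / r ^ CARD('n)) = ennreal (2 * (B * (V / r ^ CARD('n))) * B)"
      by (simp add: power2_eq_square mult_ac)
    also have "\<dots> = ennreal (2 * (B * (V / r ^ CARD('n)))) * ennreal B"
      using r B_nonneg V_nonneg by (intro ennreal_mult) auto
    also have "ennreal (2 * (B * (V / r ^ CARD('n)))) = 2 * ennreal (B * (V / r ^ CARD('n)))"
      using r B_nonneg V_nonneg by (subst ennreal_mult) auto
    finally show ?thesis by (simp only: mult.assoc)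
  qed
  finally show ?thesis .
qed

text \<open>The factor of \<open>avg_deriv_weak\<close>, squared, meets the reciprocal N-th power of
  the kernel mass. The resulting exponent N - 4 is negative in dimensions 2 and 3, so it is written
  as a quotient.\<close>

lemma avg_deriv_power2_le:
  assumes N: "CARD('n) \<ge> 2" and g: "has_weak_gradient v g" and r: "r > 0"
  shows "(ennreal \<bar>avg_deriv v r x\<bar>)\<^sup>2 \<le> ennreal (2 * B\<^sup>2 * V * r ^ CARD('n) / r ^ 4)
    * (\<integral>\<^sup>+y. indicator (cball x (1 / r)) y * ennreal ((norm (g y))\<^sup>2) \<partial>lebesgue)"
proof -
  let ?F = "\<lambda>y. \<rho> (r *\<^sub>R (x - y)) * ((r *\<^sub>R (x - y)) \<bullet> g y)"
  let ?I = "\<integral>\<^sup>+y. indicator (cball x (1 / r)) y * ennreal ((norm (g y))\<^sup>2) \<partial>lebesgue"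
  have gm: "(\<lambda>y. norm (g y)) \<in> borel_measurable lebesgue"
    using L2_measurable[OF has_weak_gradient_L2(2)[OF g]] by auto
  have le: "\<bar>?F y\<bar> \<le> \<rho> (r *\<^sub>R (x - y)) * norm (g y)" for y
  proof (cases "\<rho> (r *\<^sub>R (x - y)) = 0")
    case False
    have "\<bar>(r *\<^sub>R (x - y)) \<bullet> g y\<bar> \<le> norm (r *\<^sub>R (x - y)) * norm (g y)" by (rule Cauchy_Schwarz_ineq2)
    also have "\<dots> \<le> 1 * norm (g y)" by (intro mult_right_mono kernel_support(1)[OF r False]) auto
    finally have "\<rho> (r *\<^sub>R (x - y)) * \<bar>(r *\<^sub>R (x - y)) \<bullet> g y\<bar> \<le> \<rho> (r *\<^sub>R (x - y)) * norm (g y)"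
      using nonneg by (intro mult_left_mono) auto
    then show ?thesis using nonneg by (simp only: abs_mult abs_of_nonneg)
  qed simp
  have r': "r ^ CARD('n) = r\<^sup>2 * r ^ (CARD('n) - 2)" using N by (metis le_add_diff_inverse power_add)
  have sq: "(ennreal \<bar>c * t\<bar>)\<^sup>2 = ennreal (c\<^sup>2) * (ennreal \<bar>t\<bar>)\<^sup>2" for c t :: real
    by (simp add: ennreal_power power_mult_distrib ennreal_mult)
  have "(ennreal \<bar>avg_deriv v r x\<bar>)\<^sup>2 = ennreal ((r ^ (CARD('n) - 2))\<^sup>2) * (ennreal \<bar>LINT y|lebesgue. ?F y\<bar>)\<^sup>2"
    unfolding avg_deriv_weak(1)[OF N g r] by (rule sq)
  also have "\<dots> \<le> ennreal ((r ^ (CARD('n) - 2))\<^sup>2) * (ennreal (2 * B\<^sup>2 * V / r ^ CARD('n)) * ?I)"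
    by (intro mult_left_mono kernel_Cauchy_Schwarz r avg_deriv_weak(2)[OF N g r] gm le) auto
  also have "\<dots> = ennreal ((r ^ (CARD('n) - 2))\<^sup>2 * (2 * B\<^sup>2 * V / r ^ CARD('n))) * ?I"
    using r V_nonneg unfolding mult.assoc[symmetric] by (subst ennreal_mult) auto
  also have "(r ^ (CARD('n) - 2))\<^sup>2 * (2 * B\<^sup>2 * V / r ^ CARD('n)) = 2 * B\<^sup>2 * V * r ^ CARD('n) / r ^ 4"
    using r unfolding r' by (simp add: field_simps power2_eq_square power4_eq_xxxx)
  finally show ?thesis .
qed

text \<open>The root of the constant in \<open>kernel_Cauchy_Schwarz\<close>.\<close>

definition sup_const :: real where
  "sup_const = sqrt (2 * B\<^sup>2 * V)"

lemma sup_const_nonneg: "0 \<le> sup_const"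
  and sup_const_power2: "sup_const\<^sup>2 = 2 * B\<^sup>2 * V"
  using V_nonneg by (auto simp: sup_const_def)

lemma ball_integral_le_1:
  assumes "(\<integral>\<^sup>+y. h y \<partial>lebesgue) \<le> 1"
  shows "ennreal c * (\<integral>\<^sup>+y. indicator S y * h y \<partial>lebesgue) \<le> ennreal c"
proof -
  have "(\<integral>\<^sup>+y. indicator S y * h y \<partial>lebesgue) \<le> (\<integral>\<^sup>+y. h y \<partial>lebesgue)"
    by (intro nn_integral_mono) (auto simp: indicator_def)
  with assms have "ennreal c * (\<integral>\<^sup>+y. indicator S y * h y \<partial>lebesgue) \<le> ennreal c * 1"
    by (intro mult_left_mono) auto
  then show ?thesis by simp
qed

lemma avg_deriv_sup:
  assumes N: "CARD('n) \<ge> 2" and g: "has_weak_gradient v g" and r: "r > 0"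
    and 1: "(\<integral>\<^sup>+y. ennreal ((norm (g y))\<^sup>2) \<partial>lebesgue) \<le> 1"
  shows "\<bar>avg_deriv v r x\<bar> \<le> sup_const * r powr (real CARD('n) / 2 - 2)"
proof (rule le_of_ennreal_power2_le)
  note avg_deriv_power2_le[OF N g r]
  also note ball_integral_le_1[OF 1]
  also have "2 * B\<^sup>2 * V * r ^ CARD('n) / r ^ 4 = (sup_const * r powr (real CARD('n) / 2 - 2))\<^sup>2"
  proof -
    have "(r powr (real CARD('n) / 2 - 2))\<^sup>2 = r powr (real CARD('n) - real 4)"
      using r by (simp add: power2_eq_square flip: powr_add)
    also have "\<dots> = r ^ CARD('n) / r ^ 4" using r by (simp only: powr_diff powr_realpow)
    finally show ?thesis by (simp add: power_mult_distrib sup_const_power2)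
  qed
  finally show "(ennreal \<bar>avg_deriv v r x\<bar>)\<^sup>2 \<le> ennreal ((sup_const * r powr (real CARD('n) / 2 - 2))\<^sup>2)" .
qed (simp_all add: sup_const_nonneg)

lemma avg_1_sup:
  assumes v: "v \<in> L2" and 1: "(\<integral>\<^sup>+y. ennreal ((v y)\<^sup>2) \<partial>lebesgue) \<le> 1"
  shows "\<bar>avg v 1 x\<bar> \<le> sup_const"
proof (rule le_of_ennreal_power2_le)
  let ?F = "\<lambda>y. \<rho> (x - y) * v y"
  have "integrable lebesgue ?F"
    using L2_mult_integrable[OF test_function_L2[OF test_function_affine[OF test, of "-1" x]] v] by simp
  then have "(ennreal \<bar>LINT y|lebesgue. ?F y\<bar>)\<^sup>2 \<le> ennreal (2 * B\<^sup>2 * V / 1 ^ CARD('n))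
      * (\<integral>\<^sup>+y. indicator (cball x (1 / 1)) y * ennreal (\<bar>v y\<bar>\<^sup>2) \<partial>lebesgue)"
    using L2_measurable[OF v] nonneg by (intro kernel_Cauchy_Schwarz) (auto simp: abs_mult)
  also have "\<dots> \<le> ennreal (2 * B\<^sup>2 * V / 1 ^ CARD('n))" using 1 by (intro ball_integral_le_1) simp
  finally show "(ennreal \<bar>avg v 1 x\<bar>)\<^sup>2 \<le> ennreal (sup_const\<^sup>2)" by (simp add: avg_def sup_const_power2)
qed (simp_all add: sup_const_nonneg)

text \<open>The bound on the derivative is integrated from 1 to \<open>R\<close>, in the form that
  the average minus its majorant decreases and their sum increases. Enlarging the exponent to
  \<open>\<beta>\<close> is allowed because \<open>r \<ge> 1\<close>; strict positivity of
  \<open>\<beta>\<close> makes the primitive a power even in dimension 2.\<close>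

lemma avg_sup:
  assumes N: "CARD('n) \<ge> 2" and g: "has_weak_gradient v g"
    and c: "continuous_on UNIV v" and z: "\<And>x. x \<notin> cbox a b \<Longrightarrow> v x = 0"
    and 1: "(\<integral>\<^sup>+y. ennreal ((norm (g y))\<^sup>2) \<partial>lebesgue) \<le> 1" "(\<integral>\<^sup>+y. ennreal ((v y)\<^sup>2) \<partial>lebesgue) \<le> 1"
    and \<beta>: "0 < \<beta>" "real CARD('n) / 2 - 1 \<le> \<beta>" and R: "1 \<le> R"
  shows "\<bar>avg v R x\<bar> \<le> (sup_const + sup_const / \<beta>) * R powr \<beta>"
proof -
  have d: "\<bar>avg_deriv v r x\<bar> \<le> sup_const * r powr (\<beta> - 1)" if "1 \<le> r" for r
  proof -
    have "\<bar>avg_deriv v r x\<bar> \<le> sup_const * r powr (real CARD('n) / 2 - 2)"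
      using that by (intro avg_deriv_sup[OF N g _ 1(1)]) auto
    also have "\<dots> \<le> sup_const * r powr (\<beta> - 1)"
      using that \<beta> by (intro mult_left_mono powr_mono sup_const_nonneg) auto
    finally show ?thesis .
  qed
  have D: "((\<lambda>r. avg v r x) has_real_derivative avg_deriv v r x) (at r)" for r
    by (rule avg_has_derivative[OF c z])
  have P: "((\<lambda>r. sup_const / \<beta> * r powr \<beta>) has_real_derivative sup_const * r powr (\<beta> - 1)) (at r)" if "1 \<le> r" for r
    using that \<beta> by (auto intro!: derivative_eq_intros)
  have "avg v R x - sup_const / \<beta> * R powr \<beta> \<le> avg v 1 x - sup_const / \<beta> * 1 powr \<beta>"
  proof (rule DERIV_nonpos_imp_nonincreasing[OF R])
    fix r assume r: "1 \<le> r" "r \<le> R"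
    show "\<exists>y. ((\<lambda>r. avg v r x - sup_const / \<beta> * r powr \<beta>) has_real_derivative y) (at r) \<and> y \<le> 0"
      using DERIV_diff[OF D P[OF r(1)]] d[OF r(1)] by (intro exI conjI) auto
  qed
  moreover have "avg v 1 x + sup_const / \<beta> * 1 powr \<beta> \<le> avg v R x + sup_const / \<beta> * R powr \<beta>"
  proof (rule DERIV_nonneg_imp_nondecreasing[OF R])
    fix r assume r: "1 \<le> r" "r \<le> R"
    show "\<exists>y. ((\<lambda>r. avg v r x + sup_const / \<beta> * r powr \<beta>) has_real_derivative y) (at r) \<and> 0 \<le> y"
      using DERIV_add[OF D P[OF r(1)]] d[OF r(1)] by (intro exI conjI) auto
  qed
  moreover have "\<bar>avg v 1 x\<bar> \<le> sup_const"
    by (rule avg_1_sup[OF has_weak_gradient_L2(1)[OF g] 1(2)])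
  moreover have "0 \<le> sup_const / \<beta>" using sup_const_nonneg \<beta> by simp
  moreover have "sup_const * 1 \<le> sup_const * R powr \<beta>"
    using R \<beta> sup_const_nonneg by (intro mult_left_mono ge_one_powr_ge_zero) auto
  ultimately show ?thesis by (simp add: distrib_right abs_le_iff)
qed

text \<open>By \<open>avg_tendsto\<close>, the difference \<open>v x - avg v R x\<close> is an
  integral of \<open>avg_deriv\<close> over \<open>r \<ge> R\<close>. Cauchy-Schwarz with the weight
  \<open>1 / r\<^sup>2\<close> gives one factor 1/R. Integrating over \<open>x\<close> replaces the
  ball by its volume, which cancels \<open>r ^ CARD('n)\<close> and leaves the integral of the
  weight, a second factor 1/R.\<close>

lemma avg_L2:
  assumes N: "CARD('n) \<ge> 2" and g: "has_weak_gradient v g"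
    and c: "continuous_on UNIV v" and z: "\<And>x. x \<notin> cbox a b \<Longrightarrow> v x = 0"
    and 1: "(\<integral>\<^sup>+y. ennreal ((norm (g y))\<^sup>2) \<partial>lebesgue) \<le> 1" and R: "0 < R"
  shows "(\<integral>\<^sup>+x. ennreal ((v x - avg v R x)\<^sup>2) \<partial>lborel) \<le> ennreal (4 * B\<^sup>2 * V\<^sup>2 / R\<^sup>2)"
proof -
  have "(\<lambda>y. ennreal ((norm (g y))\<^sup>2)) \<in> borel_measurable lebesgue"
    using L2_measurable[OF has_weak_gradient_L2(2)[OF g]] by auto
  \<comment> \<open>A Borel version of the squared gradient, so that Fubini can be applied over
    \<open>lborel\<close>.\<close>
  then obtain f where f: "f \<in> borel_measurable lborel" "AE y in lborel. ennreal ((norm (g y))\<^sup>2) = f y"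
    using completion_ex_borel_measurable by blast
  have [measurable]: "f \<in> borel_measurable borel" using f(1) by simp
  have fg: "(\<integral>\<^sup>+y. h y * ennreal ((norm (g y))\<^sup>2) \<partial>lebesgue) = (\<integral>\<^sup>+y. h y * f y \<partial>lborel)" for h
    by (subst nn_integral_completion, rule nn_integral_cong_AE) (use f(2) in \<open>eventually_elim, simp\<close>)
  \<comment> \<open>Expressing the ball through \<open>dist\<close> makes the integrand jointly
    measurable in radius, centre and point.\<close>
  define D where "D r x y = (of_bool (dist x y \<le> 1 / r) :: ennreal)" for r :: real and x y :: "real ^ 'n"
  define h where "h r x = (\<integral>\<^sup>+y. D r x y * f y \<partial>lborel)" for r x
  have [measurable]: "(\<lambda>r. h r x) \<in> borel_measurable borel" "(\<lambda>x. h r x) \<in> borel_measurable borel" for x r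
    unfolding h_def D_def by measurable
  have D1: "((\<lambda>r. avg v r x) has_real_derivative avg_deriv v r x) (at r)" for r x
    by (rule avg_has_derivative[OF c z])
  have [measurable]: "(\<lambda>r. avg_deriv v r x) \<in> borel_measurable borel" for x
    by (rule borel_measurable_continuous_onI[OF avg_deriv_continuous[OF c z]])
  \<comment> \<open>The weight is integrable at infinity with mass 1/R. Its companion factor
    \<open>r\<^sup>2\<close>, once squared, cancels the \<open>r ^ 4\<close> of
    \<open>avg_deriv_power2_le\<close>.\<close>
  define k where "k r = ennreal (1 / r\<^sup>2) * indicator {R..} r" for r :: real
  have [measurable]: "k \<in> borel_measurable borel" unfolding k_def by measurable
  have k_int: "(\<integral>\<^sup>+r. k r \<partial>lborel) = ennreal (1 / R)"
  proof -
    have "(\<integral>\<^sup>+r. ennreal (1 / r\<^sup>2) * indicator {R..} r \<partial>lborel) = ennreal (0 - (- (1 / R)))"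
    proof (rule nn_integral_FTC_atLeast)
      show "((\<lambda>r. - (1 / r)) has_real_derivative 1 / r\<^sup>2) (at r)" if "R \<le> r" for r
        using that R by (auto intro!: derivative_eq_intros simp: power2_eq_square)
      have "((\<lambda>r::real. - (inverse r)) \<longlongrightarrow> - 0) at_top" by (intro tendsto_minus tendsto_inverse_0_at_top filterlim_ident)
      then show "((\<lambda>r::real. - (1 / r)) \<longlongrightarrow> 0) at_top" by (simp add: divide_inverse)
    qed auto
    then show ?thesis by (simp add: k_def)
  qed
  \<comment> \<open>Since \<open>k r * r\<^sup>2\<close> is 1 for \<open>r \<ge> R\<close>, this is
    the integral of the absolute value of \<open>avg_deriv\<close> over that ray, arranged for the
    weighted Cauchy-Schwarz inequality.\<close>
  define T where "T x = (\<integral>\<^sup>+r. k r * ennreal (r\<^sup>2 * \<bar>avg_deriv v r x\<bar>) \<partial>lborel)" for x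
  have avg_le: "ennreal \<bar>avg v R' x - avg v R x\<bar> \<le> T x" if RR: "R \<le> R'" for R' x
  proof -
    have "isCont (\<lambda>r. avg_deriv v r x) r" for r
      using avg_deriv_continuous[OF c z] by (simp add: continuous_on_eq_continuous_at)
    then have "has_bochner_integral lborel (\<lambda>r. avg_deriv v r x * indicator {R..R'} r) (avg v R' x - avg v R x)"
      by (intro has_bochner_integral_FTC_Icc_real[OF RR D1])
    from has_bochner_integral_norm_bound[OF this]
    have "ennreal \<bar>avg v R' x - avg v R x\<bar> \<le> (\<integral>\<^sup>+r. norm (avg_deriv v r x * indicator {R..R'} r) \<partial>lborel)" by simp
    also have "\<dots> \<le> T x"
      unfolding T_def
    proof (intro nn_integral_mono)
      fix r
      show "ennreal (norm (avg_deriv v r x * indicator {R..R'} r)) \<le> k r * ennreal (r\<^sup>2 * \<bar>avg_deriv v r x\<bar>)"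
        using R by (auto simp: indicator_def k_def simp flip: ennreal_mult)
    qed
    finally show ?thesis .
  qed
  have v_le: "ennreal \<bar>v x - avg v R x\<bar> \<le> T x" for x
  proof (rule tendsto_upperbound)
    show "((\<lambda>r. ennreal \<bar>avg v r x - avg v R x\<bar>) \<longlongrightarrow> ennreal \<bar>v x - avg v R x\<bar>) at_top"
      by (intro tendsto_ennrealI tendsto_intros avg_tendsto[OF c z])
    show "\<forall>\<^sub>F r in at_top. ennreal \<bar>avg v r x - avg v R x\<bar> \<le> T x"
      using eventually_ge_at_top[of R] by eventually_elim (rule avg_le)
  qed simp
  let ?J = "\<lambda>r x. k r * (ennreal (2 * B\<^sup>2 * V * \<bar>r\<bar> ^ CARD('n)) * h r x)"
  have T2: "ennreal ((v x - avg v R x)\<^sup>2) \<le> ennreal (2 / R) * (\<integral>\<^sup>+r. ?J r x \<partial>lborel)" for x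
  proof -
    have "ennreal ((v x - avg v R x)\<^sup>2) = (ennreal \<bar>v x - avg v R x\<bar>)\<^sup>2" by (simp add: ennreal_power)
    also have "\<dots> \<le> (T x)\<^sup>2" by (intro power_mono v_le) auto
    also have "\<dots> \<le> 2 * (\<integral>\<^sup>+r. k r \<partial>lborel) * (\<integral>\<^sup>+r. k r * (ennreal (r\<^sup>2 * \<bar>avg_deriv v r x\<bar>))\<^sup>2 \<partial>lborel)"
      unfolding T_def by (rule nn_integral_Cauchy_Schwarz_weighted) measurable
    also have "2 * (\<integral>\<^sup>+r. k r \<partial>lborel) = ennreal (2 / R)"
      using ennreal_mult[of 2 "1 / R"] R unfolding k_int by simp
    also have "(\<integral>\<^sup>+r. k r * (ennreal (r\<^sup>2 * \<bar>avg_deriv v r x\<bar>))\<^sup>2 \<partial>lborel) \<le> (\<integral>\<^sup>+r. ?J r x \<partial>lborel)"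
    proof (intro nn_integral_mono)
      fix r
      show "k r * (ennreal (r\<^sup>2 * \<bar>avg_deriv v r x\<bar>))\<^sup>2 \<le> ?J r x"
      proof (cases "R \<le> r")
        case True
        then have r: "r > 0" using R by simp
        have "(ennreal (r\<^sup>2 * \<bar>avg_deriv v r x\<bar>))\<^sup>2 = ennreal (r ^ 4) * (ennreal \<bar>avg_deriv v r x\<bar>)\<^sup>2"
          by (simp add: ennreal_mult power_mult_distrib ennreal_power)
        also have "\<dots> \<le> ennreal (r ^ 4) * (ennreal (2 * B\<^sup>2 * V * r ^ CARD('n) / r ^ 4) * h r x)"
          using avg_deriv_power2_le[OF N g r, of x] unfolding fg h_def D_def
          by (intro mult_left_mono) (auto simp: indicator_def)
        also have "\<dots> = ennreal (r ^ 4 * (2 * B\<^sup>2 * V * r ^ CARD('n) / r ^ 4)) * h r x"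
          using r V_nonneg unfolding mult.assoc[symmetric] by (subst ennreal_mult) auto
        also have "r ^ 4 * (2 * B\<^sup>2 * V * r ^ CARD('n) / r ^ 4) = 2 * B\<^sup>2 * V * \<bar>r\<bar> ^ CARD('n)" using r by simp
        finally show ?thesis by (intro mult_left_mono) auto
      qed (simp add: k_def)
    qed
    finally show ?thesis by (simp add: mult_left_mono)
  qed
  have hx: "(\<integral>\<^sup>+x. h r x \<partial>lborel) \<le> ennreal (V / r ^ CARD('n))" if r: "r > 0" for r
  proof -
    have "(\<integral>\<^sup>+x. h r x \<partial>lborel) = (\<integral>\<^sup>+y. (\<integral>\<^sup>+x. D r x y * f y \<partial>lborel) \<partial>lborel)"
      unfolding h_def by (rule lborel_pair.Fubini') (simp only: split_beta D_def, measurable)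
    also have "\<dots> = (\<integral>\<^sup>+y. ennreal (V / r ^ CARD('n)) * f y \<partial>lborel)"
    proof (intro nn_integral_cong)
      fix y
      have "(\<integral>\<^sup>+x. D r x y * f y \<partial>lborel) = (\<integral>\<^sup>+x. indicator (cball y (1 / r)) x \<partial>lborel) * f y"
        using borel_measurable_indicator[OF borel_closed[OF closed_cball[of y "1 / r"]]]
        by (subst nn_integral_multc[symmetric]) (auto simp: D_def indicator_def dist_commute intro!: nn_integral_cong)
      then show "(\<integral>\<^sup>+x. D r x y * f y \<partial>lborel) = ennreal (V / r ^ CARD('n)) * f y"
        using emeasure_cball_V[OF r, of y] by simp
    qed
    also have "\<dots> = ennreal (V / r ^ CARD('n)) * (\<integral>\<^sup>+y. f y \<partial>lborel)"
      by (rule nn_integral_cmult) measurable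
    also have "\<dots> \<le> ennreal (V / r ^ CARD('n)) * 1"
      using 1 fg[of "\<lambda>_. 1"] by (intro mult_left_mono) auto
    finally show ?thesis by simp
  qed
  have "(\<integral>\<^sup>+x. ennreal ((v x - avg v R x)\<^sup>2) \<partial>lborel) \<le> (\<integral>\<^sup>+x. ennreal (2 / R) * (\<integral>\<^sup>+r. ?J r x \<partial>lborel) \<partial>lborel)"
    by (intro nn_integral_mono T2)
  also have "\<dots> = ennreal (2 / R) * (\<integral>\<^sup>+x. (\<integral>\<^sup>+r. ?J r x \<partial>lborel) \<partial>lborel)"
    by (rule nn_integral_cmult) (simp only: h_def D_def, measurable)
  also have "(\<integral>\<^sup>+x. (\<integral>\<^sup>+r. ?J r x \<partial>lborel) \<partial>lborel) = (\<integral>\<^sup>+r. (\<integral>\<^sup>+x. ?J r x \<partial>lborel) \<partial>lborel)"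
    by (rule lborel_pair.Fubini') (simp only: split_beta h_def D_def, measurable)
  also have "\<dots> \<le> (\<integral>\<^sup>+r. k r * ennreal (2 * B\<^sup>2 * V\<^sup>2) \<partial>lborel)"
  proof (intro nn_integral_mono)
    fix r
    show "(\<integral>\<^sup>+x. ?J r x \<partial>lborel) \<le> k r * ennreal (2 * B\<^sup>2 * V\<^sup>2)"
    proof (cases "R \<le> r")
      case True
      then have r: "r > 0" using R by simp
      have "(\<integral>\<^sup>+x. ?J r x \<partial>lborel) = k r * (ennreal (2 * B\<^sup>2 * V * \<bar>r\<bar> ^ CARD('n)) * (\<integral>\<^sup>+x. h r x \<partial>lborel))"
        by (simp add: nn_integral_cmult)
      also have "\<dots> \<le> k r * (ennreal (2 * B\<^sup>2 * V * \<bar>r\<bar> ^ CARD('n)) * ennreal (V / r ^ CARD('n)))"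
        by (intro mult_left_mono hx r) auto
      also have "ennreal (2 * B\<^sup>2 * V * \<bar>r\<bar> ^ CARD('n)) * ennreal (V / r ^ CARD('n))
          = ennreal (2 * B\<^sup>2 * V * \<bar>r\<bar> ^ CARD('n) * (V / r ^ CARD('n)))"
        using r V_nonneg by (intro ennreal_mult[symmetric]) auto
      also have "2 * B\<^sup>2 * V * \<bar>r\<bar> ^ CARD('n) * (V / r ^ CARD('n)) = 2 * B\<^sup>2 * V\<^sup>2"
        using r by (simp add: power2_eq_square)
      finally show ?thesis .
    qed (simp add: k_def)
  qed
  also have "\<dots> = ennreal (1 / R) * ennreal (2 * B\<^sup>2 * V\<^sup>2)"
    using k_int by (subst nn_integral_multc) auto
  also have "ennreal (2 / R) * \<dots> = ennreal (2 / R * (1 / R * (2 * B\<^sup>2 * V\<^sup>2)))"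
    using R ennreal_mult[of "1 / R" "2 * B\<^sup>2 * V\<^sup>2"] ennreal_mult[of "2 / R" "1 / R * (2 * B\<^sup>2 * V\<^sup>2)"] by simp
  also have "2 / R * (1 / R * (2 * B\<^sup>2 * V\<^sup>2)) = 4 * B\<^sup>2 * V\<^sup>2 / R\<^sup>2" by (simp add: power2_eq_square)
  finally show ?thesis by (simp add: mult_left_mono)
qed

end

subsection \<open>Subcritical Sobolev inequality on small balls\<close>

text \<open>A geometric series of ratio \<open>2 powr - a\<close>. The hypothesis
  \<open>zero\<close> makes the unfolding a finite induction, so no prior finiteness of
  \<open>M\<close> is assumed, and the bound does not depend on \<open>S\<close>.\<close>

lemma dyadic_decay:
  fixes M :: "real \<Rightarrow> ennreal"
  assumes a: "0 < a" and K: "0 \<le> K" and L: "0 < L"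
    and step: "\<And>t. L \<le> t \<Longrightarrow> M t \<le> ennreal (K * t powr - a) + M (2 * t)"
    and zero: "\<And>t. S \<le> t \<Longrightarrow> M t = 0"
  shows "M L \<le> ennreal (K / (1 - 2 powr - a) * L powr - a)"
proof -
  define q where "q = 2 powr - a"
  have q: "0 < q" "q < 1" unfolding q_def using a by (auto simp: powr_less_one)
  have main: "M t \<le> ennreal (K / (1 - q) * t powr - a)" if "L \<le> t" "S \<le> 2 ^ k * t" for t k
    using that
  proof (induction k arbitrary: t)
    case 0
    then show ?case by (simp add: zero)
  next
    case (Suc k)
    have t: "t > 0" using Suc.prems L by simp
    have IH: "M (2 * t) \<le> ennreal (K / (1 - q) * (2 * t) powr - a)"
      using Suc.prems t by (intro Suc.IH) (auto simp: mult_ac)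
    have "M t \<le> ennreal (K * t powr - a) + M (2 * t)" by (rule step[OF Suc.prems(1)])
    also have "\<dots> \<le> ennreal (K * t powr - a) + ennreal (K / (1 - q) * (2 * t) powr - a)"
      by (intro add_left_mono IH)
    also have "\<dots> = ennreal (K * t powr - a + K / (1 - q) * (2 * t) powr - a)"
      using K q by (intro ennreal_plus[symmetric]) auto
    also have "(2 * t) powr - a = q * t powr - a" using t by (simp add: powr_mult q_def)
    also have "K * t powr - a + K / (1 - q) * (q * t powr - a) = K / (1 - q) * t powr - a"
      using q by (simp add: field_simps)
    finally show ?case .
  qed
  obtain k where "S / L < 2 ^ k" using real_arch_pow[of 2 "S / L"] by auto
  then have "S \<le> 2 ^ k * L" using L by (simp add: field_simps)
  then show ?thesis using main[of L k] by (simp add: q_def)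
qed

context mollifier
begin

text \<open>One dyadic layer: where L < |v| \<le> 2 L, the average is at most L/2, so |v| is at most
  twice its distance to the average and the L2 estimate applies. Values above 2 L are passed to the
  next step.\<close>

lemma sublevel_step:
  fixes v :: "real ^ 'n \<Rightarrow> real"
  assumes N: "CARD('n) \<ge> 2" and g: "has_weak_gradient v g"
    and c: "continuous_on UNIV v" and z: "\<And>x. x \<notin> cbox a b \<Longrightarrow> v x = 0"
    and 1: "(\<integral>\<^sup>+y. ennreal ((norm (g y))\<^sup>2) \<partial>lebesgue) \<le> 1" "(\<integral>\<^sup>+y. ennreal ((v y)\<^sup>2) \<partial>lebesgue) \<le> 1"
    and \<beta>: "0 < \<beta>" "real CARD('n) / 2 - 1 \<le> \<beta>" and p: "2 < p"
    and d: "0 < d" "sup_const + sup_const / \<beta> \<le> d" and L: "2 * d \<le> L"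
  shows "(\<integral>\<^sup>+x. indicator {x. L < \<bar>v x\<bar>} x * ennreal (\<bar>v x\<bar> powr p) \<partial>lborel)
    \<le> ennreal (2 powr (p - 2) * (16 * B\<^sup>2 * V\<^sup>2) * (2 * d) powr (2 / \<beta>) * L powr - (2 / \<beta> - (p - 2)))
      + (\<integral>\<^sup>+x. indicator {x. 2 * L < \<bar>v x\<bar>} x * ennreal (\<bar>v x\<bar> powr p) \<partial>lborel)"
proof -
  have L0: "L > 0" using d L by simp
  have vm[measurable]: "v \<in> borel_measurable borel" using c by (rule borel_measurable_continuous_onI)
  \<comment> \<open>The scale at which the bound of \<open>avg_sup\<close> equals at most L/2; the
    assumption \<open>2 * d \<le> L\<close> ensures \<open>R \<ge> 1\<close>.\<close>
  define R where "R = (L / (2 * d)) powr (1 / \<beta>)"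
  have R1: "1 \<le> R" unfolding R_def using L d \<beta> by (intro ge_one_powr_ge_zero) (auto simp: field_simps)
  have Rb: "R powr \<beta> = L / (2 * d)" unfolding R_def using L0 d \<beta> by (simp add: powr_powr)
  have R2: "R\<^sup>2 = (L / (2 * d)) powr (2 / \<beta>)"
  proof -
    have "R\<^sup>2 = R powr 2" using R1 by (simp add: powr_numeral)
    then show ?thesis unfolding R_def by (simp add: powr_powr)
  qed
  have av: "\<bar>avg v R x\<bar> \<le> L / 2" for x
  proof -
    have "\<bar>avg v R x\<bar> \<le> (sup_const + sup_const / \<beta>) * R powr \<beta>" by (rule avg_sup[OF N g c z 1 \<beta> R1])
    also have "\<dots> \<le> d * R powr \<beta>" using d by (intro mult_right_mono) auto
    finally show ?thesis unfolding Rb using d by simp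
  qed
  let ?A = "(2 * L) powr (p - 2) * 4"
  have pw: "indicator {x. L < \<bar>v x\<bar>} x * ennreal (\<bar>v x\<bar> powr p)
    \<le> ennreal ?A * ennreal ((v x - avg v R x)\<^sup>2) + indicator {x. 2 * L < \<bar>v x\<bar>} x * ennreal (\<bar>v x\<bar> powr p)" for x
  proof -
    consider "\<bar>v x\<bar> \<le> L" | "L < \<bar>v x\<bar>" "\<bar>v x\<bar> \<le> 2 * L" | "2 * L < \<bar>v x\<bar>" by linarith
    then show ?thesis
    proof cases
      case 2
      have "\<bar>v x\<bar> \<le> 2 * \<bar>v x - avg v R x\<bar>"
        using av[of x] 2(1) abs_triangle_ineq[of "v x - avg v R x" "avg v R x"] by simp
      then have "\<bar>v x\<bar>\<^sup>2 \<le> (2 * \<bar>v x - avg v R x\<bar>)\<^sup>2" by (intro power_mono) auto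
      then have s: "\<bar>v x\<bar>\<^sup>2 \<le> 4 * (v x - avg v R x)\<^sup>2" by (simp add: power_mult_distrib)
      have v0: "\<bar>v x\<bar> > 0" using 2 L0 by linarith
      have "\<bar>v x\<bar> powr p = \<bar>v x\<bar> powr (p - 2) * \<bar>v x\<bar>\<^sup>2"
      proof -
        have "\<bar>v x\<bar> powr p = \<bar>v x\<bar> powr ((p - 2) + 2)" by simp
        also have "\<dots> = \<bar>v x\<bar> powr (p - 2) * \<bar>v x\<bar> powr 2" by (rule powr_add)
        also have "\<bar>v x\<bar> powr 2 = \<bar>v x\<bar>\<^sup>2" using v0 by simp
        finally show ?thesis .
      qed
      also have "\<dots> \<le> (2 * L) powr (p - 2) * (4 * (v x - avg v R x)\<^sup>2)"
        using 2 p s by (intro mult_mono powr_mono2) auto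
      finally have "ennreal (\<bar>v x\<bar> powr p) \<le> ennreal (?A * (v x - avg v R x)\<^sup>2)" by (simp add: mult.assoc ennreal_leI)
      also have "\<dots> = ennreal ?A * ennreal ((v x - avg v R x)\<^sup>2)" by (rule ennreal_mult) auto
      finally show ?thesis using 2 by simp
    next
      case 3
      then have "L < \<bar>v x\<bar>" using L0 by linarith
      then show ?thesis using 3 by simp
    qed simp
  qed
  have avm: "(\<lambda>x. avg v R x) \<in> borel_measurable borel"
  proof -
    have "(\<lambda>x. avg v R x) = (\<lambda>x. integral (cbox a b) (\<lambda>y. R ^ CARD('n) * \<rho> (R *\<^sub>R (x - y)) * v y))"
      unfolding avg_def using z
      by (intro ext lebesgue_integral_cbox) (auto intro!: continuous_intros continuous_on_compose2[OF c])
    moreover have "continuous_on UNIV \<dots>"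
      by (intro integral_continuous_on_param)
         (auto simp: split_beta intro!: continuous_intros continuous_on_compose2[OF c])
    ultimately show ?thesis by (simp add: borel_measurable_continuous_onI)
  qed
  have "(\<integral>\<^sup>+x. indicator {x. L < \<bar>v x\<bar>} x * ennreal (\<bar>v x\<bar> powr p) \<partial>lborel)
    \<le> (\<integral>\<^sup>+x. ennreal ?A * ennreal ((v x - avg v R x)\<^sup>2) + indicator {x. 2 * L < \<bar>v x\<bar>} x * ennreal (\<bar>v x\<bar> powr p) \<partial>lborel)"
    by (intro nn_integral_mono pw)
  also have "\<dots> = ennreal ?A * (\<integral>\<^sup>+x. ennreal ((v x - avg v R x)\<^sup>2) \<partial>lborel)
      + (\<integral>\<^sup>+x. indicator {x. 2 * L < \<bar>v x\<bar>} x * ennreal (\<bar>v x\<bar> powr p) \<partial>lborel)"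
    using avm by (subst nn_integral_add) (auto simp: nn_integral_cmult)
  also have "ennreal ?A * (\<integral>\<^sup>+x. ennreal ((v x - avg v R x)\<^sup>2) \<partial>lborel) \<le> ennreal ?A * ennreal (4 * B\<^sup>2 * V\<^sup>2 / R\<^sup>2)"
    using R1 by (intro mult_left_mono avg_L2[OF N g c z 1(1)]) auto
  also have "\<dots> = ennreal (?A * (4 * B\<^sup>2 * V\<^sup>2 / R\<^sup>2))" by (intro ennreal_mult[symmetric]) auto
  also have "?A * (4 * B\<^sup>2 * V\<^sup>2 / R\<^sup>2) = 2 powr (p - 2) * (16 * B\<^sup>2 * V\<^sup>2) * (2 * d) powr (2 / \<beta>) * L powr - (2 / \<beta> - (p - 2))"
  proof -
    have "L powr - (2 / \<beta> - (p - 2)) = L powr (p - 2) / L powr (2 / \<beta>)" by (simp flip: powr_diff)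
    moreover have "R\<^sup>2 = L powr (2 / \<beta>) / (2 * d) powr (2 / \<beta>)" unfolding R2 by (rule powr_divide)
    moreover have "(2 * L) powr (p - 2) = 2 powr (p - 2) * L powr (p - 2)" by (rule powr_mult)
    ultimately show ?thesis by simp
  qed
  finally show ?thesis by (simp add: add_right_mono)
qed

end

lemma has_weak_gradient_cmult:
  assumes "has_weak_gradient v g"
  shows "has_weak_gradient (\<lambda>x. c * v x) (\<lambda>x. c *\<^sub>R g x)"
  unfolding has_weak_gradient_def
proof (intro conjI allI impI)
  note L2 = has_weak_gradient_L2[OF assms]
  show "(\<lambda>x. c * v x) \<in> L2" using L2_bounded_scaleR[OF L2(1), of "\<lambda>_. c" "\<bar>c\<bar>"] by simp
  show "(\<lambda>x. c *\<^sub>R g x) \<in> L2" using L2_bounded_scaleR[OF L2(2), of "\<lambda>_. c" "\<bar>c\<bar>"] by simp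
  fix \<phi> :: "real ^ 'a \<Rightarrow> real" and i assume "test_function \<phi>"
  then have "(LINT x|lebesgue. v x * partial_deriv i \<phi> x) = - (LINT x|lebesgue. g x $ i * \<phi> x)"
    using assms unfolding has_weak_gradient_def by blast
  then have "c * (LINT x|lebesgue. v x * partial_deriv i \<phi> x) = - (c * (LINT x|lebesgue. g x $ i * \<phi> x))" by simp
  then show "(LINT x|lebesgue. c * v x * partial_deriv i \<phi> x) = - (LINT x|lebesgue. (c *\<^sub>R g x) $ i * \<phi> x)"
    by (simp add: mult.assoc)
qed

text \<open>Both sides scale with the power p of \<open>v\<close>, so unit energy is the essential
  case. The height \<open>L\<close> is fixed first, to make the tail at most
  \<open>\<kappa> / 2\<close>, and \<open>\<epsilon>0\<close> afterwards. Neither depends on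
  \<open>v\<close> or on its support, so one \<open>\<epsilon>0\<close> serves all
  functions.\<close>

lemma subcritical_sobolev:
  fixes p \<kappa> :: real
  assumes N: "CARD('n) \<ge> 2" and p: "2 < p" "ereal p < critical_exponent CARD('n)" and \<kappa>: "0 < \<kappa>"
  obtains \<epsilon>0 where "0 < \<epsilon>0"
    "\<And>v g a b \<epsilon>. \<lbrakk>has_weak_gradient v g; continuous_on UNIV v; \<And>x. x \<notin> cbox a b \<Longrightarrow> v x = 0;
       0 < (LINT x|lebesgue. (norm (g x))\<^sup>2 + (v x)\<^sup>2); 0 < \<epsilon>; \<epsilon> \<le> \<epsilon>0\<rbrakk>
      \<Longrightarrow> (LINT x:ball (0 :: real ^ 'n) \<epsilon>|lebesgue. \<bar>v x\<bar> powr p) \<le> \<kappa> * (LINT x|lebesgue. (norm (g x))\<^sup>2 + (v x)\<^sup>2) powr (p / 2)"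
proof -
  obtain \<rho> :: "real ^ 'n \<Rightarrow> real" and B where "mollifier \<rho> B (unit_ball_vol (real CARD('n)))"
    using mollifier_exists by blast
  then interpret mollifier \<rho> B "unit_ball_vol (real CARD('n))" .
  let ?V = "unit_ball_vol (real CARD('n))"
  \<comment> \<open>Both entries of the maximum give a product with \<open>p - 2\<close> below 2:
    the first by subcriticality, the second because its product is 1. The second also keeps
    \<open>\<beta>\<close> positive in dimension 2.\<close>
  define \<beta> where "\<beta> = max (real CARD('n) / 2 - 1) (1 / (p - 2))"
  have \<beta>0: "0 < \<beta>" unfolding \<beta>_def using p by (simp add: less_max_iff_disj)
  have \<beta>N: "real CARD('n) / 2 - 1 \<le> \<beta>" unfolding \<beta>_def by simp
  have "\<beta> * (p - 2) < 2"
  proof -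
    have "(real CARD('n) / 2 - 1) * (p - 2) < 2"
    proof (cases "CARD('n) \<ge> 3")
      case True
      then have "p < 2 * real CARD('n) / (real CARD('n) - 2)" using p by (simp add: critical_exponent_def)
      moreover have "real CARD('n) - 2 > 0" using True by simp
      ultimately show ?thesis by (simp add: field_simps)
    next
      case False
      then have "CARD('n) = 2" using N by simp
      then show ?thesis by simp
    qed
    moreover have "1 / (p - 2) * (p - 2) < 2" using p by simp
    ultimately show ?thesis unfolding \<beta>_def by (simp only: max_def split: if_split) simp
  qed
  then have "p - 2 < 2 / \<beta>" using \<beta>0 by (simp add: field_simps)
  then obtain a where a: "a = 2 / \<beta> - (p - 2)" "0 < a" by simp
  define d where "d = sup_const + sup_const / \<beta> + 1"
  have d: "0 < d" "sup_const + sup_const / \<beta> \<le> d"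
    unfolding d_def using sup_const_nonneg \<beta>0 by (auto intro!: add_nonneg_pos add_nonneg_nonneg)
  define K where "K = 2 powr (p - 2) * (16 * B\<^sup>2 * ?V\<^sup>2) * (2 * d) powr (2 / \<beta>)"
  have K0: "0 \<le> K" unfolding K_def by simp
  have "((\<lambda>L. K / (1 - 2 powr - a) * L powr - a) \<longlongrightarrow> K / (1 - 2 powr - a) * 0) at_top"
    using a by (intro tendsto_intros tendsto_neg_powr filterlim_ident) auto
  then have "\<forall>\<^sub>F L in at_top. K / (1 - 2 powr - a) * L powr - a < \<kappa> / 2"
    using \<kappa> by (intro order_tendstoD) auto
  then have "\<forall>\<^sub>F L in at_top. K / (1 - 2 powr - a) * L powr - a < \<kappa> / 2 \<and> 2 * d \<le> L"
    using eventually_ge_at_top by (rule eventually_conj)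
  then obtain L where L: "K / (1 - 2 powr - a) * L powr - a < \<kappa> / 2" "2 * d \<le> L"
    using eventually_happens'[OF trivial_limit_at_top_linorder] by blast
  have L0: "L > 0" using L d by simp
  \<comment> \<open>The bound by 1 gives \<open>\<epsilon> ^ CARD('n) \<le> \<epsilon>\<close>; the
    other entry then makes the part below height \<open>L\<close> at most
    \<open>\<kappa> / 2\<close>.\<close>
  define \<epsilon>0 where "\<epsilon>0 = min 1 (\<kappa> / 2 / (L powr p * ?V + 1))"
  have V0: "0 \<le> L powr p * ?V" by simp
  have \<epsilon>0: "\<epsilon>0 > 0" unfolding \<epsilon>0_def using \<kappa> V0 by (simp add: add_nonneg_pos)
  have normalized: "(\<integral>\<^sup>+x. indicator (ball (0 :: real ^ 'n) \<epsilon>) x * ennreal (\<bar>v x\<bar> powr p) \<partial>lborel) \<le> ennreal \<kappa>"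
    if g: "has_weak_gradient v g" and c: "continuous_on UNIV v" and z: "\<And>x. x \<notin> cbox l u \<Longrightarrow> v x = 0"
      and 1: "(\<integral>\<^sup>+y. ennreal ((norm (g y))\<^sup>2) \<partial>lebesgue) \<le> 1" "(\<integral>\<^sup>+y. ennreal ((v y)\<^sup>2) \<partial>lebesgue) \<le> 1"
      and \<epsilon>: "0 < \<epsilon>" "\<epsilon> \<le> \<epsilon>0" for v g l u \<epsilon>
  proof -
    have [measurable]: "v \<in> borel_measurable borel" using c by (rule borel_measurable_continuous_onI)
    define M where "M t = (\<integral>\<^sup>+x. indicator {x. t < \<bar>v x\<bar>} x * ennreal (\<bar>v x\<bar> powr p) \<partial>lborel)" for t
    have "compact (v ` cbox l u)"
      using c by (intro compact_continuous_image compact_cbox) (auto intro: continuous_on_subset)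
    then obtain S where S: "S > 0" "\<forall>y\<in>v ` cbox l u. norm y \<le> S"
      using bounded_pos compact_imp_bounded by blast
    have vS: "\<bar>v x\<bar> \<le> S" for x using S z[of x] by (cases "x \<in> cbox l u") auto
    have M0: "M t = 0" if "S \<le> t" for t
    proof -
      have "{x. t < \<bar>v x\<bar>} = {}" using vS that by (auto simp: not_less intro: order_trans)
      then show ?thesis by (simp add: M_def)
    qed
    have "M L \<le> ennreal (K / (1 - 2 powr - a) * L powr - a)"
    proof (rule dyadic_decay[OF a(2) K0 L0 _ M0])
      show "M t \<le> ennreal (K * t powr - a) + M (2 * t)" if "L \<le> t" for t
        unfolding M_def K_def a(1)
        using L(2) that by (intro sublevel_step[OF N g c z 1 \<beta>0 \<beta>N p(1) d]) auto
    qed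
    also have "\<dots> \<le> ennreal (\<kappa> / 2)" using L(1) by (intro ennreal_leI) simp
    finally have MLe: "M L \<le> ennreal (\<kappa> / 2)" .
    have "(\<integral>\<^sup>+x. indicator (ball (0 :: real ^ 'n) \<epsilon>) x * ennreal (\<bar>v x\<bar> powr p) \<partial>lborel)
      \<le> (\<integral>\<^sup>+x. ennreal (L powr p) * indicator (cball 0 \<epsilon>) x + indicator {x. L < \<bar>v x\<bar>} x * ennreal (\<bar>v x\<bar> powr p) \<partial>lborel)"
    proof (intro nn_integral_mono)
      fix x :: "real ^ 'n"
      show "indicator (ball 0 \<epsilon>) x * ennreal (\<bar>v x\<bar> powr p)
        \<le> ennreal (L powr p) * indicator (cball 0 \<epsilon>) x + indicator {x. L < \<bar>v x\<bar>} x * ennreal (\<bar>v x\<bar> powr p)"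
      proof (cases "L < \<bar>v x\<bar>")
        case False
        then have le: "ennreal (\<bar>v x\<bar> powr p) \<le> ennreal (L powr p)"
          using p by (intro ennreal_leI powr_mono2) auto
        show ?thesis
        proof (cases "x \<in> ball 0 \<epsilon>")
          case True
          then have "x \<in> cball 0 \<epsilon>" by simp
          then show ?thesis using True False le by simp
        qed simp
      next
        case True
        show ?thesis
        proof (cases "x \<in> ball 0 \<epsilon>")
          case ball: True
          have "ennreal (\<bar>v x\<bar> powr p) \<le> ennreal (L powr p) * indicator (cball 0 \<epsilon>) x + ennreal (\<bar>v x\<bar> powr p)"
            by (rule add_increasing) auto
          then show ?thesis using True ball by simp
        qed simp
      qed
    qed
    also have "\<dots> = ennreal (L powr p) * emeasure lborel (cball (0 :: real ^ 'n) \<epsilon>) + M L"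
    proof -
      have cb: "cball (0 :: real ^ 'n) \<epsilon> \<in> sets lborel" by (simp add: borel_closed)
      have "(\<lambda>x. ennreal (L powr p) * indicator (cball 0 \<epsilon>) x) \<in> borel_measurable (lborel :: (real ^ 'n) measure)"
        using cb by (intro borel_measurable_times_ennreal borel_measurable_indicator) auto
      moreover have "(\<lambda>x. indicator {x. L < \<bar>v x\<bar>} x * ennreal (\<bar>v x\<bar> powr p)) \<in> borel_measurable lborel"
        by measurable
      ultimately show ?thesis
        unfolding M_def nn_integral_cmult_indicator[OF cb, symmetric] by (rule nn_integral_add)
    qed
    also have "\<dots> \<le> ennreal (\<kappa> / 2) + ennreal (\<kappa> / 2)"
    proof (intro add_mono MLe)
      have "emeasure lborel (cball (0 :: real ^ 'n) \<epsilon>) = ennreal (?V * \<epsilon> ^ CARD('n))"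
        using emeasure_cball[of \<epsilon> "0 :: real ^ 'n"] \<epsilon> by simp
      then have "ennreal (L powr p) * emeasure lborel (cball (0 :: real ^ 'n) \<epsilon>) = ennreal (L powr p * (?V * \<epsilon> ^ CARD('n)))"
        using \<epsilon> by (simp add: ennreal_mult)
      also have "L powr p * (?V * \<epsilon> ^ CARD('n)) \<le> \<kappa> / 2"
      proof -
        have "\<epsilon> \<le> 1" using \<epsilon> by (simp add: \<epsilon>0_def)
        then have "\<epsilon> ^ CARD('n) \<le> \<epsilon>" using \<epsilon> power_decreasing[of 1 "CARD('n)" \<epsilon>] N by simp
        then have "L powr p * ?V * \<epsilon> ^ CARD('n) \<le> L powr p * ?V * \<epsilon>" by (intro mult_left_mono) auto
        also have "\<dots> \<le> (L powr p * ?V + 1) * \<epsilon>" using \<epsilon> by (simp add: distrib_right)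
        also have "\<dots> \<le> (L powr p * ?V + 1) * (\<kappa> / 2 / (L powr p * ?V + 1))"
          using \<epsilon> V0 by (intro mult_left_mono) (auto simp: \<epsilon>0_def)
        also have "\<dots> = \<kappa> / 2"
        proof -
          have "L powr p * ?V + 1 \<noteq> 0" using V0 by linarith
          then show ?thesis by (metis nonzero_mult_div_cancel_left times_divide_eq_right)
        qed
        finally show ?thesis by (simp add: mult.assoc)
      qed
      finally show "ennreal (L powr p) * emeasure lborel (cball (0 :: real ^ 'n) \<epsilon>) \<le> ennreal (\<kappa> / 2)"
        by (simp add: ennreal_leI)
    qed
    also have "\<dots> = ennreal \<kappa>" using \<kappa> by (simp flip: ennreal_plus)
    finally show ?thesis .
  qed
  have "(LINT x:ball (0 :: real ^ 'n) \<epsilon>|lebesgue. \<bar>v x\<bar> powr p) \<le> \<kappa> * (LINT x|lebesgue. (norm (g x))\<^sup>2 + (v x)\<^sup>2) powr (p / 2)"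
    if g: "has_weak_gradient v g" and c: "continuous_on UNIV v" and z: "\<And>x. x \<notin> cbox a b \<Longrightarrow> v x = 0"
      and E: "0 < (LINT x|lebesgue. (norm (g x))\<^sup>2 + (v x)\<^sup>2)" and \<epsilon>: "0 < \<epsilon>" "\<epsilon> \<le> \<epsilon>0" for v g a b \<epsilon>
  proof -
    define E where "E = (LINT x|lebesgue. (norm (g x))\<^sup>2 + (v x)\<^sup>2)"
    have E0: "E > 0" using E by (simp add: E_def)
    define s where "s = 1 / sqrt E"
    have s: "s > 0" "s\<^sup>2 * E = 1" using E0 by (auto simp: s_def power_divide)
    note L2 = has_weak_gradient_L2[OF g]
    have small: "(\<integral>\<^sup>+y. ennreal (s\<^sup>2 * h y) \<partial>lebesgue) \<le> 1"
      if h: "integrable lebesgue h" "\<And>y. 0 \<le> h y" "\<And>y. h y \<le> (norm (g y))\<^sup>2 + (v y)\<^sup>2" for h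
    proof -
      have "(\<integral>\<^sup>+y. ennreal (s\<^sup>2 * h y) \<partial>lebesgue) = ennreal (LINT y|lebesgue. s\<^sup>2 * h y)"
        using h by (intro nn_integral_eq_integral) auto
      also have "(LINT y|lebesgue. h y) \<le> E"
        unfolding E_def using h L2_integrable[OF L2(1)] L2_integrable[OF L2(2)] by (intro integral_mono) auto
      then have "(LINT y|lebesgue. s\<^sup>2 * h y) \<le> s\<^sup>2 * E" by (simp add: mult_left_mono)
      finally show ?thesis using s by (simp add: ennreal_leI)
    qed
    have n1: "(\<integral>\<^sup>+y. ennreal ((norm (s *\<^sub>R g y))\<^sup>2) \<partial>lebesgue) \<le> 1"
      using small[of "\<lambda>y. (norm (g y))\<^sup>2"] L2_integrable[OF L2(2)] by (simp add: power_mult_distrib)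
    have n2: "(\<integral>\<^sup>+y. ennreal ((s * v y)\<^sup>2) \<partial>lebesgue) \<le> 1"
      using small[of "\<lambda>y. (v y)\<^sup>2"] L2_integrable[OF L2(1)] by (simp add: power_mult_distrib)
    have cs: "continuous_on UNIV (\<lambda>x. s * v x)" by (intro continuous_intros c)
    have le: "(\<integral>\<^sup>+x. indicator (ball 0 \<epsilon>) x * ennreal (\<bar>s * v x\<bar> powr p) \<partial>lborel) \<le> ennreal \<kappa>"
      by (rule normalized[OF has_weak_gradient_cmult[OF g, of s] cs _ n1 n2 \<epsilon>, of a b]) (simp add: z)
    let ?f = "\<lambda>x. indicator (ball 0 \<epsilon>) x * \<bar>s * v x\<bar> powr p"
    have cp: "continuous_on UNIV (\<lambda>x. \<bar>s * v x\<bar> powr p)" using p by (intro continuous_on_powr' continuous_intros c) auto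
    have m: "?f \<in> borel_measurable borel"
      using borel_measurable_continuous_onI[OF cp]
      by (intro borel_measurable_times borel_measurable_indicator borel_open open_ball) auto
    have "(LINT x|lebesgue. ?f x) = (LINT x|lborel. ?f x)" using m by (intro integral_completion) simp
    also have "\<dots> \<le> \<kappa>"
      using le \<kappa> by (intro integral_real_bounded) (auto simp: indicator_mult_ennreal[symmetric] mult.commute)
    finally have "(LINT x|lebesgue. ?f x) \<le> \<kappa>" .
    moreover have "(LINT x|lebesgue. ?f x) = s powr p * (LINT x:ball 0 \<epsilon>|lebesgue. \<bar>v x\<bar> powr p)"
    proof -
      have "?f = (\<lambda>x. s powr p * (indicator (ball 0 \<epsilon>) x *\<^sub>R \<bar>v x\<bar> powr p))"
        using s by (auto simp: abs_mult powr_mult fun_eq_iff)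
      then show ?thesis by (simp only: set_lebesgue_integral_def integral_mult_right_zero)
    qed
    moreover have "s powr p * E powr (p / 2) = 1"
    proof -
      have "E powr (p / 2) = (1 / s) powr p"
        unfolding s_def using E0 by (simp add: powr_half_sqrt[symmetric] powr_powr)
      then show ?thesis using s by (simp add: powr_divide)
    qed
    ultimately have "s powr p * (LINT x:ball 0 \<epsilon>|lebesgue. \<bar>v x\<bar> powr p) \<le> s powr p * (\<kappa> * E powr (p / 2))"
      by (simp add: mult.left_commute)
    then show ?thesis using s unfolding E_def by simp
  qed
  then show ?thesis using that[OF \<epsilon>0] by blast
qed

subsection \<open>Concentration\<close>

lemma ball_half_subset_cell: "ball 0 (1 / 2) \<subseteq> cell 0"
proof
  fix x :: "real ^ 'n" assume "x \<in> ball 0 (1 / 2)"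
  then have "\<bar>x $ i\<bar> < 1 / 2" for i
    using component_le_norm_cart[of x i] by simp
  then have "- (1 / 2) \<le> x $ i \<and> x $ i < 1 / 2" for i by (smt (verit))
  then show "x \<in> cell 0" by (simp add: cell_def)
qed

text \<open>The Sobolev inequality is for functions vanishing outside a box, so \<open>u\<close> is
  multiplied by a cutoff supported in the cell and at least 1 on every ball of radius up to 1/4. The
  energy of the product is at most \<open>C\<close> times the cell energy E, whence E \<le> \<kappa>
  (C E)^(p/2) with \<kappa> at our disposal.\<close>

lemma cell_energy_large:
  fixes p T :: real
  assumes N: "CARD('n) \<ge> 2" and p: "2 < p" "ereal p < critical_exponent CARD('n)" and T: "0 < T"
  obtains \<epsilon>0 where "0 < \<epsilon>0"
    "\<And>\<epsilon> u. \<lbrakk>0 < \<epsilon>; \<epsilon> \<le> \<epsilon>0; positive_solution p \<epsilon> u;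
       H1_energy (cell (0 :: real ^ 'n)) u \<le> (LINT x:ball 0 \<epsilon>|lebesgue. u x powr p)\<rbrakk> \<Longrightarrow> T \<le> H1_energy (cell 0) u"
proof -
  obtain \<eta> :: "real ^ 'n \<Rightarrow> real" where \<eta>: "test_function \<eta>" "\<And>x. 0 \<le> \<eta> x" "\<And>x. x \<in> cball 0 (1 / 4) \<Longrightarrow> 1 \<le> \<eta> x"
    "closure {x. \<eta> x \<noteq> 0} \<subseteq> ball 0 (1 / 2)"
  proof -
    have "cball 0 (1 / 4) \<subseteq> (ball 0 (1 / 2) :: (real ^ 'n) set)" by (auto simp: mem_cball mem_ball)
    from test_function_bump[OF compact_cball open_ball this] show thesis using that by blast
  qed
  define S where "S = closure {x. \<eta> x \<noteq> 0}"
  have S: "compact S" "S \<subseteq> cell 0" "\<And>x. \<eta> x \<noteq> 0 \<Longrightarrow> x \<in> S"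
    using test_function_support[OF \<eta>(1)] \<eta>(4) ball_half_subset_cell by (auto simp: S_def)
  obtain a b where ab: "S \<subseteq> cbox a b"
    using bounded_subset_cbox_symmetric[OF compact_imp_bounded[OF S(1)]] by metis
  obtain B where B: "\<And>x. \<bar>\<eta> x\<bar> \<le> B" "B > 0" using test_function_bounded[OF \<eta>(1)] by blast
  obtain B' where B': "\<And>x. norm (grad \<eta> x) \<le> B'" "B' > 0" using grad_bounded[OF \<eta>(1)] by blast
  \<comment> \<open>From the product rule and the inequality (s + t)^2 \<le> 2 s^2 + 2 t^2; the sum
    also covers the square of \<open>\<eta> * u\<close>.\<close>
  define C where "C = 2 * B\<^sup>2 + 2 * B'\<^sup>2"
  have C: "C > 0" unfolding C_def using B by (simp add: add_pos_nonneg)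
  \<comment> \<open>Chosen so that dividing \<open>E \<le> \<kappa> * (C * E) powr (p / 2)\<close>
    by \<open>E\<close> leaves \<open>T powr (p / 2 - 1) \<le> E powr (p / 2 - 1)\<close>.\<close>
  define \<kappa> where "\<kappa> = 1 / (C powr (p / 2) * T powr (p / 2 - 1))"
  have \<kappa>: "\<kappa> > 0" unfolding \<kappa>_def using C T by simp
  obtain \<epsilon>1 where \<epsilon>1: "0 < \<epsilon>1" and sob:
    "\<And>v g a b \<epsilon>. \<lbrakk>has_weak_gradient v g; continuous_on UNIV v; \<And>x. x \<notin> cbox a b \<Longrightarrow> v x = 0;
       0 < (LINT x|lebesgue. (norm (g x))\<^sup>2 + (v x)\<^sup>2); 0 < \<epsilon>; \<epsilon> \<le> \<epsilon>1\<rbrakk>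
      \<Longrightarrow> (LINT x:ball (0 :: real ^ 'n) \<epsilon>|lebesgue. \<bar>v x\<bar> powr p) \<le> \<kappa> * (LINT x|lebesgue. (norm (g x))\<^sup>2 + (v x)\<^sup>2) powr (p / 2)"
    by (rule subcritical_sobolev[OF N p \<kappa>]) blast
  have "T \<le> H1_energy (cell 0) u"
    if \<epsilon>: "0 < \<epsilon>" "\<epsilon> \<le> min \<epsilon>1 (1 / 4)" and u: "positive_solution p \<epsilon> u"
      and conc: "H1_energy (cell (0 :: real ^ 'n)) u \<le> (LINT x:ball 0 \<epsilon>|lebesgue. u x powr p)" for \<epsilon> u
  proof -
    let ?g = "weak_grad u"
    have g: "has_weak_gradient u ?g" using u by (rule positive_solution_weak_gradient)
    have pos: "u x > 0" for x using u by (simp add: positive_solution_def)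
    have uc: "continuous_on UNIV u" using u by (simp add: positive_solution_def)
    let ?v = "\<lambda>x. \<eta> x * u x" and ?h = "\<lambda>x. \<eta> x *\<^sub>R ?g x + u x *\<^sub>R grad \<eta> x"
    have v: "has_weak_gradient ?v ?h" by (rule has_weak_gradient_mult[OF g \<eta>(1)])
    have vc: "continuous_on UNIV ?v"
      by (intro continuous_intros uc smooth_continuous test_function_smooth \<eta>)
    have vz: "?v x = 0" if "x \<notin> cbox a b" for x using S(3)[of x] ab that by auto
    define E where "E = H1_energy (cell 0) u"
    define F where "F = (LINT x|lebesgue. (norm (?h x))\<^sup>2 + (?v x)\<^sup>2)"
    have iF: "integrable lebesgue (\<lambda>x. (norm (?h x))\<^sup>2 + (?v x)\<^sup>2)"
      using has_weak_gradient_L2[OF v, THEN L2_integrable] by simp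
    have bl: "ball 0 \<epsilon> \<in> sets (lebesgue :: (real ^ 'n) measure)" by (intro sets_completionI_sets) auto
    have F0: "0 < F"
      unfolding F_def
    proof (rule integral_pos_open[OF iF, of "ball 0 (1 / 4)"])
      show "0 < (norm (?h x))\<^sup>2 + (?v x)\<^sup>2" if "x \<in> ball 0 (1 / 4)" for x
        using \<eta>(3)[of x] pos[of x] that by (intro add_nonneg_pos) auto
    qed auto
    have FE: "F \<le> C * E"
    proof -
      have pw: "(norm (?h x))\<^sup>2 + (?v x)\<^sup>2 \<le> C * (indicator (cell 0) x *\<^sub>R ((norm (?g x))\<^sup>2 + (u x)\<^sup>2))" for x
      proof (cases "x \<in> S")
        case False
        then have "\<eta> x = 0" "grad \<eta> x = 0" using S(3) grad_eq_0[of x \<eta>] unfolding S_def by auto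
        then show ?thesis using C by (auto simp: indicator_def)
      next
        case True
        have "norm (?h x) \<le> \<bar>\<eta> x\<bar> * norm (?g x) + \<bar>u x\<bar> * norm (grad \<eta> x)"
          by (rule order_trans[OF norm_triangle_ineq]) simp
        also have "\<dots> \<le> B * norm (?g x) + \<bar>u x\<bar> * B'"
          using B(2) by (intro add_mono mult_mono B(1) B'(1)) auto
        finally have "(norm (?h x))\<^sup>2 \<le> (B * norm (?g x) + \<bar>u x\<bar> * B')\<^sup>2" by (intro power_mono) auto
        also have "\<dots> \<le> 2 * (B * norm (?g x))\<^sup>2 + 2 * (\<bar>u x\<bar> * B')\<^sup>2"
          using sum_squares_bound[of "B * norm (?g x)" "\<bar>u x\<bar> * B'"] by (simp add: power2_sum)
        finally have 1: "(norm (?h x))\<^sup>2 \<le> 2 * B\<^sup>2 * (norm (?g x))\<^sup>2 + 2 * B'\<^sup>2 * (u x)\<^sup>2"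
          by (simp add: power_mult_distrib mult_ac)
        have "\<bar>\<eta> x\<bar>\<^sup>2 \<le> B\<^sup>2" by (intro power_mono B) auto
        then have 2: "(?v x)\<^sup>2 \<le> B\<^sup>2 * (u x)\<^sup>2" by (simp add: power_mult_distrib mult_right_mono)
        have "C * ((norm (?g x))\<^sup>2 + (u x)\<^sup>2) = (2 * B\<^sup>2 * (norm (?g x))\<^sup>2 + 2 * B'\<^sup>2 * (u x)\<^sup>2) + B\<^sup>2 * (u x)\<^sup>2
            + (2 * B'\<^sup>2 * (norm (?g x))\<^sup>2 + B\<^sup>2 * (u x)\<^sup>2)"
          by (simp add: C_def algebra_simps)
        moreover have "0 \<le> 2 * B'\<^sup>2 * (norm (?g x))\<^sup>2 + B\<^sup>2 * (u x)\<^sup>2" by simp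
        ultimately have "(norm (?h x))\<^sup>2 + (?v x)\<^sup>2 \<le> C * ((norm (?g x))\<^sup>2 + (u x)\<^sup>2)" using 1 2 by linarith
        then show ?thesis using True S(2) by auto
      qed
      have "F \<le> (LINT x|lebesgue. C * (indicator (cell 0) x *\<^sub>R ((norm (?g x))\<^sup>2 + (u x)\<^sup>2)))"
        unfolding F_def
        by (intro integral_mono iF pw integrable_mult_right integrable_mult_indicator cell_sets H1_energy_integrable g)
      then show ?thesis unfolding E_def H1_energy_def set_lebesgue_integral_def by (simp only: integral_mult_right_zero)
    qed
    have E0: "E > 0" using F0 FE C by (meson less_le_trans zero_less_mult_pos)
    have "E \<le> (LINT x:ball 0 \<epsilon>|lebesgue. u x powr p)" using conc by (simp add: E_def)
    also have "\<dots> \<le> (LINT x:ball 0 \<epsilon>|lebesgue. \<bar>?v x\<bar> powr p)"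
      unfolding set_lebesgue_integral_def
    proof (rule integral_mono)
      have ci: "set_integrable lebesgue (ball 0 \<epsilon>) f" if "continuous_on UNIV f" for f :: "real ^ 'n \<Rightarrow> real"
        by (rule set_integrable_subset[OF set_integrable_compact_continuous[OF compact_cball that] bl ball_subset_cball])
      show "integrable lebesgue (\<lambda>x. indicat_real (ball 0 \<epsilon>) x *\<^sub>R u x powr p)"
        using ci[OF positive_solution_powr_continuous[OF u]] by (simp add: set_integrable_def)
      show "integrable lebesgue (\<lambda>x. indicat_real (ball 0 \<epsilon>) x *\<^sub>R \<bar>?v x\<bar> powr p)"
      proof -
        have "continuous_on UNIV (\<lambda>x. \<bar>?v x\<bar> powr p)"
          using p(1) by (intro continuous_on_powr' continuous_intros vc) auto
        from ci[OF this] show ?thesis by (simp only: set_integrable_def)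
      qed
      show "indicat_real (ball 0 \<epsilon>) x *\<^sub>R u x powr p \<le> indicat_real (ball 0 \<epsilon>) x *\<^sub>R \<bar>?v x\<bar> powr p" for x
      proof (cases "x \<in> ball 0 \<epsilon>")
        case True
        then have "1 \<le> \<eta> x" using \<epsilon> by (intro \<eta>(3)) auto
        then have "u x \<le> \<bar>?v x\<bar>" using pos[of x] by (simp add: abs_mult)
        then show ?thesis using True pos[of x] p by (simp add: powr_mono2)
      qed simp
    qed
    also have "\<dots> \<le> \<kappa> * F powr (p / 2)"
      unfolding F_def using \<epsilon> F0 by (intro sob[OF v vc vz]) (auto simp: F_def)
    also have "\<dots> \<le> \<kappa> * (C * E) powr (p / 2)"
      using \<kappa> FE F0 p by (intro mult_left_mono powr_mono2) auto
    also have "\<dots> = \<kappa> * C powr (p / 2) * (E powr (p / 2 - 1) * E)"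
    proof -
      have "E powr (p / 2) = E powr (p / 2 - 1) * E powr 1"
        using powr_add[of E "p / 2 - 1" 1] by simp
      then show ?thesis using E0 by (simp add: powr_mult)
    qed
    finally have "1 * E \<le> (\<kappa> * C powr (p / 2) * E powr (p / 2 - 1)) * E" by simp
    then have "1 \<le> \<kappa> * C powr (p / 2) * E powr (p / 2 - 1)" using E0 by (rule mult_right_le_imp_le)
    then have le: "T powr (p / 2 - 1) \<le> E powr (p / 2 - 1)"
      using C T by (simp add: \<kappa>_def field_simps)
    have "T \<le> E"
    proof (rule ccontr)
      assume "\<not> T \<le> E"
      then have "E powr (p / 2 - 1) < T powr (p / 2 - 1)" using E0 p by (intro powr_less_mono2) auto
      then show False using le by simp
    qed
    then show ?thesis by (simp add: E_def)
  qed
  then show ?thesis using that[of "min \<epsilon>1 (1 / 4)"] \<epsilon>1 by auto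
qed

section \<open>Splitting a bounded open set into lattice balls and a remainder\<close>

lemma finite_int_lattice_bounded:
  fixes U :: "(real ^ 'n) set"
  assumes "bounded U"
  shows "finite (U \<inter> int_lattice)"
proof -
  obtain M where M: "\<And>x. x \<in> U \<Longrightarrow> norm x \<le> M" using assms by (auto simp: bounded_iff)
  let ?I = "(of_int ` {\<lfloor>- M\<rfloor>..\<lceil>M\<rceil>}) :: real set"
  have "U \<inter> int_lattice \<subseteq> vec_lambda ` (PiE UNIV (\<lambda>_::'n. ?I))"
  proof
    fix x assume x: "x \<in> U \<inter> int_lattice"
    have "x $ i \<in> ?I" for i
    proof -
      obtain k where k: "x $ i = of_int k" using x by (auto simp: int_lattice_def Ints_def)
      have "\<bar>x $ i\<bar> \<le> M" using component_le_norm_cart[of x i] M[of x] x by auto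
      then have "- M \<le> of_int k" "of_int k \<le> M" using k by auto
      then have "k \<in> {\<lfloor>- M\<rfloor>..\<lceil>M\<rceil>}" by simp linarith
      then show ?thesis using k by blast
    qed
    then show "x \<in> vec_lambda ` (PiE UNIV (\<lambda>_::'n. ?I))"
      by (intro image_eqI[of _ _ "vec_nth x"]) auto
  qed
  then show ?thesis by (rule finite_subset) (intro finite_imageI finite_PiE; simp)
qed

text \<open>A ball is connected, so if it starts in \<open>U\<close> and leaves it, it meets the
  frontier at a distance below \<open>\<delta>\<close> from its centre.\<close>

lemma ball_subset_of_setdist_frontier:
  fixes U S :: "'a::euclidean_space set"
  assumes "z \<in> S" "S \<subseteq> U" "\<delta> \<le> setdist S (frontier U)"
  shows "ball z \<delta> \<subseteq> U"
proof (rule ccontr)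
  assume "\<not> ball z \<delta> \<subseteq> U"
  then obtain x where x: "x \<in> ball z \<delta>" "x \<notin> U" by blast
  have "0 \<le> dist z x" by simp
  then have "z \<in> ball z \<delta>" using x(1) by (simp del: zero_le_dist)
  then have "ball z \<delta> \<inter> frontier U \<noteq> {}"
    using x assms(1,2) connected_Int_frontier[OF connected_ball, of z \<delta> U] by blast
  then obtain q where q: "q \<in> ball z \<delta>" "q \<in> frontier U" by blast
  then have "setdist S (frontier U) \<le> dist z q" using assms(1) by (intro setdist_le_dist)
  then show False using q assms(3) by simp
qed

text \<open>The balls exhaust \<open>U\<close> up to a remainder inside \<open>K\<close>, where the
  integral is bounded independently of the solution. The density is kept general because both ratios
  use the same comparison.\<close>

lemma sum_set_integral_bounds:
  fixes f :: "'a::euclidean_space \<Rightarrow> real"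
  assumes S: "finite S" "disjoint_family_on A S" "\<And>z. z \<in> S \<Longrightarrow> A z \<in> sets lebesgue" "\<And>z. z \<in> S \<Longrightarrow> A z \<subseteq> U"
    and U: "U \<in> sets lebesgue" and f: "set_integrable lebesgue U f" "\<And>x. 0 \<le> f x"
    and K: "U - (\<Union>z\<in>S. A z) \<subseteq> K" "set_integrable lebesgue K f"
  shows "(\<Sum>z\<in>S. LINT x:A z|lebesgue. f x) \<le> (LINT x:U|lebesgue. f x)"
    and "(LINT x:U|lebesgue. f x) - (LINT x:K|lebesgue. f x) \<le> (\<Sum>z\<in>S. LINT x:A z|lebesgue. f x)"
proof -
  let ?W = "\<Union>z\<in>S. A z"
  have W: "?W \<in> sets lebesgue" using S by (intro sets.finite_UN) auto
  have D: "U - ?W \<in> sets lebesgue" using U W by (rule sets.Diff)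
  have "?W \<subseteq> U" using S by blast
  have iA: "set_integrable lebesgue (A z) f" if "z \<in> S" for z
    using that S by (intro set_integrable_subset[OF f(1)]) auto
  have iW: "set_integrable lebesgue ?W f" using \<open>?W \<subseteq> U\<close> W by (intro set_integrable_subset[OF f(1)])
  have iD: "set_integrable lebesgue (U - ?W) f" using D by (intro set_integrable_subset[OF f(1)]) auto
  have sum: "(LINT x:?W|lebesgue. f x) = (\<Sum>z\<in>S. LINT x:A z|lebesgue. f x)"
    using S iA by (intro set_integral_finite_Union) auto
  have "U = ?W \<union> (U - ?W)" using \<open>?W \<subseteq> U\<close> by blast
  then have "(LINT x:U|lebesgue. f x) = (LINT x:?W|lebesgue. f x) + (LINT x:U - ?W|lebesgue. f x)"
    using set_integral_Un[OF _ iW iD] by (metis Diff_disjoint)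
  moreover have "0 \<le> (LINT x:U - ?W|lebesgue. f x)"
    unfolding set_lebesgue_integral_def using f(2) by (intro Bochner_Integration.integral_nonneg) auto
  moreover have "(LINT x:U - ?W|lebesgue. f x) \<le> (LINT x:K|lebesgue. f x)"
    unfolding set_lebesgue_integral_def
    using iD K f(2) unfolding set_integrable_def
    by (intro integral_mono) (auto simp: indicator_def)
  ultimately show "(\<Sum>z\<in>S. LINT x:A z|lebesgue. f x) \<le> (LINT x:U|lebesgue. f x)"
    and "(LINT x:U|lebesgue. f x) - (LINT x:K|lebesgue. f x) \<le> (\<Sum>z\<in>S. LINT x:A z|lebesgue. f x)"
    using sum by linarith+
qed

text \<open>A bounded deficit disappears after division by a divergent total.\<close>

lemma tendsto_ratio_1:
  fixes a T :: "nat \<Rightarrow> real"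
  assumes T: "filterlim T at_top sequentially"
    and le: "\<forall>\<^sub>F n in sequentially. T n - C \<le> a n \<and> a n \<le> T n"
  shows "(\<lambda>n. a n / T n) \<longlonglongrightarrow> 1"
proof (rule tendsto_sandwich)
  have pos: "\<forall>\<^sub>F n in sequentially. 0 < T n" using T by (simp add: filterlim_at_top_dense)
  show "\<forall>\<^sub>F n in sequentially. 1 - C / T n \<le> a n / T n"
    using le pos
  proof eventually_elim
    case (elim n)
    have "1 - C / T n = (T n - C) / T n" using elim by (simp add: diff_divide_distrib)
    also have "\<dots> \<le> a n / T n" using elim by (intro divide_right_mono) auto
    finally show ?case .
  qed
  show "\<forall>\<^sub>F n in sequentially. a n / T n \<le> 1"
    using le pos by eventually_elim (simp add: field_simps)
  have "(\<lambda>n. 1 - C / T n) \<longlonglongrightarrow> 1 - 0"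
    by (intro tendsto_intros real_tendsto_divide_at_top[OF tendsto_const T])
  then show "(\<lambda>n. 1 - C / T n) \<longlonglongrightarrow> 1" by simp
qed simp

theorem theorem1p2:
  fixes p :: real and \<epsilon> :: "nat \<Rightarrow> real" and u :: "nat \<Rightarrow> real ^ 'n \<Rightarrow> real"
  assumes "CARD('n) \<ge> 2"
    and "2 < p" and "ereal p < critical_exponent CARD('n)"
    and "\<And>n. 0 < \<epsilon> n \<and> \<epsilon> n < 1 / 2" and "\<epsilon> \<longlonglongrightarrow> 0"
    and "\<And>n. positive_solution p (\<epsilon> n) (u n)"
  shows "\<exists>y :: nat \<Rightarrow> real ^ 'n. (\<forall>n. y n \<in> int_lattice) \<and>
    (let w = (\<lambda>n x. u n (x + y n)) in
      \<forall>U :: (real ^ 'n) set.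
        open U \<and> bounded U \<and> cbox (\<chi> i. - 1 / 2) (\<chi> i. 1 / 2) \<subseteq> U \<and>
        frontier U \<inter> int_lattice = {} \<longrightarrow>
        (\<forall>\<delta>. 0 < \<delta> \<and> \<delta> < min (1 / 2) (setdist (U \<inter> int_lattice) (frontier U)) \<longrightarrow>
          (\<lambda>n. (\<Sum>z\<in>U \<inter> int_lattice. H1_energy (ball z \<delta>) (w n)) / H1_energy U (w n))
            \<longlonglongrightarrow> 1 \<and>
          (\<lambda>n. (\<Sum>z\<in>U \<inter> int_lattice. LINT x:ball z \<delta>|lebesgue. \<bar>w n x\<bar> powr p) /
               (LINT x:U|lebesgue. \<bar>w n x\<bar> powr p)) \<longlonglongrightarrow> 1) \<and>
        filterlim (\<lambda>n. H1_norm U (w n)) at_top sequentially)"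
proof -
  note N = assms(1) and p = assms(2,3) and \<epsilon> = assms(4) and \<epsilon>0 = assms(5) and u = assms(6)
  have "\<exists>y\<in>int_lattice. H1_energy (cell y) (u n) \<le> (LINT x:ball y (\<epsilon> n)|lebesgue. u n x powr p)" for n
    using exists_concentration_cell[OF u] \<epsilon>[of n] by metis
  then obtain y where y: "\<And>n. y n \<in> int_lattice"
    "\<And>n. H1_energy (cell (y n)) (u n) \<le> (LINT x:ball (y n) (\<epsilon> n)|lebesgue. u n x powr p)" by metis
  define w where "w = (\<lambda>n x. u n (x + y n))"
  have w: "positive_solution p (\<epsilon> n) (w n)" for n
    unfolding w_def by (rule positive_solution_translate[OF u y(1)])
  have gw: "has_weak_gradient (w n) (weak_grad (w n))" for n by (rule positive_solution_weak_gradient[OF w])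
  have wpos: "w n x > 0" for n x using w[of n] by (simp add: positive_solution_def)
  have wabs: "\<bar>w n x\<bar> powr p = w n x powr p" for n x using wpos[of n x] by simp
  have conc: "H1_energy (cell 0) (w n) \<le> (LINT x:ball 0 (\<epsilon> n)|lebesgue. w n x powr p)" for n
  proof -
    have "u n \<in> H1" using u[of n] by (simp add: positive_solution_def weak_solution_def)
    then have "H1_energy (cell 0) (w n) = H1_energy {x. x - y n \<in> cell 0} (u n)"
      unfolding w_def by (rule H1_energy_translate[OF _ cell_sets])
    also have "{x. x - y n \<in> cell 0} = cell (y n)"
    proof -
      have "(- (1 / 2) \<le> x $ i - y n $ i \<and> x $ i - y n $ i < 1 / 2)
        \<longleftrightarrow> (y n $ i - 1 / 2 \<le> x $ i \<and> x $ i < y n $ i + 1 / 2)" for x i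
        by linarith
      then show ?thesis by (simp add: cell_def)
    qed
    also have "H1_energy (cell (y n)) (u n) \<le> (LINT x:ball (y n) (\<epsilon> n)|lebesgue. u n x powr p)" by (rule y)
    also have "ball (y n) (\<epsilon> n) = {x. x - y n \<in> ball 0 (\<epsilon> n)}" by (auto simp: dist_norm norm_minus_commute)
    also have "(LINT x:{x. x - y n \<in> ball 0 (\<epsilon> n)}|lebesgue. u n x powr p) = (LINT x:ball 0 (\<epsilon> n)|lebesgue. w n x powr p)"
      unfolding w_def by (rule set_integral_translate[symmetric])
    finally show ?thesis .
  qed
  have ev: "\<forall>\<^sub>F n in sequentially. \<epsilon> n < e" if "0 < e" for e
    using order_tendstoD(2)[OF \<epsilon>0 that] .
  have cell_top: "filterlim (\<lambda>n. H1_energy (cell 0) (w n)) at_top sequentially"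
    unfolding filterlim_at_top_gt[where c = 0]
  proof (intro allI impI)
    fix T :: real assume "0 < T"
    then obtain e where "0 < e" and e: "\<And>\<epsilon> u. \<lbrakk>0 < \<epsilon>; \<epsilon> \<le> e; positive_solution p \<epsilon> u;
       H1_energy (cell (0 :: real ^ 'n)) u \<le> (LINT x:ball 0 \<epsilon>|lebesgue. u x powr p)\<rbrakk> \<Longrightarrow> T \<le> H1_energy (cell 0) u"
      by (rule cell_energy_large[OF N p]) blast
    from ev[OF this(1)] show "\<forall>\<^sub>F n in sequentially. T \<le> H1_energy (cell 0) (w n)"
    proof eventually_elim
      case (elim n)
      show ?case by (rule e[OF _ less_imp_le[OF elim] w conc]) (use \<epsilon> in blast)
    qed
  qed
  have Ei: "set_integrable lebesgue S (\<lambda>x. (norm (weak_grad (w n) x))\<^sup>2 + (w n x)\<^sup>2)" if "S \<in> sets lebesgue" for S n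
    using integrable_mult_indicator[OF that H1_energy_integrable[OF gw]] by (simp add: set_integrable_def)
  have E_mono: "H1_energy S (w n) \<le> H1_energy T (w n)" if "S \<in> sets lebesgue" "T \<in> sets lebesgue" "S \<subseteq> T" for S T n
    unfolding H1_energy_def set_lebesgue_integral_def
    using Ei[OF that(1), of n] Ei[OF that(2), of n] that(3)
    by (intro integral_mono) (auto simp: set_integrable_def indicator_def)
  have "(\<forall>\<delta>. 0 < \<delta> \<and> \<delta> < min (1 / 2) (setdist (U \<inter> int_lattice) (frontier U)) \<longrightarrow>
        (\<lambda>n. (\<Sum>z\<in>U \<inter> int_lattice. H1_energy (ball z \<delta>) (w n)) / H1_energy U (w n)) \<longlonglongrightarrow> 1 \<and>
        (\<lambda>n. (\<Sum>z\<in>U \<inter> int_lattice. LINT x:ball z \<delta>|lebesgue. \<bar>w n x\<bar> powr p) /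
             (LINT x:U|lebesgue. \<bar>w n x\<bar> powr p)) \<longlonglongrightarrow> 1) \<and>
      filterlim (\<lambda>n. H1_norm U (w n)) at_top sequentially"
    if U: "open U \<and> bounded U \<and> cbox (\<chi> i. - 1 / 2) (\<chi> i. 1 / 2) \<subseteq> U \<and> frontier U \<inter> int_lattice = {}"
    for U :: "(real ^ 'n) set"
  proof -
    have Us: "U \<in> sets lebesgue" using U by (intro sets_completionI_sets) (auto intro: borel_open)
    \<comment> \<open>The closed cube replaces the half-open cell because
      \<open>energy_le_powr_integral\<close> requires a compact set; inside the open
      \<open>U\<close> it leaves room for a cutoff.\<close>
    let ?Q = "cbox (\<chi> i. - 1 / 2) (\<chi> i. 1 / 2) :: (real ^ 'n) set"
    have Qs: "?Q \<in> sets lebesgue" by (intro sets_completionI_sets) (auto intro: borel_closed)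
    have cellQ: "cell 0 \<subseteq> ?Q" by (auto simp: cell_def mem_box_cart less_imp_le)
    have Q_top: "filterlim (\<lambda>n. H1_energy ?Q (w n)) at_top sequentially"
      by (rule filterlim_at_top_mono[OF cell_top]) (intro always_eventually allI E_mono cell_sets Qs cellQ)
    have U_top: "filterlim (\<lambda>n. H1_energy U (w n)) at_top sequentially"
      by (rule filterlim_at_top_mono[OF Q_top]) (use U in \<open>intro always_eventually allI E_mono Us Qs, auto\<close>)
    obtain D where D: "0 < D" "\<And>\<epsilon> u. positive_solution p \<epsilon> u \<Longrightarrow>
        set_integrable lebesgue U (\<lambda>x. u x powr p) \<and> H1_energy ?Q u \<le> D * (1 + (LINT x:U|lebesgue. u x powr p))"
      by (rule energy_le_powr_integral[OF p(1) compact_cbox, of "\<chi> i. - 1 / 2" "\<chi> i. 1 / 2" U]) (use U in auto)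
    have P_top: "filterlim (\<lambda>n. LINT x:U|lebesgue. w n x powr p) at_top sequentially"
    proof (rule filterlim_at_top_mono)
      have "filterlim (\<lambda>n. - 1 + (1 / D) * H1_energy ?Q (w n)) at_top sequentially"
        using D(1) by (intro filterlim_tendsto_add_at_top[OF tendsto_const] filterlim_tendsto_pos_mult_at_top[OF tendsto_const _ Q_top]) auto
      then show "filterlim (\<lambda>n. - 1 + (1 / D) * H1_energy ?Q (w n)) at_top sequentially" .
      show "\<forall>\<^sub>F n in sequentially. - 1 + (1 / D) * H1_energy ?Q (w n) \<le> (LINT x:U|lebesgue. w n x powr p)"
        using D(1) conjunct2[OF D(2)[OF w]] by (intro always_eventually allI) (simp add: field_simps)
    qed
    have "(\<lambda>n. (\<Sum>z\<in>U \<inter> int_lattice. H1_energy (ball z \<delta>) (w n)) / H1_energy U (w n)) \<longlonglongrightarrow> 1 \<and>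
        (\<lambda>n. (\<Sum>z\<in>U \<inter> int_lattice. LINT x:ball z \<delta>|lebesgue. \<bar>w n x\<bar> powr p) /
             (LINT x:U|lebesgue. \<bar>w n x\<bar> powr p)) \<longlonglongrightarrow> 1"
      if \<delta>: "0 < \<delta> \<and> \<delta> < min (1 / 2) (setdist (U \<inter> int_lattice) (frontier U))" for \<delta>
    proof -
      let ?S = "U \<inter> int_lattice"
      have fin: "finite ?S" using U by (intro finite_int_lattice_bounded) auto
      have dis: "disjoint_family_on (\<lambda>z. ball z \<delta>) ?S"
      proof (unfold disjoint_family_on_def, intro ballI impI)
        fix z z' assume zz: "z \<in> ?S" "z' \<in> ?S" "z \<noteq> z'"
        show "ball z \<delta> \<inter> ball z' \<delta> = {}"
        proof (rule ccontr)
          assume "ball z \<delta> \<inter> ball z' \<delta> \<noteq> {}"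
          then obtain x where "dist z x < \<delta>" "dist z' x < \<delta>" by auto
          then have "dist z z' < 1" using dist_triangle2[of z z' x] \<delta> by linarith
          then have "\<bar>z $ i - z' $ i\<bar> < 1" for i
            using component_le_norm_cart[of "z - z'" i] by (simp add: dist_norm)
          then have "z = z'" using zz by (intro int_lattice_eqI) auto
          then show False using zz by simp
        qed
      qed
      have sub: "ball z \<delta> \<subseteq> U" if "z \<in> ?S" for z
        using \<delta> that by (intro ball_subset_of_setdist_frontier[of z ?S]) auto
      have bm: "ball z \<delta> \<in> sets lebesgue" for z by (intro sets_completionI_sets) auto
      \<comment> \<open>Taking the closure of \<open>U\<close> makes \<open>K\<close> compact. It
        adds no lattice point because the frontier contains none, and the open balls remove those in
        \<open>U\<close>.\<close>
      define K where "K = closure U - (\<Union>z\<in>?S. ball z \<delta>)"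
      have "compact (closure U)" using U by (simp add: compact_closure)
      then have K: "compact K" unfolding K_def by (intro compact_diff) auto
      have Ks: "K \<in> sets lebesgue" using lmeasurable_compact[OF K] by auto
      have KL: "K \<inter> int_lattice = {}"
      proof -
        have "x \<in> U" if "x \<in> closure U" "x \<in> int_lattice" for x
          using U that by (auto simp: frontier_def interior_open)
        then show ?thesis unfolding K_def using \<delta> by force
      qed
      have UK: "U - (\<Union>z\<in>?S. ball z \<delta>) \<subseteq> K" unfolding K_def using closure_subset by blast
      obtain e C where e: "0 < e" and C: "\<And>\<epsilon> u. \<epsilon> < e \<Longrightarrow> positive_solution p \<epsilon> u \<Longrightarrow>
           set_integrable lebesgue K (\<lambda>x. u x powr p) \<and> H1_energy K u \<le> C \<and> (LINT x:K|lebesgue. u x powr p) \<le> C"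
        by (rule local_energy_bound[OF p(1) K KL]) blast
      have h1: "\<forall>\<^sub>F n in sequentially. H1_energy U (w n) - C \<le> (\<Sum>z\<in>?S. H1_energy (ball z \<delta>) (w n)) \<and>
          (\<Sum>z\<in>?S. H1_energy (ball z \<delta>) (w n)) \<le> H1_energy U (w n)"
        using ev[OF e]
      proof eventually_elim
        case (elim n)
        note s = sum_set_integral_bounds[OF fin dis bm sub Us Ei[OF Us, of n] _ UK Ei[OF Ks, of n]]
        have "H1_energy K (w n) \<le> C" using C[OF elim w] by blast
        with s show ?case unfolding H1_energy_def by fastforce
      qed
      have h2: "\<forall>\<^sub>F n in sequentially. (LINT x:U|lebesgue. w n x powr p) - C \<le> (\<Sum>z\<in>?S. LINT x:ball z \<delta>|lebesgue. w n x powr p) \<and>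
          (\<Sum>z\<in>?S. LINT x:ball z \<delta>|lebesgue. w n x powr p) \<le> (LINT x:U|lebesgue. w n x powr p)"
        using ev[OF e]
      proof eventually_elim
        case (elim n)
        have c: "set_integrable lebesgue K (\<lambda>x. w n x powr p)" "(LINT x:K|lebesgue. w n x powr p) \<le> C"
          using C[OF elim w] by blast+
        note s = sum_set_integral_bounds[OF fin dis bm sub Us conjunct1[OF D(2)[OF w]] _ UK c(1)]
        with c(2) show ?case by fastforce
      qed
      show ?thesis
        unfolding wabs by (intro conjI tendsto_ratio_1[OF U_top h1] tendsto_ratio_1[OF P_top h2])
    qed
    moreover have "filterlim (\<lambda>n. H1_norm U (w n)) at_top sequentially"
      unfolding H1_norm_def by (rule filterlim_compose[OF sqrt_at_top U_top])
    ultimately show ?thesis by blast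
  qed
  then show ?thesis using y(1) unfolding Let_def w_def by blast
qed

end
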